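(* Let $\varepsilon>0$, let $u$ be a subsolution and $v$ a supersolution of (HJ$_\varepsilon$). Assume that for each $T>0$, $$\lim_{R\to\infty}\sup\big\{u(t,x)-v(t,x):\ |x|\ge R,\ t\in(0,T]\big\}\le0.$$ Then $u(0,\cdot)\le v(0,\cdot)$ on $\mathbb R$ implies $u\le v$ on $Q$.
   Context: $Q=(0,\infty)\times\mathbb R$, $B_\rho=(-\rho,\rho)$. For $\varepsilon>0$ let $E_\varepsilon(\alpha)=\varepsilon(\lfloor\alpha/\varepsilon\rfloor+\frac12)$; its upper and lower semicontinuous envelopes are $E_\varepsilon^*=E_\varepsilon$ and $E_{\varepsilon,*}(\alpha)=\varepsilon\lceil\alpha/\varepsilon\rceil-\frac\varepsilon2$. $\mathrm{pv}\int_{B_\rho}$ means $\lim_{r\to0}\int_{B_\rho\setminus B_r}$. (HJ$_\varepsilon$) is formally $u_t=\mathcal M_\varepsilon[u]\,|u_x|$ with $\mathcal M_\varepsilon[w](x)=\int_{\mathbb R}E_\varepsilon[w(x+z)-w(x)]\frac{dz}{z^2}$. For $\rho>0$, $u$ bounded, $\phi\in C^2(Q)$ with $\phi_x(t,x)\ne0$, set $$\overline H_{\rho,\varepsilon}[\phi,u](t,x)=|\phi_x(t,x)|\Big(\mathrm{pv}\!\int_{B_\rho}E^*_\varepsilon[\phi(t,x+z)-\phi(t,x)]\tfrac{dz}{z^2}+\int_{\mathbb R\setminus B_\rho}E^*_\varepsilon[u(t,x+z)-u(t,x)]\tfrac{dz}{z^2}\Big),$$ and $\underline H_{\rho,\varepsilon}[\phi,u]$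 by the same formula with $E_{\varepsilon,*}$ in place of $E^*_\varepsilon$. A bounded upper semicontinuous $u:Q\to\mathbb R$ is a subsolution of (HJ$_\varepsilon$) if, whenever $\phi\in C^2(Q)$ and $u-\phi$ has a global maximum at $(\bar t,\bar x)\in Q$: if $\phi_x(\bar t,\bar x)\ne0$ then $\phi_t(\bar t,\bar x)\le\overline H_{\rho,\varepsilon}[\phi,u](\bar t,\bar x)$; if $\phi(t,x)=c|x-\bar x|^4+g(t)$ for some $c\in\mathbb R$ and some $g$, then $\phi_t(\bar t,\bar x)\le0$; otherwise no condition. A bounded lower semicontinuous $v:Q\to\mathbb R$ is a supersolution if, whenever $\psi\in C^2(Q)$ and $v-\psi$ has a global minimum at $(\bar t,\bar x)\in Q$: if $\psi_x(\bar t,\bar x)\ne0$ then $\psi_t(\bar t,\bar x)\ge\underline H_{\rho,\varepsilon}[\psi,v](\bar t,\bar x)$; if $\psi(t,x)=c|x-\bar x|^4+g(t)$ then $\psi_t(\bar t,\bar x)\ge0$; otherwise no condition. These notions do not depend on the choice of $\rho>0$. Subsolutions and supersolutions are extended to $t=0$ by $u(0,x):=u^*(0,x)=\limsup_{Q\ni(s,y)\to(0,x)}u(s,y)$ and $v(0,x):=v_*(0,x)=\liminf_{Q\ni(s,y)\to(0,x)}v(s,y)$. *)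

theory Defs
  imports "HOL-Analysis.Analysis"
begin

text \<open>Points of space-time are pairs \<open>(t, x)\<close>; functions on \<open>Q\<close> are total functions of which only
  the values on \<open>Q\<close> are ever used.\<close>

definition Q :: "(real \<times> real) set" where
  "Q = {0<..} \<times> UNIV"

definition Dt :: "(real \<times> real \<Rightarrow> real) \<Rightarrow> real \<times> real \<Rightarrow> real" where
  "Dt \<phi> = (\<lambda>(t, x). deriv (\<lambda>s. \<phi> (s, x)) t)"

definition Dx :: "(real \<times> real \<Rightarrow> real) \<Rightarrow> real \<times> real \<Rightarrow> real" where
  "Dx \<phi> = (\<lambda>(t, x). deriv (\<lambda>y. \<phi> (t, y)) x)"

definition C1_on :: "(real \<times> real) set \<Rightarrow> (real \<times> real \<Rightarrow> real) \<Rightarrow> bool" where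
  "C1_on S \<phi> \<longleftrightarrow>
     (\<forall>(t, x)\<in>S. (\<lambda>s. \<phi> (s, x)) field_differentiable (at t) \<and>
                 (\<lambda>y. \<phi> (t, y)) field_differentiable (at x)) \<and>
     continuous_on S (Dt \<phi>) \<and> continuous_on S (Dx \<phi>)"

definition C2_on :: "(real \<times> real) set \<Rightarrow> (real \<times> real \<Rightarrow> real) \<Rightarrow> bool" where
  "C2_on S \<phi> \<longleftrightarrow> C1_on S \<phi> \<and> C1_on S (Dt \<phi>) \<and> C1_on S (Dx \<phi>)"

definition usc_on :: "'a::topological_space set \<Rightarrow> ('a \<Rightarrow> real) \<Rightarrow> bool" where
  "usc_on S u \<longleftrightarrow> (\<forall>p\<in>S. \<forall>a. u p < a \<longrightarrow> (\<forall>\<^sub>F q in at p within S. u q < a))"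

definition lsc_on :: "'a::topological_space set \<Rightarrow> ('a \<Rightarrow> real) \<Rightarrow> bool" where
  "lsc_on S v \<longleftrightarrow> (\<forall>p\<in>S. \<forall>a. a < v p \<longrightarrow> (\<forall>\<^sub>F q in at p within S. a < v q))"

text \<open>\<open>E\<^sub>\<epsilon>\<close> is already upper semicontinuous, so \<open>E_up\<close> is both
  \<open>E\<^sub>\<epsilon>\<close> and its upper semicontinuous envelope; \<open>E_lo\<close> is the lower semicontinuous envelope.\<close>

definition E_up :: "real \<Rightarrow> real \<Rightarrow> real" where
  "E_up \<epsilon> \<alpha> = \<epsilon> * (of_int \<lfloor>\<alpha> / \<epsilon>\<rfloor> + 1 / 2)"

definition E_lo :: "real \<Rightarrow> real \<Rightarrow> real" where
  "E_lo \<epsilon> \<alpha> = \<epsilon> * of_int \<lceil>\<alpha> / \<epsilon>\<rceil> - \<epsilon> / 2"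

definition B :: "real \<Rightarrow> real set" where
  "B \<rho> = {-\<rho><..<\<rho>}"

text \<open>For \<open>E = E_up \<epsilon>\<close> or \<open>E_lo \<epsilon>\<close>, \<open>\<phi>\<close> of class C2 with nonzero \<open>x\<close>-derivative at \<open>(t, x)\<close>, the
  integrand of the principal value is odd for small \<open>z\<close>, so the limit exists; outside \<open>B \<rho>\<close> the
  integrand is dominated by a multiple of \<open>1 / z\<^sup>2\<close> when \<open>u\<close> is bounded.\<close>

definition pv_integral :: "real \<Rightarrow> (real \<Rightarrow> real) \<Rightarrow> real" where
  "pv_integral \<rho> f = Lim (at_right 0) (\<lambda>r. LINT z:B \<rho> - B r|lborel. f z)"

definition hamiltonian ::
  "(real \<Rightarrow> real) \<Rightarrow> real \<Rightarrow> (real \<times> real \<Rightarrow> real) \<Rightarrow> (real \<times> real \<Rightarrow> real) \<Rightarrow> real \<times> real \<Rightarrow> real" where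
  "hamiltonian E \<rho> \<phi> u = (\<lambda>(t, x). \<bar>Dx \<phi> (t, x)\<bar> *
     (pv_integral \<rho> (\<lambda>z. E (\<phi> (t, x + z) - \<phi> (t, x)) / z\<^sup>2) +
      (LINT z:- B \<rho>|lborel. E (u (t, x + z) - u (t, x)) / z\<^sup>2)))"

abbreviation H_up ::
  "real \<Rightarrow> real \<Rightarrow> (real \<times> real \<Rightarrow> real) \<Rightarrow> (real \<times> real \<Rightarrow> real) \<Rightarrow> real \<times> real \<Rightarrow> real" where
  "H_up \<rho> \<epsilon> \<equiv> hamiltonian (E_up \<epsilon>) \<rho>"

abbreviation H_lo ::
  "real \<Rightarrow> real \<Rightarrow> (real \<times> real \<Rightarrow> real) \<Rightarrow> (real \<times> real \<Rightarrow> real) \<Rightarrow> real \<times> real \<Rightarrow> real" where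
  "H_lo \<rho> \<epsilon> \<equiv> hamiltonian (E_lo \<epsilon>) \<rho>"

definition subsolution :: "real \<Rightarrow> real \<Rightarrow> (real \<times> real \<Rightarrow> real) \<Rightarrow> bool" where
  "subsolution \<rho> \<epsilon> u \<longleftrightarrow>
     bounded (u ` Q) \<and> usc_on Q u \<and>
     (\<forall>\<phi> tb xb. C2_on Q \<phi> \<and> (tb, xb) \<in> Q \<and>
        (\<forall>p\<in>Q. u p - \<phi> p \<le> u (tb, xb) - \<phi> (tb, xb)) \<longrightarrow>
        (Dx \<phi> (tb, xb) \<noteq> 0 \<longrightarrow> Dt \<phi> (tb, xb) \<le> H_up \<rho> \<epsilon> \<phi> u (tb, xb)) \<and>
        ((\<exists>c g. \<forall>(t, x)\<in>Q. \<phi> (t, x) = c * \<bar>x - xb\<bar> ^ 4 + g t) \<longrightarrow> Dt \<phi> (tb, xb) \<le> 0))"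

definition supersolution :: "real \<Rightarrow> real \<Rightarrow> (real \<times> real \<Rightarrow> real) \<Rightarrow> bool" where
  "supersolution \<rho> \<epsilon> v \<longleftrightarrow>
     bounded (v ` Q) \<and> lsc_on Q v \<and>
     (\<forall>\<psi> tb xb. C2_on Q \<psi> \<and> (tb, xb) \<in> Q \<and>
        (\<forall>p\<in>Q. v p - \<psi> p \<ge> v (tb, xb) - \<psi> (tb, xb)) \<longrightarrow>
        (Dx \<psi> (tb, xb) \<noteq> 0 \<longrightarrow> Dt \<psi> (tb, xb) \<ge> H_lo \<rho> \<epsilon> \<psi> v (tb, xb)) \<and>
        ((\<exists>c g. \<forall>(t, x)\<in>Q. \<psi> (t, x) = c * \<bar>x - xb\<bar> ^ 4 + g t) \<longrightarrow> Dt \<psi> (tb, xb) \<ge> 0))"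

text \<open>The extensions to \<open>t = 0\<close>. They are finite for functions bounded on \<open>Q\<close>; the type \<open>ereal\<close> is
  used because \<open>Limsup\<close> and \<open>Liminf\<close> live on complete lattices.\<close>

definition upper_initial :: "(real \<times> real \<Rightarrow> real) \<Rightarrow> real \<Rightarrow> ereal" where
  "upper_initial u x = Limsup (at (0, x) within Q) (\<lambda>p. ereal (u p))"

definition lower_initial :: "(real \<times> real \<Rightarrow> real) \<Rightarrow> real \<Rightarrow> ereal" where
  "lower_initial v x = Liminf (at (0, x) within Q) (\<lambda>p. ereal (v p))"

end

theory Submission
  imports Defs "HOL-Probability.Sinc_Integral"
begin

text \<open>With \<open>w = - v\<close>, double the variables with the penalty
  \<open>c * (x - y) ^ 4 + k * (t - s)\<^sup>2 + lam * t\<close>.  Since nothing is assumed at infinity on \<open>u (t, x) - v (s, y)\<close> at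
  distinct points, the maximum is taken only over a large box; the local touching is turned
  into a global one by enlarging \<open>c\<close> (if \<open>x = y\<close>) or by gluing the quartic to smooth majorants converging to
  \<open>u\<close> (if \<open>x \<noteq> y\<close>), which also makes the singular part of the integral vanish by oddness.

  Splitting \<open>1 / z\<^sup>2\<close> into a part supported near \<open>0\<close> and a Lipschitz tail, the near part is compared at equal
  increments \<open>z\<close>.  Equality of the increments of \<open>u\<close> and \<open>v\<close>, the only case in which
  the two envelopes of \<open>E\<close> differ in the wrong direction, happens at a jump of \<open>E\<close> for
  countably many \<open>z\<close> only.  The tail is compared at equal points; moving it costs a multiple of
  \<open>c * (x - y) ^ 4\<close>, which is small, and the points outside the box disappear as \<open>k\<close> tends to
  infinity with \<open>c\<close> fixed.\<close>

section \<open>Functions of class C2\<close>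

text \<open>Three features of the definitions shape the argument. The condition at a zero gradient
  is available only for test functions of the form \<open>c * \<bar>x - xb\<bar> ^ 4 + g t\<close>,
  hence the quartic penalty. The nonlocal term is multiplied by the gradient, of size
  \<open>4 * c * \<bar>x - y\<bar> ^ 3\<close>, on which no bound uniform in \<open>c\<close> is
  available; an error is harmless if it carries one more factor \<open>\<bar>x - y\<bar>\<close>,
  because the penalty is small at the maximum. The contribution from outside the box has no such
  factor: it is multiplied by a gradient bound depending on \<open>c\<close>, so \<open>c\<close>
  has to be fixed before the two times are made to coalesce. A change of sign exchanges the two
  envelopes of the step function, so that \<open>u\<close> and \<open>w\<close> are both
  subsolutions and one set of one-sided estimates serves for both. The term \<open>lam * t\<close>
  does double duty: the time slopes of the two touchings add up to \<open>lam\<close>, which the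
  integrals must then dominate, and on a long time interval it excludes a maximum at the final
  time.\<close>

definition C2_real :: "(real \<Rightarrow> real) \<Rightarrow> bool" where
  "C2_real f \<longleftrightarrow> (\<exists>f' f''. (\<forall>x. (f has_field_derivative f' x) (at x)) \<and>
     (\<forall>x. (f' has_field_derivative f'' x) (at x)) \<and> continuous_on UNIV f'')"

lemma has_field_derivative_continuous_UNIV:
  fixes f :: "real \<Rightarrow> real"
  assumes "\<And>x. (f has_field_derivative f' x) (at x)"
  shows "continuous_on UNIV f"
  by (meson DERIV_isCont assms continuous_at_imp_continuous_on)

lemma C2_realI:
  assumes "\<And>x. (f has_field_derivative f' x) (at x)" "\<And>x. (f' has_field_derivative f'' x) (at x)"
    "continuous_on UNIV f''"
  shows "C2_real f"
  using assms unfolding C2_real_def by blast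

lemma C2_realE:
  assumes "C2_real f"
  obtains f' f'' where "\<And>x. (f has_field_derivative f' x) (at x)"
    "\<And>x. (f' has_field_derivative f'' x) (at x)" "continuous_on UNIV f''"
    "continuous_on UNIV f" "continuous_on UNIV f'"
  using assms has_field_derivative_continuous_UNIV unfolding C2_real_def by metis

lemma C2_real_const [simp]: "C2_real (\<lambda>x. c)"
  by (rule C2_realI[where f' = "\<lambda>_. 0" and f'' = "\<lambda>_. 0"]) auto

lemma C2_real_affine [simp]: "C2_real (\<lambda>x. a * x + b)"
  by (rule C2_realI[where f' = "\<lambda>_. a" and f'' = "\<lambda>_. 0"]) (auto intro!: derivative_eq_intros)

lemma C2_real_ident [simp]: "C2_real (\<lambda>x. x)"
  using C2_real_affine[of 1 0] by simp

lemma C2_real_add [intro]: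
  assumes "C2_real f" "C2_real g"
  shows "C2_real (\<lambda>x. f x + g x)"
proof -
  obtain f' f'' where f: "\<And>x. (f has_field_derivative f' x) (at x)"
    "\<And>x. (f' has_field_derivative f'' x) (at x)" "continuous_on UNIV f''"
    by (rule C2_realE[OF assms(1)]) blast
  obtain g' g'' where g: "\<And>x. (g has_field_derivative g' x) (at x)"
    "\<And>x. (g' has_field_derivative g'' x) (at x)" "continuous_on UNIV g''"
    by (rule C2_realE[OF assms(2)]) blast
  show ?thesis
    by (rule C2_realI[where f' = "\<lambda>x. f' x + g' x" and f'' = "\<lambda>x. f'' x + g'' x"])
      (auto intro!: derivative_eq_intros continuous_intros f g)
qed

lemma C2_real_mult [intro]:
  assumes "C2_real f" "C2_real g"
  shows "C2_real (\<lambda>x. f x * g x)"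
proof -
  obtain f' f'' where f: "\<And>x. (f has_field_derivative f' x) (at x)"
    "\<And>x. (f' has_field_derivative f'' x) (at x)" "continuous_on UNIV f''"
    "continuous_on UNIV f" "continuous_on UNIV f'"
    by (rule C2_realE[OF assms(1)]) blast
  obtain g' g'' where g: "\<And>x. (g has_field_derivative g' x) (at x)"
    "\<And>x. (g' has_field_derivative g'' x) (at x)" "continuous_on UNIV g''"
    "continuous_on UNIV g" "continuous_on UNIV g'"
    by (rule C2_realE[OF assms(2)]) blast
  show ?thesis
    by (rule C2_realI[where f' = "\<lambda>x. f' x * g x + f x * g' x"
          and f'' = "\<lambda>x. f'' x * g x + f' x * g' x + (f' x * g' x + f x * g'' x)"])
      (auto intro!: derivative_eq_intros continuous_intros f g)
qed

lemma C2_real_diff [intro]: "C2_real f \<Longrightarrow> C2_real g \<Longrightarrow> C2_real (\<lambda>x. f x - g x)"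
  using C2_real_add[of f "\<lambda>x. -1 * g x"] C2_real_mult[of "\<lambda>_. -1" g] by simp

lemma C2_real_power [intro]: "C2_real f \<Longrightarrow> C2_real (\<lambda>x. f x ^ n)"
  by (induction n) auto

lemma C2_real_inverse [intro]:
  assumes "C2_real f" "\<And>x. f x \<noteq> 0"
  shows "C2_real (\<lambda>x. inverse (f x))"
proof -
  obtain f' f'' where f: "\<And>x. (f has_field_derivative f' x) (at x)"
    "\<And>x. (f' has_field_derivative f'' x) (at x)" "continuous_on UNIV f''"
    "continuous_on UNIV f" "continuous_on UNIV f'"
    by (rule C2_realE[OF assms(1)]) blast
  define g where "g = (\<lambda>x. inverse (f x))"
  define g' where "g' = (\<lambda>x. - (g x * f' x * g x))"
  have g: "(g has_field_derivative g' x) (at x)" for x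
    using DERIV_inverse'[OF f(1) assms(2)] by (simp add: g_def g'_def)
  have "C2_real g"
  proof (rule C2_realI[OF g])
    show "(g' has_field_derivative - (g' x * f' x * g x + g x * f'' x * g x + g x * f' x * g' x)) (at x)" for x
      unfolding g'_def[abs_def]
      by (rule derivative_eq_intros f g refl)+ (simp add: g'_def algebra_simps)
    show "continuous_on UNIV (\<lambda>x. - (g' x * f' x * g x + g x * f'' x * g x + g x * f' x * g' x))"
      unfolding g'_def g_def using assms(2) by (intro continuous_intros f) auto
  qed
  then show ?thesis by (simp add: g_def)
qed

lemma C2_real_compose_affine [intro]:
  assumes "C2_real f"
  shows "C2_real (\<lambda>x. f (a * x + b))"
proof -
  obtain f' f'' where f: "\<And>x. (f has_field_derivative f' x) (at x)"
    "\<And>x. (f' has_field_derivative f'' x) (at x)" "continuous_on UNIV f''"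
    by (rule C2_realE[OF assms]) blast
  have "((\<lambda>x. f (a * x + b)) has_field_derivative f' (a * x + b) * a) (at x)" for x
    by (rule DERIV_chain'[where g = f, OF _ f(1)]) (auto intro!: derivative_eq_intros)
  moreover have "((\<lambda>x. f' (a * x + b) * a) has_field_derivative f'' (a * x + b) * a * a) (at x)" for x
    by (rule DERIV_cmult_right, rule DERIV_chain'[where g = f', OF _ f(2)])
      (auto intro!: derivative_eq_intros)
  moreover have "continuous_on UNIV (\<lambda>x. f'' (a * x + b) * a * a)"
    by (intro continuous_intros continuous_on_compose2[OF f(3)]) auto
  ultimately show ?thesis by (rule C2_realI)
qed

section \<open>Cutoff functions of class C2\<close>

lemma DERIV_pos_part_power:
  "((\<lambda>x::real. max 0 x ^ Suc (Suc n)) has_field_derivative real (n + 2) * max 0 x ^ Suc n) (at x)"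
proof -
  consider "x < 0" | "x = 0" | "x > 0" by linarith
  then show ?thesis
  proof cases
    case 1
    have "((\<lambda>x::real. 0) has_field_derivative real (n + 2) * max 0 x ^ Suc n) (at x)"
      using 1 by simp
    then show ?thesis
      by (rule has_field_derivative_transform_within_open[where S = "{..<0}"]) (use 1 in auto)
  next
    case 3
    have "((\<lambda>x::real. x ^ Suc (Suc n)) has_field_derivative real (n + 2) * max 0 x ^ Suc n) (at x)"
      using DERIV_pow[of "Suc (Suc n)" x] 3 by (simp add: max_def)
    then show ?thesis
      by (rule has_field_derivative_transform_within_open[where S = "{0<..}"]) (use 3 in auto)
  next
    case 2
    have "((\<lambda>h::real. max 0 h ^ Suc (Suc n) / h) \<longlongrightarrow> 0) (at 0)"
    proof (rule Lim_null_comparison[where g = "\<lambda>h. \<bar>h\<bar> ^ Suc n"])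
      show "\<forall>\<^sub>F h in at 0. norm (max 0 h ^ Suc (Suc n) / h) \<le> \<bar>h\<bar> ^ Suc n"
      proof (intro always_eventually allI)
        show "norm (max 0 h ^ Suc (Suc n) / h) \<le> \<bar>h\<bar> ^ Suc n" for h :: real
          by (cases "h > 0") (simp_all add: max_def mult_nonpos_nonneg)
      qed
      show "((\<lambda>h::real. \<bar>h\<bar> ^ Suc n) \<longlongrightarrow> 0) (at 0)"
        by (rule tendsto_eq_intros | simp)+
    qed
    then show ?thesis using 2 by (simp add: DERIV_def)
  qed
qed

lemma C2_real_pos_part_cubed: "C2_real (\<lambda>x. max 0 x ^ 3)"
proof (rule C2_realI)
  show "((\<lambda>x. max 0 x ^ 3) has_field_derivative 3 * max 0 x ^ 2) (at x)" for x :: real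
    using DERIV_pos_part_power[of 1 x] by (simp add: numeral_eq_Suc)
  show "((\<lambda>x. 3 * max 0 x ^ 2) has_field_derivative 3 * (2 * max 0 x)) (at x)" for x :: real
    by (rule DERIV_cmult) (use DERIV_pos_part_power[of 0 x] in \<open>simp add: numeral_eq_Suc\<close>)
  show "continuous_on UNIV (\<lambda>x::real. 3 * (2 * max 0 x))"
    by (intro continuous_intros)
qed

text \<open>A quotient \<open>a / (a + b)\<close> of one-sided cubes. Cubes of positive parts are of
  class C2, and at every point at least one of the two is positive; the result is a C2 transition
  that is constant outside the unit interval.\<close>

definition smoothstep :: "real \<Rightarrow> real" where
  "smoothstep x = max 0 x ^ 3 * inverse (max 0 x ^ 3 + max 0 (1 - x) ^ 3)"

lemma smoothstep_denominator: "max 0 x ^ 3 + max 0 (1 - x) ^ 3 > (0::real)"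
proof (cases "x > 0")
  case True
  then show ?thesis by (intro add_pos_nonneg) auto
next
  case False
  then show ?thesis by (intro add_nonneg_pos) auto
qed

lemma C2_real_smoothstep: "C2_real smoothstep"
proof -
  have "C2_real (\<lambda>x::real. max 0 (1 - x) ^ 3)"
    using C2_real_compose_affine[OF C2_real_pos_part_cubed, of "-1" 1] by simp
  then have "C2_real (\<lambda>x. max 0 x ^ 3 * inverse (max 0 x ^ 3 + max 0 (1 - x) ^ 3))"
    using smoothstep_denominator
    by (intro C2_real_mult C2_real_inverse C2_real_add C2_real_pos_part_cubed) (auto simp: less_le)
  then show ?thesis by (simp add: smoothstep_def[abs_def])
qed

lemma smoothstep_eq_0: "x \<le> 0 \<Longrightarrow> smoothstep x = 0"
  by (simp add: smoothstep_def)

lemma smoothstep_eq_1: "x \<ge> 1 \<Longrightarrow> smoothstep x = 1"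
  by (simp add: smoothstep_def)

lemma smoothstep_nonneg: "smoothstep x \<ge> 0"
  using smoothstep_denominator[of x] by (simp add: smoothstep_def)

lemma smoothstep_le_1: "smoothstep x \<le> 1"
  using smoothstep_denominator[of x] by (simp add: smoothstep_def field_simps)

text \<open>\<open>a / (a + b)\<close> increases with \<open>a\<close> and decreases with
  \<open>b\<close>; cross-multiplied, this is \<open>a * b' \<le> a' * b\<close>.\<close>

lemma smoothstep_mono:
  assumes "x \<le> y"
  shows "smoothstep x \<le> smoothstep y"
proof -
  define a b a' b' :: real where
    "a = max 0 x ^ 3" and "b = max 0 (1 - x) ^ 3" and "a' = max 0 y ^ 3" and "b' = max 0 (1 - y) ^ 3"
  have "0 \<le> a" "0 \<le> b'" "a \<le> a'" "b' \<le> b"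
    using assms unfolding a_def b_def a'_def b'_def by (auto intro!: power_mono)
  moreover have "a + b > 0" "a' + b' > 0"
    unfolding a_def b_def a'_def b'_def by (rule smoothstep_denominator)+
  moreover have "a * b' \<le> a' * b"
    using calculation by (intro mult_mono) auto
  ultimately have "a / (a + b) \<le> a' / (a' + b')"
    by (simp add: field_simps)
  then show ?thesis by (simp add: smoothstep_def a_def b_def a'_def b'_def divide_inverse)
qed

text \<open>\<open>C1_on\<close> speaks only of partial derivatives. Carrying the continuity of
  \<open>f\<close> itself lets the product rule produce continuous partial derivatives at
  once.\<close>

definition C1_plane :: "(real \<times> real \<Rightarrow> real) \<Rightarrow> bool" where
  "C1_plane f \<longleftrightarrow> continuous_on UNIV f \<and> C1_on UNIV f"

definition C2_plane :: "(real \<times> real \<Rightarrow> real) \<Rightarrow> bool" where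
  "C2_plane f \<longleftrightarrow> C1_plane f \<and> C1_plane (Dt f) \<and> C1_plane (Dx f)"

lemma C2_plane_imp_C2_on: "C2_plane f \<Longrightarrow> C2_on S f"
  unfolding C2_plane_def C1_plane_def C2_on_def C1_on_def
  by (auto intro: continuous_on_subset)

lemma C1_planeD:
  assumes "C1_plane f"
  shows "continuous_on UNIV f" "continuous_on UNIV (Dt f)" "continuous_on UNIV (Dx f)"
    "((\<lambda>s. f (s, x)) has_field_derivative Dt f (t, x)) (at t)"
    "((\<lambda>y. f (t, y)) has_field_derivative Dx f (t, x)) (at x)"
  using assms
  by (auto simp: C1_plane_def C1_on_def Dt_def Dx_def field_differentiable_derivI)

lemma C1_planeI:
  assumes "continuous_on UNIV f" "continuous_on UNIV ft" "continuous_on UNIV fx"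
    and "\<And>t x. ((\<lambda>s. f (s, x)) has_field_derivative ft (t, x)) (at t)"
    and "\<And>t x. ((\<lambda>y. f (t, y)) has_field_derivative fx (t, x)) (at x)"
  shows "C1_plane f" "Dt f = ft" "Dx f = fx"
proof -
  show t: "Dt f = ft" and x: "Dx f = fx"
    using assms by (auto simp: Dt_def Dx_def fun_eq_iff intro!: DERIV_imp_deriv)
  show "C1_plane f"
    unfolding C1_plane_def C1_on_def t x field_differentiable_def using assms by blast
qed

lemma C1_plane_add:
  assumes "C1_plane f" "C1_plane g"
  shows "C1_plane (\<lambda>p. f p + g p)" "Dt (\<lambda>p. f p + g p) = (\<lambda>p. Dt f p + Dt g p)"
    "Dx (\<lambda>p. f p + g p) = (\<lambda>p. Dx f p + Dx g p)"
  using assms[THEN C1_planeD(1)] assms[THEN C1_planeD(2)] assms[THEN C1_planeD(3)]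
    assms[THEN C1_planeD(4)] assms[THEN C1_planeD(5)]
  by (intro C1_planeI[where ft = "\<lambda>p. Dt f p + Dt g p" and fx = "\<lambda>p. Dx f p + Dx g p"]
      continuous_intros DERIV_add; simp)+

lemma C1_plane_mult:
  assumes "C1_plane f" "C1_plane g"
  shows "C1_plane (\<lambda>p. f p * g p)" "Dt (\<lambda>p. f p * g p) = (\<lambda>p. Dt f p * g p + Dt g p * f p)"
    "Dx (\<lambda>p. f p * g p) = (\<lambda>p. Dx f p * g p + Dx g p * f p)"
  using assms[THEN C1_planeD(1)] assms[THEN C1_planeD(2)] assms[THEN C1_planeD(3)]
    assms[THEN C1_planeD(4)] assms[THEN C1_planeD(5)]
  by (intro C1_planeI[where ft = "\<lambda>p. Dt f p * g p + Dt g p * f p"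
        and fx = "\<lambda>p. Dx f p * g p + Dx g p * f p"]
      continuous_intros DERIV_mult; simp)+

lemma C2_plane_add: "C2_plane f \<Longrightarrow> C2_plane g \<Longrightarrow> C2_plane (\<lambda>p. f p + g p)"
  by (simp add: C2_plane_def C1_plane_add)

lemma C2_plane_mult: "C2_plane f \<Longrightarrow> C2_plane g \<Longrightarrow> C2_plane (\<lambda>p. f p * g p)"
  by (simp add: C2_plane_def C1_plane_add C1_plane_mult)

lemma C1_plane_fst:
  assumes "\<And>x. (f has_field_derivative f' x) (at x)" "continuous_on UNIV f'"
  shows "C1_plane (\<lambda>p. f (fst p))" "Dt (\<lambda>p. f (fst p)) = (\<lambda>p. f' (fst p))"
    "Dx (\<lambda>p. f (fst p)) = (\<lambda>p. 0)"
  using assms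
  by (intro C1_planeI[where ft = "\<lambda>p. f' (fst p)" and fx = "\<lambda>p. 0"]
      continuous_on_compose2[OF has_field_derivative_continuous_UNIV[OF assms(1)]]
      continuous_on_compose2[OF assms(2)] continuous_intros; simp)+

lemma C1_plane_snd:
  assumes "\<And>x. (f has_field_derivative f' x) (at x)" "continuous_on UNIV f'"
  shows "C1_plane (\<lambda>p. f (snd p))" "Dt (\<lambda>p. f (snd p)) = (\<lambda>p. 0)"
    "Dx (\<lambda>p. f (snd p)) = (\<lambda>p. f' (snd p))"
  using assms
  by (intro C1_planeI[where fx = "\<lambda>p. f' (snd p)" and ft = "\<lambda>p. 0"]
      continuous_on_compose2[OF has_field_derivative_continuous_UNIV[OF assms(1)]]
      continuous_on_compose2[OF assms(2)] continuous_intros; simp)+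

lemma C1_plane_const: "C1_plane (\<lambda>p. c)"
  using C1_plane_fst(1)[of "\<lambda>_. c" "\<lambda>_. 0"] by simp

lemma C2_plane_fst:
  assumes "C2_real f"
  shows "C2_plane (\<lambda>p. f (fst p))"
proof -
  obtain f' f'' where f: "\<And>x. (f has_field_derivative f' x) (at x)"
    "\<And>x. (f' has_field_derivative f'' x) (at x)" "continuous_on UNIV f''" "continuous_on UNIV f'"
    by (rule C2_realE[OF assms]) blast
  show ?thesis
    unfolding C2_plane_def C1_plane_fst(2,3)[OF f(1,4)]
    using C1_plane_fst(1)[OF f(1,4)] C1_plane_fst(1)[OF f(2,3)] C1_plane_const by simp
qed

lemma C2_plane_snd:
  assumes "C2_real f"
  shows "C2_plane (\<lambda>p. f (snd p))"
proof -
  obtain f' f'' where f: "\<And>x. (f has_field_derivative f' x) (at x)"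
    "\<And>x. (f' has_field_derivative f'' x) (at x)" "continuous_on UNIV f''" "continuous_on UNIV f'"
    by (rule C2_realE[OF assms]) blast
  show ?thesis
    unfolding C2_plane_def C1_plane_snd(2,3)[OF f(1,4)]
    using C1_plane_snd(1)[OF f(1,4)] C1_plane_snd(1)[OF f(2,3)] C1_plane_const by simp
qed

lemma C2_plane_const [simp]: "C2_plane (\<lambda>p. c)"
  using C2_plane_fst[of "\<lambda>_. c"] by simp

lemma C2_plane_sum:
  assumes "\<And>i. i \<in> I \<Longrightarrow> C2_plane (f i)"
  shows "C2_plane (\<lambda>p. \<Sum>i\<in>I. f i p)"
  using assms by (induction I rule: infinite_finite_induct) (auto intro!: C2_plane_add)

section \<open>Semicontinuity and the step function\<close>

text \<open>This symmetry is what makes the negative of a supersolution a subsolution; it allows all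
  estimates to be made for \<open>E_up\<close> alone.\<close>

lemma E_lo_conv_E_up: "E_lo \<epsilon> a = - E_up \<epsilon> (- a)"
  by (simp add: E_lo_def E_up_def ceiling_def algebra_simps)

lemma E_up_mono: "\<epsilon> > 0 \<Longrightarrow> a \<le> b \<Longrightarrow> E_up \<epsilon> a \<le> E_up \<epsilon> b"
  by (simp add: E_up_def floor_mono divide_right_mono)

lemma abs_E_up_le:
  assumes "\<epsilon> > 0"
  shows "\<bar>E_up \<epsilon> a\<bar> \<le> \<bar>a\<bar> + \<epsilon> / 2"
proof -
  have "\<epsilon> * of_int \<lfloor>a / \<epsilon>\<rfloor> \<le> \<epsilon> * (a / \<epsilon>)" "\<epsilon> * (a / \<epsilon>) \<le> \<epsilon> * (of_int \<lfloor>a / \<epsilon>\<rfloor> + 1)"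
    using assms by (intro mult_left_mono; linarith)+
  then have "\<epsilon> * of_int \<lfloor>a / \<epsilon>\<rfloor> \<le> a" "a \<le> \<epsilon> * of_int \<lfloor>a / \<epsilon>\<rfloor> + \<epsilon>"
    using assms by (simp_all add: distrib_left)
  then show ?thesis unfolding E_up_def distrib_left by linarith
qed

lemma E_up_eq_half:
  assumes "0 \<le> a" "a < \<epsilon>"
  shows "E_up \<epsilon> a = \<epsilon> / 2"
proof -
  have "\<lfloor>a / \<epsilon>\<rfloor> = 0" using assms by (simp add: floor_eq_iff)
  then show ?thesis by (simp add: E_up_def)
qed

lemma E_up_eq_minus_half:
  assumes "- \<epsilon> \<le> a" "a < 0"
  shows "E_up \<epsilon> a = - \<epsilon> / 2"
proof -
  have "\<lfloor>a / \<epsilon>\<rfloor> = -1" using assms by (simp add: floor_eq_iff field_simps)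
  then show ?thesis by (simp add: E_up_def algebra_simps)
qed

text \<open>The sum is \<open>\<epsilon>\<close> times the sum of the two floors plus 1, so the
  floors must add up to at most -1. Superadditivity of the floor gives this if
  \<open>a + b < 0\<close>; opposite numbers that are not integers have floors adding up to exactly
  -1. For opposite multiples of \<open>\<epsilon>\<close> the sum is \<open>\<epsilon>\<close>, the
  case excluded by the last premise.\<close>

lemma E_up_add_nonpos:
  assumes "\<epsilon> > 0" "a + b \<le> 0" "a + b < 0 \<or> a / \<epsilon> \<notin> \<int>"
  shows "E_up \<epsilon> a + E_up \<epsilon> b \<le> 0"
proof -
  have le: "\<lfloor>a / \<epsilon>\<rfloor> + \<lfloor>b / \<epsilon>\<rfloor> \<le> -1"
  proof (cases "a + b < 0")
    case True
    have "\<lfloor>a / \<epsilon>\<rfloor> + \<lfloor>b / \<epsilon>\<rfloor> \<le> \<lfloor>a / \<epsilon> + b / \<epsilon>\<rfloor>" by (rule le_floor_add)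
    also have "\<dots> < 0"
      using True assms(1) by (simp flip: add_divide_distrib add: divide_neg_pos)
    finally show ?thesis by simp
  next
    case False
    then have b: "b / \<epsilon> = - (a / \<epsilon>)" using assms(2) by (metis add_eq_0_iff not_less_iff_gr_or_eq order_le_less minus_divide_left)
    have "of_int \<lfloor>a / \<epsilon>\<rfloor> \<noteq> a / \<epsilon>" using False assms(3) by (metis Ints_of_int)
    then have "of_int \<lfloor>a / \<epsilon>\<rfloor> < a / \<epsilon>" using of_int_floor_le[of "a / \<epsilon>"] by linarith
    moreover have "of_int \<lfloor>b / \<epsilon>\<rfloor> \<le> - (a / \<epsilon>)" using of_int_floor_le[of "b / \<epsilon>"] b by simp
    ultimately have "real_of_int (\<lfloor>a / \<epsilon>\<rfloor> + \<lfloor>b / \<epsilon>\<rfloor>) < 0" by simp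
    then show ?thesis by linarith
  qed
  have "E_up \<epsilon> a + E_up \<epsilon> b = \<epsilon> * (of_int (\<lfloor>a / \<epsilon>\<rfloor> + \<lfloor>b / \<epsilon>\<rfloor>) + 1)"
    by (simp add: E_up_def algebra_simps)
  also have "\<dots> \<le> 0"
    using le assms(1) by (intro mult_nonneg_nonpos) auto
  finally show ?thesis .
qed

text \<open>\<open>E_up\<close> is a right-continuous step function. This is why \<open>u\<close> is
  approximated by majorants: increments approached from above pass to the limit inside
  \<open>E_up\<close>.\<close>

lemma E_up_tendsto_from_above:
  assumes "\<epsilon> > 0" "X \<longlonglongrightarrow> l" "\<And>n. l \<le> X n"
  shows "(\<lambda>n. E_up \<epsilon> (X n)) \<longlonglongrightarrow> E_up \<epsilon> l"
proof (rule tendsto_eventually)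
  define b where "b = \<epsilon> * (of_int \<lfloor>l / \<epsilon>\<rfloor> + 1)"
  have "l / \<epsilon> < of_int \<lfloor>l / \<epsilon>\<rfloor> + 1" by linarith
  then have "l < b" using assms(1) by (simp add: b_def field_simps)
  then have "\<forall>\<^sub>F n in sequentially. X n < b" using assms(2) by (rule order_tendstoD(2)[rotated])
  then show "\<forall>\<^sub>F n in sequentially. E_up \<epsilon> (X n) = E_up \<epsilon> l"
  proof eventually_elim
    case (elim n)
    then have "X n / \<epsilon> < of_int \<lfloor>l / \<epsilon>\<rfloor> + 1" "l / \<epsilon> \<le> X n / \<epsilon>"
      using assms(1,3) by (simp_all add: b_def field_simps divide_right_mono)
    then have "\<lfloor>X n / \<epsilon>\<rfloor> = \<lfloor>l / \<epsilon>\<rfloor>" by linarith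
    then show ?case by (simp add: E_up_def)
  qed
qed

lemma borel_measurable_E_up [measurable]: "E_up \<epsilon> \<in> borel_measurable borel"
  unfolding E_up_def[abs_def] by measurable

section \<open>Upper semicontinuity on metric spaces and compactness\<close>

lemma usc_onD:
  fixes u :: "'a::metric_space \<Rightarrow> real"
  assumes "usc_on S u" "p \<in> S" "u p < a"
  obtains r where "r > 0" "\<And>q. q \<in> S \<Longrightarrow> dist q p < r \<Longrightarrow> u q < a"
proof -
  have "\<forall>\<^sub>F q in at p within S. u q < a" using assms by (auto simp: usc_on_def)
  then obtain r where "r > 0" "\<forall>q\<in>S. q \<noteq> p \<and> dist q p < r \<longrightarrow> u q < a"
    unfolding eventually_at by blast
  then show ?thesis using that assms(3) by metis
qed

lemma usc_onI:
  fixes u :: "'a::metric_space \<Rightarrow> real"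
  assumes "\<And>p a. p \<in> S \<Longrightarrow> u p < a \<Longrightarrow> \<exists>r>0. \<forall>q\<in>S. dist q p < r \<longrightarrow> u q < a"
  shows "usc_on S u"
  unfolding usc_on_def eventually_at by (intro ballI allI impI) (metis assms)

lemma usc_on_subset: "usc_on S u \<Longrightarrow> T \<subseteq> S \<Longrightarrow> usc_on T (u :: 'a::metric_space \<Rightarrow> real)"
  by (rule usc_onI) (metis usc_onD subsetD)

lemma usc_on_sequentially:
  fixes u :: "'a::metric_space \<Rightarrow> real"
  assumes "usc_on S u" "\<And>n. X n \<in> S" "X \<longlonglongrightarrow> l" "l \<in> S" "u l < a"
  shows "\<forall>\<^sub>F n in sequentially. u (X n) < a"
proof -
  obtain r where r: "r > 0" "\<And>q. q \<in> S \<Longrightarrow> dist q l < r \<Longrightarrow> u q < a"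
    using usc_onD[OF assms(1,4,5)] by blast
  have "\<forall>\<^sub>F n in sequentially. dist (X n) l < r" using assms(3) r(1) by (rule tendstoD)
  then show ?thesis by eventually_elim (use r assms(2) in auto)
qed

lemma usc_on_add:
  fixes u v :: "'a::metric_space \<Rightarrow> real"
  assumes "usc_on S u" "usc_on S v"
  shows "usc_on S (\<lambda>p. u p + v p)"
proof (rule usc_onI)
  fix p a assume p: "p \<in> S" and a: "u p + v p < a"
  define d where "d = (a - (u p + v p)) / 2"
  have "d > 0" using a by (simp add: d_def)
  then obtain r1 r2 where "r1 > 0" "\<And>q. q \<in> S \<Longrightarrow> dist q p < r1 \<Longrightarrow> u q < u p + d"
    and "r2 > 0" "\<And>q. q \<in> S \<Longrightarrow> dist q p < r2 \<Longrightarrow> v q < v p + d"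
    using usc_onD[OF assms(1) p, of "u p + d"] usc_onD[OF assms(2) p, of "v p + d"]
    by (metis less_add_same_cancel1)
  moreover have "u q + v q < a" if "u q < u p + d" "v q < v p + d" for q
    using that by (simp add: d_def field_simps)
  ultimately show "\<exists>r>0. \<forall>q\<in>S. dist q p < r \<longrightarrow> u q + v q < a"
    by (intro exI[of _ "min r1 r2"]) auto
qed

lemma continuous_on_imp_usc_on:
  fixes f :: "'a::metric_space \<Rightarrow> real"
  assumes "continuous_on S f"
  shows "usc_on S f"
  unfolding usc_on_def
proof (intro ballI allI impI)
  fix p a assume "p \<in> S" "f p < a"
  then have "(f \<longlongrightarrow> f p) (at p within S)" using assms by (auto simp: continuous_on_def)
  then show "\<forall>\<^sub>F q in at p within S. f q < a" using \<open>f p < a\<close> by (rule order_tendstoD(2))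
qed

lemma usc_on_compose:
  fixes u :: "'b::metric_space \<Rightarrow> real" and f :: "'a::metric_space \<Rightarrow> 'b"
  assumes "usc_on T u" "continuous_on S f" "f ` S \<subseteq> T"
  shows "usc_on S (\<lambda>p. u (f p))"
proof (rule usc_onI)
  fix p a assume p: "p \<in> S" and a: "u (f p) < a"
  then obtain r where r: "r > 0" "\<And>q. q \<in> T \<Longrightarrow> dist q (f p) < r \<Longrightarrow> u q < a"
    using usc_onD[OF assms(1), of "f p" a] assms(3) by auto
  then obtain d where "d > 0" "\<forall>q\<in>S. dist q p < d \<longrightarrow> dist (f q) (f p) < r"
    using assms(2) p unfolding continuous_on_iff by metis
  then show "\<exists>r>0. \<forall>q\<in>S. dist q p < r \<longrightarrow> u (f q) < a"
    using r(2) assms(3) by (metis imageI subsetD)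
qed

lemma usc_on_attains_sup:
  fixes f :: "'a::metric_space \<Rightarrow> real"
  assumes "compact K" "K \<noteq> {}" "usc_on K f" "bdd_above (f ` K)"
  obtains p where "p \<in> K" "\<And>q. q \<in> K \<Longrightarrow> f q \<le> f p"
proof -
  define s where "s = Sup (f ` K)"
  have le: "f q \<le> s" if "q \<in> K" for q
    unfolding s_def using that assms(4) by (intro cSup_upper) auto
  have "\<exists>q\<in>K. s - 1 / Suc n < f q" for n
    using less_cSup_iff[of "f ` K" "s - 1 / Suc n"] assms(2,4) by (auto simp: s_def)
  then obtain X where X: "\<And>n. X n \<in> K" "\<And>n. s - 1 / Suc n < f (X n)" by metis
  obtain l \<phi> where l: "l \<in> K" "strict_mono \<phi>" "(X \<circ> \<phi>) \<longlonglongrightarrow> l"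
    using assms(1) X(1) unfolding compact_def by meson
  have "f l \<ge> s"
  proof (rule ccontr)
    assume "\<not> f l \<ge> s"
    then obtain a where a: "f l < a" "a < s" using dense by (metis not_le)
    have "\<forall>\<^sub>F n in sequentially. f ((X \<circ> \<phi>) n) < a"
      by (rule usc_on_sequentially[OF assms(3) _ l(3,1) a(1)]) (simp add: X)
    moreover have "(\<lambda>n. s - 1 / Suc (\<phi> n)) \<longlonglongrightarrow> s - 0"
      using LIMSEQ_subseq_LIMSEQ[OF LIMSEQ_inverse_real_of_nat l(2)]
      by (intro tendsto_diff tendsto_const) (simp add: o_def inverse_eq_divide)
    then have "\<forall>\<^sub>F n in sequentially. a < s - 1 / Suc (\<phi> n)"
      using a by (intro order_tendstoD(1)[where y = "s - 0"]) auto
    ultimately have "\<forall>\<^sub>F n in sequentially. False"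
      by eventually_elim (use X(2) in \<open>force simp: o_def dest: less_trans\<close>)
    then show False by simp
  qed
  then show ?thesis using that l(1) le by (meson order_trans)
qed

text \<open>Points violating the bound at distances tending to 0 would accumulate at a diagonal
  point, where semicontinuity contradicts them. It replaces uniform continuity when facts about a
  single point are transferred to the doubled variables.\<close>

lemma usc_on_less_near_diagonal:
  fixes F :: "'a::metric_space \<times> 'a \<Rightarrow> real"
  assumes "compact K" "usc_on K F" "\<And>p. (p, p) \<in> K \<Longrightarrow> F (p, p) < c"
  obtains \<eta> where "\<eta> > 0" "\<And>p q. (p, q) \<in> K \<Longrightarrow> dist p q \<le> \<eta> \<Longrightarrow> F (p, q) < c"
proof -
  have "\<exists>\<eta>>0. \<forall>p q. (p, q) \<in> K \<longrightarrow> dist p q \<le> \<eta> \<longrightarrow> F (p, q) < c"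
  proof (rule ccontr)
    assume neg: "\<not> ?thesis"
    have "\<exists>z\<in>K. dist (fst z) (snd z) \<le> inverse (real (Suc n)) \<and> F z \<ge> c" for n
    proof -
      have "inverse (real (Suc n)) > 0" by simp
      then show ?thesis using neg by (metis fst_conv snd_conv not_le)
    qed
    then obtain X where X: "\<And>n. X n \<in> K" "\<And>n. F (X n) \<ge> c"
      "\<And>n. dist (fst (X n)) (snd (X n)) \<le> inverse (real (Suc n))" by metis
    obtain l \<phi> where l: "l \<in> K" "strict_mono \<phi>" "(X \<circ> \<phi>) \<longlonglongrightarrow> l"
      using assms(1) X(1) unfolding compact_def by meson
    have "(\<lambda>n. dist (fst ((X \<circ> \<phi>) n)) (snd ((X \<circ> \<phi>) n))) \<longlonglongrightarrow> dist (fst l) (snd l)"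
      using l(3) by (intro tendsto_intros)
    moreover have "(\<lambda>n. inverse (real (Suc (\<phi> n)))) \<longlonglongrightarrow> 0"
      using LIMSEQ_subseq_LIMSEQ[OF LIMSEQ_inverse_real_of_nat l(2)] by (simp add: o_def)
    ultimately have "dist (fst l) (snd l) \<le> 0"
      by (rule LIMSEQ_le) (use X(3) in \<open>auto simp: o_def\<close>)
    then have "F l < c" using assms(3)[of "fst l"] l(1) by (cases l) auto
    from usc_on_sequentially[OF assms(2) _ l(3,1) this]
    have "\<forall>\<^sub>F n in sequentially. F ((X \<circ> \<phi>) n) < c" by (simp add: X)
    then obtain n where "F ((X \<circ> \<phi>) n) < c" by (metis eventually_happens' sequentially_bot)
    then show False using X(2)[of "\<phi> n"] by simp
  qed
  then show ?thesis using that by blast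
qed

section \<open>The half-plane \<open>Q\<close> and the extension to the initial line\<close>

lemma open_Q: "open Q"
  unfolding Q_def by (intro open_Times) auto

lemma borel_measurable_usc_slice:
  assumes "usc_on Q u" "t > 0"
  shows "(\<lambda>x. u (t, x)) \<in> borel_measurable borel"
proof (rule borel_measurable_iff_less[THEN iffD2], intro allI)
  fix a
  have "usc_on UNIV (\<lambda>x. u (t, x))"
    by (rule usc_on_compose[OF assms(1)]) (use assms(2) in \<open>auto simp: Q_def intro!: continuous_intros\<close>)
  then have "open {x. u (t, x) < a}"
    unfolding open_dist by (auto elim!: usc_onD)
  then show "{x \<in> space borel. u (t, x) < a} \<in> sets borel" by simp
qed

text \<open>With the initial line included, maxima can be taken over compact boxes. The conversion
  to \<open>real\<close> is faithful for bounded \<open>u\<close>; the values at negative times are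
  irrelevant, as every use is at nonnegative ones.\<close>

definition initial_ext :: "(real \<times> real \<Rightarrow> real) \<Rightarrow> real \<times> real \<Rightarrow> real" where
  "initial_ext u p = (if fst p > 0 then u p else real_of_ereal (upper_initial u (snd p)))"

text \<open>Along a trivial filter \<open>Limsup\<close> would be minus infinity, so the lower bound
  for the initial values rests on this.\<close>

lemma at_initial_neq_bot: "at (0, x) within Q \<noteq> bot"
proof -
  have "(0, x) islimpt Q"
    unfolding islimpt_approachable
  proof (intro allI impI)
    fix e :: real assume "e > 0"
    then show "\<exists>x'\<in>Q. x' \<noteq> (0, x) \<and> dist x' (0, x) < e"
      by (intro bexI[of _ "(e / 2, x)"]) (auto simp: Q_def dist_Pair_Pair)
  qed
  then show ?thesis by (simp add: trivial_limit_within)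
qed

lemma upper_initial_finite:
  assumes "\<forall>p\<in>Q. \<bar>u p\<bar> \<le> C"
  shows "ereal (- C) \<le> upper_initial u x" "upper_initial u x \<le> ereal C"
proof -
  have ev: "\<forall>\<^sub>F p in at (0, x) within Q. \<bar>u p\<bar> \<le> C"
    using assms by (auto simp: eventually_at_filter)
  show "upper_initial u x \<le> ereal C"
    unfolding upper_initial_def by (rule Limsup_bounded) (use ev in \<open>auto elim!: eventually_mono\<close>)
  show "ereal (- C) \<le> upper_initial u x"
    unfolding upper_initial_def
    by (rule le_Limsup[OF at_initial_neq_bot]) (use ev in \<open>auto elim!: eventually_mono\<close>)
qed

lemma initial_ext_eq:
  assumes "\<forall>p\<in>Q. \<bar>u p\<bar> \<le> C"
  shows "ereal (initial_ext u (0, x)) = upper_initial u x"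
  using upper_initial_finite[OF assms, of x] by (auto simp: initial_ext_def ereal_real)

lemma abs_initial_ext_le:
  assumes "\<forall>p\<in>Q. \<bar>u p\<bar> \<le> C" "fst p \<ge> 0"
  shows "\<bar>initial_ext u p\<bar> \<le> C"
proof (cases "fst p > 0")
  case True
  then show ?thesis using assms(1) by (cases p) (auto simp: initial_ext_def Q_def)
next
  case False
  then have p: "p = (0, snd p)" using assms(2) by (cases p) auto
  show ?thesis
    using upper_initial_finite[OF assms(1), of "snd p"] p
    by (subst p) (simp flip: initial_ext_eq[OF assms(1), of "snd p"])
qed

text \<open>At an initial point the \<open>Limsup\<close> condition bounds \<open>u\<close> on a
  half ball. Neighbouring initial points inherit the bound, since small half balls around them lie
  in the same half ball.\<close>

lemma usc_on_initial_ext: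
  assumes bound: "\<forall>p\<in>Q. \<bar>u p\<bar> \<le> C" and usc: "usc_on Q u"
  shows "usc_on ({0..} \<times> UNIV) (initial_ext u)"
proof (rule usc_onI)
  fix p :: "real \<times> real" and a
  assume p: "p \<in> {0..} \<times> UNIV" and a: "initial_ext u p < a"
  show "\<exists>r>0. \<forall>q\<in>{0..} \<times> UNIV. dist q p < r \<longrightarrow> initial_ext u q < a"
  proof (cases "fst p > 0")
    case True
    then have pQ: "p \<in> Q" by (cases p) (auto simp: Q_def)
    obtain r where r: "r > 0" "\<And>q. q \<in> Q \<Longrightarrow> dist q p < r \<Longrightarrow> u q < a"
      using usc_onD[OF usc pQ, of a] a True by (auto simp: initial_ext_def)
    obtain e where e: "e > 0" "ball p e \<subseteq> Q" using open_Q pQ open_contains_ball by blast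
    have "initial_ext u q < a" if "dist q p < min r e" for q
    proof -
      have "q \<in> Q" using e that by (auto simp: dist_commute)
      then show ?thesis using r(2)[of q] that by (cases q) (auto simp: initial_ext_def Q_def)
    qed
    then show ?thesis using r(1) e(1) by (intro exI[of _ "min r e"]) auto
  next
    case False
    then have p0: "p = (0, snd p)" using p by (cases p) auto
    \<comment> \<open>The intermediate level is needed because the strict bound on \<open>u\<close>
      becomes a weak one for the upper limits at neighbouring initial points.\<close>
    obtain b where b: "initial_ext u p < b" "b < a" using a dense by blast
    have "upper_initial u (snd p) < ereal b"
      using b(1) p0 initial_ext_eq[OF bound, of "snd p"] by (metis less_ereal.simps(1))
    then have "\<forall>\<^sub>F q in at (0, snd p) within Q. ereal (u q) < ereal b"
      unfolding upper_initial_def by (rule Limsup_lessD)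
    then obtain r where r: "r > 0" "\<And>q. q \<in> Q \<Longrightarrow> q \<noteq> p \<Longrightarrow> dist q p < r \<Longrightarrow> u q < b"
      unfolding eventually_at using p0 by (metis less_ereal.simps(1))
    have rQ: "u q < b" if "q \<in> Q" "dist q p < r" for q
      using r(2)[OF that(1) _ that(2)] that(1) p0 by (metis Q_def fst_conv greaterThan_iff mem_Times_iff less_irrefl)
    have "initial_ext u q < a" if q: "q \<in> {0..} \<times> UNIV" "dist q p < r" for q
    proof (cases "fst q > 0")
      case True
      then have "q \<in> Q" by (cases q) (auto simp: Q_def)
      then show ?thesis using rQ[of q] q b(2) True by (auto simp: initial_ext_def)
    next
      case False
      then have q0: "q = (0, snd q)" using q by (cases q) auto
      have "\<forall>\<^sub>F z in at (0, snd q) within Q. ereal (u z) \<le> ereal b"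
        unfolding eventually_at
      proof (intro exI conjI ballI impI)
        show "r - dist q p > 0" using q by simp
        fix z assume "z \<in> Q" "z \<noteq> (0, snd q) \<and> dist z (0, snd q) < r - dist q p"
        then have "dist z p < r" using dist_triangle[of z p q] q0 by auto
        then show "ereal (u z) \<le> ereal b" using rQ \<open>z \<in> Q\<close> by (simp add: less_imp_le)
      qed
      then have "upper_initial u (snd q) \<le> ereal b"
        unfolding upper_initial_def by (rule Limsup_bounded)
      then have "initial_ext u q \<le> b" using q0 initial_ext_eq[OF bound, of "snd q"] by (metis ereal_less_eq(3))
      then show ?thesis using b by simp
    qed
    then show ?thesis using r(1) by blast
  qed
qed

section \<open>Integrability of the kernel away from its singularity\<close>

lemma integrable_far_kernel: "integrable lborel (\<lambda>z::real. 1 / max 1 (z\<^sup>2))"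
proof (rule Bochner_Integration.integrable_bound)
  have "integrable lborel (\<lambda>z::real. inverse (1 + z\<^sup>2))"
    using integrable_inverse_1_plus_square by (simp add: set_integrable_def)
  then show "integrable lborel (\<lambda>z::real. 2 * inverse (1 + z\<^sup>2))" by simp
  show "AE z::real in lborel. norm (1 / max 1 (z\<^sup>2)) \<le> norm (2 * inverse (1 + z\<^sup>2))"
  proof (intro AE_I2)
    fix z :: real
    have "1 + z\<^sup>2 \<le> 2 * max 1 (z\<^sup>2)" by simp
    moreover have "1 + z\<^sup>2 > 0" by (simp add: add_pos_nonneg)
    ultimately show "norm (1 / max 1 (z\<^sup>2)) \<le> norm (2 * inverse (1 + z\<^sup>2))"
      by (simp add: field_simps)
  qed
qed measurable

lemma integrable_inverse_square_off_ball:
  assumes "r > 0"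
  shows "integrable lborel (\<lambda>z. indicat_real (- B r) z / z\<^sup>2)"
proof (rule Bochner_Integration.integrable_bound)
  show "integrable lborel (\<lambda>z::real. max 1 (1 / r\<^sup>2) * (1 / max 1 (z\<^sup>2)))"
    using integrable_far_kernel by (rule integrable_mult_right)
  show "AE z in lborel. norm (indicat_real (- B r) z / z\<^sup>2) \<le> norm (max 1 (1 / r\<^sup>2) * (1 / max 1 (z\<^sup>2)))"
  proof (intro AE_I2)
    fix z :: real
    show "norm (indicat_real (- B r) z / z\<^sup>2) \<le> norm (max 1 (1 / r\<^sup>2) * (1 / max 1 (z\<^sup>2)))"
    proof (cases "z \<in> B r")
      case False
      then have "r \<le> \<bar>z\<bar>" by (auto simp: B_def)
      then have "r\<^sup>2 \<le> z\<^sup>2" "z\<^sup>2 > 0" using assms by (auto simp: abs_le_square_iff[symmetric])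
      then have "1 / z\<^sup>2 \<le> max 1 (1 / r\<^sup>2) * (1 / max 1 (z\<^sup>2))"
        using assms by (auto simp: max_def field_simps intro: order_trans)
      then show ?thesis using False by simp
    qed simp
  qed
  have "B r \<in> sets borel" by (simp add: B_def)
  then show "(\<lambda>z. indicat_real (- B r) z / z\<^sup>2) \<in> borel_measurable lborel" by measurable
qed

lemma sets_B [measurable]: "B r \<in> sets borel"
  by (simp add: B_def)

text \<open>Applied to integrands cut off to symmetric annuli, where it removes the singular
  part.\<close>

lemma integral_odd_eq_0:
  fixes f :: "real \<Rightarrow> real"
  assumes "\<And>z. f (- z) = - f z"
  shows "(LINT z|lborel. f z) = 0"
proof -
  have "(LINT z|lborel. f z) = (LINT z|lborel. f (- z))"
    using lborel_integral_real_affine[of "-1" f 0] by simp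
  also have "\<dots> = - (LINT z|lborel. f z)" by (simp add: assms)
  finally show ?thesis by simp
qed

section \<open>Test functions\<close>

text \<open>A partition of unity on a grid of mesh \<open>1 / N n\<close>, weighted by the suprema
  of \<open>u\<close> over the cells. A point meets only suprema over cells containing it, so a
  majorant results; by upper semicontinuity these suprema shrink to the value of \<open>u\<close>.
  Convergence is arranged at time \<open>tb\<close> only, the time at which the Hamiltonian
  evaluates increments.\<close>

lemma C2_majorants:
  assumes bound: "\<forall>p\<in>Q. \<bar>u p\<bar> \<le> C" and usc: "usc_on Q u" and tb: "tb > 0"
  obtains w :: "nat \<Rightarrow> real \<times> real \<Rightarrow> real" where "\<And>n. C2_plane (w n)"
    "\<And>n p. p \<in> Q \<Longrightarrow> u p \<le> w n p" "\<And>n p. p \<in> Q \<Longrightarrow> w n p \<le> C"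
    "\<And>x. (\<lambda>n. w n (tb, x)) \<longlonglongrightarrow> u (tb, x)"
proof -
  define N :: "nat \<Rightarrow> real" where "N n = real (Suc n)" for n
  have N: "N n > 0" for n by (simp add: N_def)
  \<comment> \<open>The number of nodes of the grid from \<open>- N n\<close> to \<open>N n\<close>
    in steps of \<open>1 / N n\<close>.\<close>
  define M where "M n = 2 * (Suc n)\<^sup>2 + 1" for n :: nat
  define cell where "cell n i = {p \<in> Q. \<bar>fst p - tb\<bar> \<le> 1 / N n \<and> \<bar>snd p - (real i - (N n)\<^sup>2) / N n\<bar> \<le> 1 / N n}"
    for n i
  define m where "m n i = Sup (u ` cell n i)" for n i
  \<comment> \<open>A difference of consecutive shifts of one transition: it is nonnegative, lives
    within \<open>1 / N n\<close> of the node, and its sum over the nodes telescopes.\<close>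
  define \<eta> where "\<eta> n i x = smoothstep (N n * x + ((N n)\<^sup>2 + 1 - real i))
      - smoothstep (N n * x + ((N n)\<^sup>2 + 1 - real (Suc i)))" for n i x
  define \<tau> where "\<tau> n t = smoothstep (N n * t + (1 - N n * tb)) * smoothstep (- N n * t + (1 + N n * tb))"
    for n t
  \<comment> \<open>Starting from \<open>C\<close> and adding nonpositive corrections keeps
    \<open>w\<close> above \<open>u\<close> even where the weights add up to less than 1, that is
    far from \<open>tb\<close> or outside the grid.\<close>
  define w where "w n p = C + (\<Sum>i<M n. (m n i - C) * (\<tau> n (fst p) * \<eta> n i (snd p)))" for n p
  have bdd: "bdd_above (u ` cell n i)" for n i
    using bound by (intro bdd_aboveI[of _ C]) (auto simp: cell_def abs_le_iff)
  have "(tb, (real i - (N n)\<^sup>2) / N n) \<in> cell n i" for n i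
    using tb N by (simp add: cell_def Q_def less_imp_le)
  then have ne: "cell n i \<noteq> {}" for n i by blast
  have m_ge: "u p \<le> m n i" if "p \<in> cell n i" for p n i
    unfolding m_def using that bdd by (intro cSup_upper) auto
  have m_le: "m n i \<le> a" if "\<And>p. p \<in> cell n i \<Longrightarrow> u p \<le> a" for a n i
    unfolding m_def using that ne by (intro cSup_least) auto
  have m_le_C: "m n i \<le> C" for n i
    using bound by (intro m_le) (auto simp: cell_def abs_le_iff)
  have \<eta>_nonneg: "\<eta> n i x \<ge> 0" for n i x
    by (simp add: \<eta>_def smoothstep_mono)
  have \<eta>_sum: "(\<Sum>i<M n. \<eta> n i x) = smoothstep (N n * x + ((N n)\<^sup>2 + 1)) - smoothstep (N n * x - (N n)\<^sup>2)" for n x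
  proof -
    have "(N n * x + ((N n)\<^sup>2 + 1 - real (M n))) = N n * x - (N n)\<^sup>2"
      by (simp add: N_def M_def)
    then show ?thesis
      using sum_lessThan_telescope'[of "\<lambda>i. smoothstep (N n * x + ((N n)\<^sup>2 + 1 - real i))" "M n"]
      unfolding \<eta>_def by (simp only: of_nat_0 diff_zero)
  qed
  have \<eta>_sum_le: "(\<Sum>i<M n. \<eta> n i x) \<le> 1" for n x
    unfolding \<eta>_sum by (smt (verit) smoothstep_le_1 smoothstep_nonneg)
  have \<tau>: "0 \<le> \<tau> n t" "\<tau> n t \<le> 1" for n t
    by (simp_all add: \<tau>_def smoothstep_nonneg smoothstep_le_1 mult_le_one)
  have support: "p \<in> cell n i" if "p \<in> Q" "\<tau> n (fst p) * \<eta> n i (snd p) \<noteq> 0" for p n i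
  proof -
    have "smoothstep (N n * fst p + (1 - N n * tb)) \<noteq> 0" "smoothstep (- N n * fst p + (1 + N n * tb)) \<noteq> 0"
      using that by (auto simp: \<tau>_def)
    then have "N n * fst p + (1 - N n * tb) > 0" "- N n * fst p + (1 + N n * tb) > 0"
      using smoothstep_eq_0 not_le by blast+
    then have "\<bar>N n * (fst p - tb)\<bar> \<le> 1" by (simp add: algebra_simps abs_le_iff)
    then have 1: "\<bar>fst p - tb\<bar> \<le> 1 / N n"
      using N[of n] by (simp add: abs_mult pos_le_divide_eq mult.commute)
    define y where "y = N n * snd p - (real i - (N n)\<^sup>2)"
    have "smoothstep (y + 1) \<noteq> smoothstep y"
      using that by (auto simp: \<eta>_def y_def algebra_simps)
    then have "y + 1 > 0" "y < 1"
      using smoothstep_eq_0[of "y + 1"] smoothstep_eq_0[of y] smoothstep_eq_1[of "y + 1"] smoothstep_eq_1[of y]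
      by (force simp: not_le[symmetric])+
    then have "\<bar>y\<bar> \<le> 1" by linarith
    moreover have "snd p - (real i - (N n)\<^sup>2) / N n = y / N n"
      using N[of n] by (simp add: y_def diff_divide_distrib)
    ultimately have 2: "\<bar>snd p - (real i - (N n)\<^sup>2) / N n\<bar> \<le> 1 / N n"
      using N[of n] by (simp add: divide_right_mono)
    show ?thesis using 1 2 that(1) by (simp add: cell_def)
  qed
  show thesis
  proof (rule that)
    show "C2_plane (w n)" for n
    proof -
      have "C2_real (\<tau> n)"
        unfolding \<tau>_def by (intro C2_real_mult C2_real_compose_affine C2_real_smoothstep)
      moreover have "C2_real (\<eta> n i)" for i
        unfolding \<eta>_def by (intro C2_real_diff C2_real_compose_affine C2_real_smoothstep)
      ultimately show ?thesis
        unfolding w_def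
        by (intro C2_plane_add C2_plane_sum C2_plane_mult C2_plane_const C2_plane_fst C2_plane_snd)
    qed
    show ge: "u p \<le> w n p" if p: "p \<in> Q" for n p
    proof -
      define s where "s = (\<Sum>i<M n. \<tau> n (fst p) * \<eta> n i (snd p))"
      have "s = \<tau> n (fst p) * (\<Sum>i<M n. \<eta> n i (snd p))" by (simp add: s_def sum_distrib_left)
      then have "s \<le> 1"
        using \<tau>[of n "fst p"] \<eta>_sum_le[of n "snd p"] \<eta>_nonneg by (simp add: mult_le_one sum_nonneg)
      have uC: "u p \<le> C" using bound p by (auto simp: abs_le_iff)
      \<comment> \<open>Since \<open>u p - C\<close> is nonpositive, total weight at most 1 is
        enough.\<close>
      have "(u p - C) * 1 \<le> (u p - C) * s"
        using uC \<open>s \<le> 1\<close> by (intro mult_left_mono_neg) auto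
      also have "\<dots> = (\<Sum>i<M n. (u p - C) * (\<tau> n (fst p) * \<eta> n i (snd p)))"
        by (simp add: s_def sum_distrib_left)
      also have "\<dots> \<le> (\<Sum>i<M n. (m n i - C) * (\<tau> n (fst p) * \<eta> n i (snd p)))"
      proof (rule sum_mono)
        fix i
        show "(u p - C) * (\<tau> n (fst p) * \<eta> n i (snd p)) \<le> (m n i - C) * (\<tau> n (fst p) * \<eta> n i (snd p))"
        proof (cases "\<tau> n (fst p) * \<eta> n i (snd p) = 0")
          case True
          then show ?thesis by (simp only: mult_zero_right)
        next
          case False
          then show ?thesis
            using m_ge[OF support[OF p]] \<tau> \<eta>_nonneg by (intro mult_right_mono) auto
        qed
      qed
      finally show ?thesis by (simp add: w_def)
    qed
    show "w n p \<le> C" if "p \<in> Q" for n p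
    proof -
      have "(\<Sum>i<M n. (m n i - C) * (\<tau> n (fst p) * \<eta> n i (snd p))) \<le> 0"
        using m_le_C \<tau> \<eta>_nonneg by (intro sum_nonpos mult_nonpos_nonneg mult_nonneg_nonneg) auto
      then show ?thesis by (simp add: w_def)
    qed
    show "(\<lambda>n. w n (tb, x)) \<longlonglongrightarrow> u (tb, x)" for x
    proof (rule order_tendstoI)
      have Q: "(tb, x) \<in> Q" using tb by (simp add: Q_def)
      show "\<forall>\<^sub>F n in sequentially. a < w n (tb, x)" if "a < u (tb, x)" for a
        using that ge[OF Q] by (intro always_eventually) (auto intro: less_le_trans)
      fix a' assume "u (tb, x) < a'"
      then obtain a where a: "u (tb, x) < a" "a < a'" using dense by blast
      obtain r where r: "r > 0" "\<And>q. q \<in> Q \<Longrightarrow> dist q (tb, x) < r \<Longrightarrow> u q < a"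
        using usc_onD[OF usc Q a(1)] by blast
      \<comment> \<open>The first bound places \<open>x\<close> inside the grid, where the weights
        add up to 1. The second puts every cell containing \<open>(tb, x)\<close> into the ball of
        radius \<open>r\<close>: such a cell reaches at most \<open>1 / N n\<close> in time plus
        \<open>2 / N n\<close> in space.\<close>
      have "\<forall>\<^sub>F n in sequentially. max \<bar>x\<bar> (4 / r) < N n"
        using filterlim_compose[OF filterlim_real_sequentially filterlim_Suc]
        unfolding filterlim_at_top_dense N_def by blast
      then show "\<forall>\<^sub>F n in sequentially. w n (tb, x) < a'"
      proof eventually_elim
        case (elim n)
        have small: "4 / N n < r" using elim r(1) N[of n] by (simp add: field_simps)
        have \<tau>1: "\<tau> n tb = 1" by (simp add: \<tau>_def smoothstep_eq_1)
        have "N n * \<bar>x\<bar> \<le> (N n)\<^sup>2"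
          unfolding power2_eq_square using elim N[of n] by (intro mult_left_mono) auto
        then have "\<bar>N n * x\<bar> \<le> (N n)\<^sup>2" using N[of n] by (simp add: abs_mult)
        then have \<eta>1: "(\<Sum>i<M n. \<eta> n i x) = 1"
          unfolding \<eta>_sum by (subst smoothstep_eq_1, simp) (subst smoothstep_eq_0, auto)
        have "(m n i - C) * \<eta> n i x \<le> (a - C) * \<eta> n i x" for i
        proof (cases "\<eta> n i x = 0")
          case False
          then have c: "(tb, x) \<in> cell n i" using support[OF Q, of n i] \<tau>1 by simp
          have "u p \<le> a" if "p \<in> cell n i" for p
          proof -
            have "dist (snd p) x \<le> 2 / N n" "dist (fst p) tb \<le> 1 / N n"
              using that c by (auto simp: cell_def dist_real_def)
            then have "dist p (tb, x) \<le> 1 / N n + 2 / N n"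
              using sqrt_sum_squares_le_sum_abs[of "dist (fst p) tb" "dist (snd p) x"]
              by (cases p) (simp add: dist_Pair_Pair)
            also have "\<dots> < 4 / N n" using N[of n] by (simp add: divide_simps)
            finally show ?thesis using small that r(2)[of p] by (auto simp: cell_def)
          qed
          then show ?thesis using m_le \<eta>_nonneg by (intro mult_right_mono) auto
        qed simp
        then have "w n (tb, x) \<le> C + (\<Sum>i<M n. (a - C) * \<eta> n i x)"
          unfolding w_def by (simp add: \<tau>1 sum_mono)
        also have "\<dots> = a" using \<eta>1 by (simp flip: sum_distrib_left)
        finally show ?case using a by simp
      qed
    qed
  qed
qed

section \<open>Integrals off a ball and principal values\<close>

lemma set_integrable_over_square:
  assumes "g \<in> borel_measurable borel" "A \<in> sets borel" "A \<subseteq> - B r" "r > 0"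
    and "\<And>z. z \<in> A \<Longrightarrow> \<bar>g z\<bar> \<le> K"
  shows "set_integrable lborel A (\<lambda>z. g z / z\<^sup>2)"
  unfolding set_integrable_def
proof (rule Bochner_Integration.integrable_bound)
  show "integrable lborel (\<lambda>z. K * (indicat_real (- B r) z / z\<^sup>2))"
    by (rule integrable_mult_right[OF integrable_inverse_square_off_ball[OF \<open>r > 0\<close>]])
  show "(\<lambda>z. indicat_real A z *\<^sub>R (g z / z\<^sup>2)) \<in> borel_measurable lborel"
    using assms by measurable
  show "AE z in lborel. norm (indicat_real A z *\<^sub>R (g z / z\<^sup>2)) \<le> norm (K * (indicat_real (- B r) z / z\<^sup>2))"
    using assms(3) order_trans[OF assms(5) abs_ge_self[of K]]
    by (intro AE_I2) (auto simp: indicator_def intro!: divide_right_mono)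
qed

text \<open>Shrinking \<open>r\<close> below \<open>r0\<close> adds only symmetric annuli on which
  \<open>f\<close> is odd. The truncated integrals are thus eventually constant, and the limit
  exists even though \<open>f\<close> may be singular at 0.\<close>

lemma pv_integral_eq:
  assumes "0 < r0" "r0 \<le> \<rho>" "\<And>z. \<bar>z\<bar> < r0 \<Longrightarrow> f (- z) = - f z"
    and int: "\<And>r. r > 0 \<Longrightarrow> set_integrable lborel (B \<rho> - B r) f"
  shows "pv_integral \<rho> f = (LINT z:B \<rho> - B r0|lborel. f z)"
  unfolding pv_integral_def
proof (rule tendsto_Lim)
  show "((\<lambda>r. LINT z:B \<rho> - B r|lborel. f z) \<longlongrightarrow> (LINT z:B \<rho> - B r0|lborel. f z)) (at_right 0)"
  proof (rule tendsto_eventually)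
    have "\<forall>\<^sub>F r in at_right 0. r \<in> {0<..<r0}"
      by (rule eventually_at_rightI[OF _ assms(1)])
    then show "\<forall>\<^sub>F r in at_right 0. (LINT z:B \<rho> - B r|lborel. f z) = (LINT z:B \<rho> - B r0|lborel. f z)"
    proof eventually_elim
      case (elim r)
      have eq: "B \<rho> - B r = (B \<rho> - B r0) \<union> (B r0 - B r)"
        using elim assms(2) by (auto simp: B_def)
      have "set_integrable lborel (B r0 - B r) f"
        by (rule set_integrable_subset[OF int[of r]]) (use elim assms(2) in \<open>auto simp: B_def\<close>)
      then have "(LINT z:B \<rho> - B r|lborel. f z) =
          (LINT z:B \<rho> - B r0|lborel. f z) + (LINT z:B r0 - B r|lborel. f z)"
        unfolding eq using int[OF assms(1)] by (intro set_integral_Un) auto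
      moreover have "(LINT z:B r0 - B r|lborel. f z) = 0"
        unfolding set_lebesgue_integral_def
      proof (rule integral_odd_eq_0)
        show "indicat_real (B r0 - B r) (- z) *\<^sub>R f (- z) = - (indicat_real (B r0 - B r) z *\<^sub>R f z)" for z
          using assms(3)[of z] by (auto simp: indicator_def B_def)
      qed
      ultimately show ?case by simp
    qed
  qed
qed simp

text \<open>Boundedness of \<open>u\<close> makes the restriction on \<open>t\<close> removable: a
  larger coefficient of \<open>(t - tb)\<^sup>2\<close> covers the remaining times and changes
  neither the value nor the slope at \<open>tb\<close>.\<close>

lemma touching_on_strip:
  fixes u :: "real \<times> real \<Rightarrow> real"
  assumes bound: "\<forall>p\<in>Q. \<bar>u p\<bar> \<le> C" and "tb > 0" "r > 0" "c \<ge> 0"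
    and touch: "\<And>t x. t > 0 \<Longrightarrow> \<bar>t - tb\<bar> \<le> r \<Longrightarrow> \<bar>x - xb\<bar> \<le> r \<Longrightarrow>
      u (t, x) \<le> u (tb, xb) + c * ((x - a) ^ 4 - (xb - a) ^ 4) + q * (t - tb) + \<kappa> * (t - tb)\<^sup>2"
  obtains k where "k \<ge> 1" "\<And>t x. t > 0 \<Longrightarrow> \<bar>x - xb\<bar> \<le> r \<Longrightarrow>
      u (t, x) \<le> u (tb, xb) + c * ((x - a) ^ 4 - (xb - a) ^ 4) + q * (t - tb) + k * (t - tb)\<^sup>2"
proof -
  \<comment> \<open>The gap to be bridged at distant times: the oscillation of \<open>u\<close> and
    the subtracted quartic, the other quartic being nonnegative.\<close>
  define D where "D = 2 * C + c * (xb - a) ^ 4"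
  have u_le: "\<bar>u (t, x)\<bar> \<le> C" if "t > 0" for t x
    using bound that by (auto simp: Q_def)
  have "C \<ge> 0" using u_le[OF \<open>tb > 0\<close>, of xb] by linarith
  then have D: "D \<ge> 0" using \<open>c \<ge> 0\<close> by (simp add: D_def)
  \<comment> \<open>For \<open>h = \<bar>t - tb\<bar> > r\<close> both
    \<open>h \<le> h\<^sup>2 / r\<close> and \<open>1 \<le> h\<^sup>2 / r\<^sup>2\<close> hold, so
    the last two terms absorb \<open>\<bar>q\<bar> * h + D\<close>.\<close>
  define k where "k = max 1 \<kappa> + \<bar>q\<bar> / r + D / r\<^sup>2"
  have k: "k \<ge> 1" "k \<ge> \<kappa>" "k \<ge> \<bar>q\<bar> / r + D / r\<^sup>2"
    using D \<open>r > 0\<close> by (auto simp: k_def add_increasing2)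
  show thesis
  proof (rule that[OF k(1)])
    fix t x :: real assume t: "t > 0" and x: "\<bar>x - xb\<bar> \<le> r"
    show "u (t, x) \<le> u (tb, xb) + c * ((x - a) ^ 4 - (xb - a) ^ 4) + q * (t - tb) + k * (t - tb)\<^sup>2"
    proof (cases "\<bar>t - tb\<bar> \<le> r")
      case True
      have "\<kappa> * (t - tb)\<^sup>2 \<le> k * (t - tb)\<^sup>2" using k by (intro mult_right_mono) auto
      then show ?thesis using touch[OF t True x] by linarith
    next
      case False
      define h where "h = \<bar>t - tb\<bar>"
      have h: "h > r" "h\<^sup>2 = (t - tb)\<^sup>2" using False by (simp_all add: h_def)
      have "\<bar>q\<bar> * h \<le> \<bar>q\<bar> / r * h\<^sup>2"
        using h \<open>r > 0\<close> by (simp add: field_simps power2_eq_square mult_left_mono mult_right_mono)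
      moreover have "r\<^sup>2 \<le> h\<^sup>2" using h(1) \<open>r > 0\<close> by (intro power_mono) auto
      then have "D \<le> D / r\<^sup>2 * h\<^sup>2" using D \<open>r > 0\<close> by (simp add: field_simps mult_left_mono)
      moreover have "(\<bar>q\<bar> / r + D / r\<^sup>2) * h\<^sup>2 \<le> k * h\<^sup>2" using k by (intro mult_right_mono) auto
      ultimately have "\<bar>q\<bar> * h + D \<le> k * (t - tb)\<^sup>2" by (simp add: distrib_right h(2))
      moreover have "- (\<bar>q\<bar> * h) \<le> q * (t - tb)"
        unfolding h_def by (metis abs_ge_minus_self abs_mult minus_le_iff)
      moreover have "c * (x - a) ^ 4 \<ge> 0" using \<open>c \<ge> 0\<close> by simp
      ultimately show ?thesis
        using u_le[OF t, of x] u_le[OF \<open>tb > 0\<close>, of xb] by (simp add: D_def right_diff_distrib)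
    qed
  qed
qed

lemma subsolution_zero_gradient:
  assumes sub: "subsolution \<rho> \<epsilon> u" and bound: "\<forall>p\<in>Q. \<bar>u p\<bar> \<le> C" and "tb > 0" "r > 0" "c \<ge> 0"
    and touch: "\<And>t x. t > 0 \<Longrightarrow> \<bar>t - tb\<bar> \<le> r \<Longrightarrow> \<bar>x - xb\<bar> \<le> r \<Longrightarrow>
      u (t, x) \<le> u (tb, xb) + c * (x - xb) ^ 4 + q * (t - tb) + \<kappa> * (t - tb)\<^sup>2"
  shows "q \<le> 0"
proof -
  obtain k where k: "k \<ge> 1" and strip: "\<And>t x. t > 0 \<Longrightarrow> \<bar>x - xb\<bar> \<le> r \<Longrightarrow>
      u (t, x) \<le> u (tb, xb) + c * (x - xb) ^ 4 + q * (t - tb) + k * (t - tb)\<^sup>2"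
    using touching_on_strip[OF bound \<open>tb > 0\<close> \<open>r > 0\<close> \<open>c \<ge> 0\<close>, of xb xb q \<kappa>] touch by auto
  have u_le: "\<bar>u (t, x)\<bar> \<le> C" if "t > 0" for t x
    using bound that by (auto simp: Q_def)
  have "C \<ge> 0" using u_le[OF \<open>tb > 0\<close>, of xb] by linarith
  \<comment> \<open>At distance more than \<open>r\<close> from \<open>xb\<close> the additional
    quartic exceeds \<open>2 * C + q\<^sup>2\<close>: the first term pays for the oscillation of
    \<open>u\<close>, the second for the negative part of \<open>g\<close>.\<close>
  define c' where "c' = c + (2 * C + q\<^sup>2) / r ^ 4"
  define g where "g t = q * (t - tb) + k * (t - tb)\<^sup>2" for t
  define \<psi> where "\<psi> p = c' * (snd p - xb) ^ 4 + g (fst p)" for p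
  have c': "c' \<ge> c" using \<open>C \<ge> 0\<close> by (simp add: c'_def)
  have global: "u (t, x) \<le> u (tb, xb) + \<psi> (t, x)" if t: "t > 0" for t x
  proof (cases "\<bar>x - xb\<bar> \<le> r")
    case True
    have "c * (x - xb) ^ 4 \<le> c' * (x - xb) ^ 4" using c' by (intro mult_right_mono) auto
    then show ?thesis using strip[OF t True] by (simp add: \<psi>_def g_def)
  next
    case False
    have "r ^ 4 \<le> \<bar>x - xb\<bar> ^ 4" using False \<open>r > 0\<close> by (intro power_mono) auto
    then have "r ^ 4 \<le> (x - xb) ^ 4" by simp
    then have "(2 * C + q\<^sup>2) / r ^ 4 * r ^ 4 \<le> (2 * C + q\<^sup>2) / r ^ 4 * (x - xb) ^ 4"
      using \<open>C \<ge> 0\<close> by (intro mult_left_mono) auto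
    then have "2 * C + q\<^sup>2 \<le> (2 * C + q\<^sup>2) / r ^ 4 * (x - xb) ^ 4" using \<open>r > 0\<close> by simp
    moreover have "c * (x - xb) ^ 4 \<ge> 0" using \<open>c \<ge> 0\<close> by simp
    \<comment> \<open>Completing the square; the bound does not involve \<open>k\<close> because
      \<open>k \<ge> 1\<close>.\<close>
    moreover have "g t \<ge> - q\<^sup>2"
    proof -
      have "0 \<le> (q + (t - tb) / 2)\<^sup>2" by simp
      also have "\<dots> = q\<^sup>2 + q * (t - tb) + (t - tb)\<^sup>2 / 4"
        by (simp add: power2_eq_square algebra_simps)
      finally have "0 \<le> q\<^sup>2 + q * (t - tb) + (t - tb)\<^sup>2 / 4" .
      moreover have "1 * (t - tb)\<^sup>2 \<le> k * (t - tb)\<^sup>2" using k by (intro mult_right_mono) auto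
      moreover have "(t - tb)\<^sup>2 \<ge> 0" by simp
      ultimately show ?thesis unfolding g_def by linarith
    qed
    ultimately show ?thesis
      using u_le[OF t, of x] u_le[OF \<open>tb > 0\<close>, of xb] by (simp add: \<psi>_def c'_def distrib_right)
  qed
  have g: "C2_real g" unfolding g_def[abs_def] by (intro C2_real_add C2_real_mult C2_real_power C2_real_diff C2_real_const C2_real_ident)
  have "C2_plane \<psi>"
    unfolding \<psi>_def[abs_def]
    by (intro C2_plane_add C2_plane_mult C2_plane_const C2_plane_fst[OF g]
        C2_plane_snd[of "\<lambda>x. (x - xb) ^ 4"] C2_real_power C2_real_diff C2_real_const C2_real_ident)
  moreover have "(tb, xb) \<in> Q" using \<open>tb > 0\<close> by (simp add: Q_def)
  moreover have "\<psi> (tb, xb) = 0" by (simp add: \<psi>_def g_def)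
  then have "\<forall>p\<in>Q. u p - \<psi> p \<le> u (tb, xb) - \<psi> (tb, xb)"
    using global by (auto simp: Q_def diff_le_eq)
  moreover have "\<forall>(t, x)\<in>Q. \<psi> (t, x) = c' * \<bar>x - xb\<bar> ^ 4 + g t" by (simp add: \<psi>_def)
  ultimately have "Dt \<psi> (tb, xb) \<le> 0"
    using sub C2_plane_imp_C2_on unfolding subsolution_def by meson
  moreover have "((\<lambda>s. \<psi> (s, xb)) has_field_derivative q) (at tb)"
    unfolding \<psi>_def g_def by (auto intro!: derivative_eq_intros)
  ultimately show ?thesis by (simp add: Dt_def DERIV_imp_deriv)
qed


text \<open>The test function is the quartic near \<open>xb\<close> and a smooth majorant of
  \<open>u\<close> elsewhere. Letting the majorants decrease to \<open>u\<close> puts the increments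
  of \<open>u\<close> into the integral; what the quartic leaves inside \<open>B r1\<close> is odd
  and integrates to 0. No trace of \<open>\<rho>\<close> remains, and the singularity is excluded on
  both sides by the same \<open>r1\<close>.\<close>

lemma subsolution_nonzero_gradient:
  fixes u :: "real \<times> real \<Rightarrow> real"
  assumes sub: "subsolution \<rho> \<epsilon> u" and bound: "\<forall>p\<in>Q. \<bar>u p\<bar> \<le> C"
    and \<epsilon>: "\<epsilon> > 0" and "tb > 0" "r > 0" "c \<ge> 0"
    and touch: "\<And>t x. t > 0 \<Longrightarrow> \<bar>t - tb\<bar> \<le> r \<Longrightarrow> \<bar>x - xb\<bar> \<le> r \<Longrightarrow>
      u (t, x) \<le> u (tb, xb) + c * ((x - a) ^ 4 - (xb - a) ^ 4) + q * (t - tb) + \<kappa> * (t - tb)\<^sup>2"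
    and p: "p = 4 * c * (xb - a) ^ 3" "p \<noteq> 0"
    and r1: "0 < r1" "r1 \<le> r" "r1 \<le> \<rho>"
    and odd: "\<And>z. \<bar>z\<bar> \<le> r1 \<Longrightarrow> z \<noteq> 0 \<Longrightarrow>
      E_up \<epsilon> (c * ((xb + z - a) ^ 4 - (xb - a) ^ 4)) = sgn (z * p) * (\<epsilon> / 2)"
  shows "q \<le> \<bar>p\<bar> * (LINT z:- B r1|lborel. E_up \<epsilon> (u (tb, xb + z) - u (tb, xb)) / z\<^sup>2)"
proof -
  define u0 where "u0 = u (tb, xb)"
  define T where "T z = c * ((xb + z - a) ^ 4 - (xb - a) ^ 4)" for z
  obtain k where strip: "\<And>t x. t > 0 \<Longrightarrow> \<bar>x - xb\<bar> \<le> r1 \<Longrightarrow>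
      u (t, x) \<le> u0 + c * ((x - a) ^ 4 - (xb - a) ^ 4) + q * (t - tb) + k * (t - tb)\<^sup>2"
    using touching_on_strip[OF bound \<open>tb > 0\<close> \<open>0 < r1\<close> \<open>c \<ge> 0\<close>, of xb a q \<kappa>] touch r1(2)
    unfolding u0_def by (smt (verit))
  have u_le: "\<bar>u (t, x)\<bar> \<le> C" if "t > 0" for t x
    using bound that by (auto simp: Q_def)
  have u0_le: "\<bar>u0\<bar> \<le> C" using u_le[OF \<open>tb > 0\<close>] by (simp add: u0_def)
  have usc: "usc_on Q u" using sub by (simp add: subsolution_def)
  have [measurable]: "(\<lambda>x. u (tb, x)) \<in> borel_measurable borel"
    using usc \<open>tb > 0\<close> by (rule borel_measurable_usc_slice)
  obtain w where w: "\<And>n. C2_plane (w n)" "\<And>n p. p \<in> Q \<Longrightarrow> u p \<le> w n p" "\<And>n p. p \<in> Q \<Longrightarrow> w n p \<le> C"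
    "\<And>x. (\<lambda>n. w n (tb, x)) \<longlonglongrightarrow> u (tb, x)"
    using C2_majorants[OF bound usc \<open>tb > 0\<close>] by blast
  have Q: "(tb, x) \<in> Q" for x using \<open>tb > 0\<close> by (simp add: Q_def)

  \<comment> \<open>A cutoff in space, 1 within \<open>r1 / 2\<close> of \<open>xb\<close> and 0
    beyond \<open>r1\<close>. Time needs no cutoff, since the bound on the strip holds for all
    positive times.\<close>
  define \<theta> where "\<theta> x = smoothstep (- (2 / r1) * x + (2 + 2 / r1 * xb)) * smoothstep (2 / r1 * x + (2 - 2 / r1 * xb))" for x
  have \<theta>_arg: "\<theta> (xb + z) = smoothstep (2 - 2 * (z / r1)) * smoothstep (2 + 2 * (z / r1))" for z
    by (simp add: \<theta>_def algebra_simps add_divide_distrib)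
  have \<theta>: "0 \<le> \<theta> x" "\<theta> x \<le> 1" for x
    by (simp_all add: \<theta>_def smoothstep_nonneg smoothstep_le_1 mult_le_one)
  have \<theta>_1: "\<theta> (xb + z) = 1" if "\<bar>z\<bar> \<le> r1 / 2" for z
  proof -
    have "\<bar>z / r1\<bar> \<le> 1 / 2" using that r1(1) by (simp add: field_simps)
    then have "2 - 2 * (z / r1) \<ge> 1" "2 + 2 * (z / r1) \<ge> 1" by linarith+
    then show ?thesis unfolding \<theta>_arg by (simp only: smoothstep_eq_1)
  qed
  have \<theta>_0: "\<theta> (xb + z) = 0" if "\<bar>z\<bar> \<ge> r1" for z
  proof -
    have "\<bar>z / r1\<bar> \<ge> 1" using that r1(1) by (simp add: field_simps)
    then have "z / r1 \<ge> 1 \<or> z / r1 \<le> -1" by linarith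
    then have "2 - 2 * (z / r1) \<le> 0 \<or> 2 + 2 * (z / r1) \<le> 0" by linarith
    then show ?thesis unfolding \<theta>_arg using smoothstep_eq_0 by (metis mult_zero_left mult_zero_right)
  qed
  define \<phi>0 where "\<phi>0 p = u0 + c * ((snd p - a) ^ 4 - (xb - a) ^ 4) + q * (fst p - tb) + k * (fst p - tb)\<^sup>2" for p
  define \<phi> where "\<phi> n p = \<theta> (snd p) * \<phi>0 p + (1 - \<theta> (snd p)) * w n p" for n p
  have C2\<theta>: "C2_real \<theta>"
    unfolding \<theta>_def[abs_def] by (intro C2_real_mult C2_real_compose_affine C2_real_smoothstep)
  have "C2_plane \<phi>0"
  proof -
    have "C2_real (\<lambda>t. q * (t - tb) + k * (t - tb)\<^sup>2)"
      by (intro C2_real_add C2_real_mult C2_real_power C2_real_diff C2_real_const C2_real_ident)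
    moreover have "C2_real (\<lambda>x. u0 + c * ((x - a) ^ 4 - (xb - a) ^ 4))"
      by (intro C2_real_add C2_real_mult C2_real_power C2_real_diff C2_real_const C2_real_ident)
    ultimately have "C2_plane (\<lambda>p. (u0 + c * ((snd p - a) ^ 4 - (xb - a) ^ 4)) + (q * (fst p - tb) + k * (fst p - tb)\<^sup>2))"
      by (intro C2_plane_add C2_plane_fst C2_plane_snd)
    then show ?thesis by (simp add: \<phi>0_def[abs_def] add.assoc)
  qed
  then have C2\<phi>: "C2_plane (\<phi> n)" for n
    unfolding \<phi>_def[abs_def]
    by (intro C2_plane_add C2_plane_mult w C2_plane_snd C2\<theta> C2_real_diff C2_real_const)
  have \<phi>_ge: "u p \<le> \<phi> n p" if "p \<in> Q" for n p
  proof -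
    obtain t x where p: "p = (t, x)" "t > 0" using \<open>p \<in> Q\<close> by (auto simp: Q_def)
    have "\<theta> x * u p \<le> \<theta> x * \<phi>0 p"
    proof (cases "\<bar>x - xb\<bar> \<le> r1")
      case True
      then show ?thesis using strip[OF p(2) True] \<theta> p by (intro mult_left_mono) (auto simp: \<phi>0_def)
    next
      case False
      then show ?thesis using \<theta>_0[of "x - xb"] by simp
    qed
    moreover have "(1 - \<theta> x) * u p \<le> (1 - \<theta> x) * w n p"
      using \<theta> w(2)[OF that] by (intro mult_left_mono) auto
    ultimately show ?thesis by (simp add: \<phi>_def p algebra_simps)
  qed
  have \<phi>_touch: "\<phi> n (tb, xb) = u0" for n
    using \<theta>_1[of 0] r1 by (simp add: \<phi>_def \<phi>0_def)
  have Dt\<phi>: "Dt (\<phi> n) (tb, xb) = q" for n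
  proof -
    have "\<phi> n (t, xb) = u0 + q * (t - tb) + k * (t - tb)\<^sup>2" for t
      using \<theta>_1[of 0] r1 by (simp add: \<phi>_def \<phi>0_def)
    then have "((\<lambda>t. \<phi> n (t, xb)) has_field_derivative q) (at tb)"
      by (auto intro!: derivative_eq_intros)
    then show ?thesis by (simp add: Dt_def DERIV_imp_deriv)
  qed
  have Dx\<phi>: "Dx (\<phi> n) (tb, xb) = p" for n
  proof -
    have "((\<lambda>x. u0 + c * ((x - a) ^ 4 - (xb - a) ^ 4)) has_field_derivative p) (at xb)"
      unfolding p(1) by (auto intro!: derivative_eq_intros)
    then have "((\<lambda>x. \<phi> n (tb, x)) has_field_derivative p) (at xb)"
    proof (rule has_field_derivative_transform_within_open[where S = "ball xb (r1 / 2)"])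
      show "u0 + c * ((x - a) ^ 4 - (xb - a) ^ 4) = \<phi> n (tb, x)" if "x \<in> ball xb (r1 / 2)" for x
        using that \<theta>_1[of "x - xb"] by (simp add: \<phi>_def \<phi>0_def dist_real_def abs_minus_commute)
    qed (use r1 in auto)
    then show ?thesis by (simp add: Dx_def DERIV_imp_deriv)
  qed

  define F where "F n z = \<phi> n (tb, xb + z) - u0" for n z
  define U where "U z = u (tb, xb + z) - u0" for z
  define f where "f z = \<theta> (xb + z) * T z + (1 - \<theta> (xb + z)) * U z" for z
  \<comment> \<open>The Hamiltonian uses the test function inside \<open>B \<rho>\<close> and
    \<open>u\<close> outside; gluing the two increments turns its two integrals into one.\<close>
  define F' where "F' n z = (if z \<in> B \<rho> then F n z else U z)" for n z
  have F_eq: "F n z = \<theta> (xb + z) * T z + (1 - \<theta> (xb + z)) * (w n (tb, xb + z) - u0)" for n z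
    by (simp add: F_def \<phi>_def \<phi>0_def T_def algebra_simps)
  have U_le: "\<bar>U z\<bar> \<le> 2 * C" for z
    using u_le[OF \<open>tb > 0\<close>, of "xb + z"] u0_le by (simp add: U_def abs_le_iff)
  have T_le: "\<bar>E_up \<epsilon> (T z)\<bar> \<le> \<epsilon> / 2" if "\<bar>z\<bar> \<le> r1" for z
  proof (cases "z = 0")
    case True
    then show ?thesis using E_up_eq_half[of 0 \<epsilon>] \<epsilon> by (simp add: T_def)
  next
    case False
    have "\<bar>sgn (z * p) * (\<epsilon> / 2)\<bar> \<le> \<epsilon> / 2"
      using \<epsilon> by (cases "z * p = 0") (auto simp: abs_mult abs_sgn_eq)
    then show ?thesis using odd[OF that False] by (simp only: T_def)
  qed
  have T_odd: "E_up \<epsilon> (T (- z)) / (- z)\<^sup>2 = - (E_up \<epsilon> (T z) / z\<^sup>2)" if "\<bar>z\<bar> \<le> r1" for z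
  proof (cases "z = 0")
    case False
    then have "E_up \<epsilon> (T (- z)) = sgn (- z * p) * (\<epsilon> / 2)" "E_up \<epsilon> (T z) = sgn (z * p) * (\<epsilon> / 2)"
      unfolding T_def using that by (intro odd; simp)+
    then have "E_up \<epsilon> (T (- z)) = - E_up \<epsilon> (T z)" by (simp add: sgn_mult)
    then show ?thesis by simp
  qed simp
  have [measurable]: "U \<in> borel_measurable borel"
    unfolding U_def[abs_def] by measurable
  have [measurable]: "T \<in> borel_measurable borel"
    unfolding T_def[abs_def] by measurable
  have [measurable]: "\<theta> \<in> borel_measurable borel"
    using C2\<theta> by (elim C2_realE) (rule borel_measurable_continuous_onI)
  have [measurable]: "(\<lambda>z. F n z) \<in> borel_measurable borel" for n
  proof -
    have "continuous_on UNIV (\<phi> n)" using C2\<phi> by (simp add: C2_plane_def C1_plane_def)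
    then have "continuous_on UNIV (\<lambda>z. \<phi> n (tb, xb + z))"
      by (rule continuous_on_compose2) (auto intro!: continuous_intros)
    then show ?thesis unfolding F_def[abs_def]
      by (intro borel_measurable_diff borel_measurable_continuous_onI) auto
  qed
  have [measurable]: "f \<in> borel_measurable borel"
    unfolding f_def[abs_def] by measurable
  define K where "K = 2 * C + \<epsilon>"
  \<comment> \<open>The dominating constant must not depend on \<open>n\<close>. A convex
    combination lies between its two arguments, so by monotonicity \<open>E_up\<close> of it is
    controlled by its values at \<open>T z\<close> and \<open>y\<close>; beyond \<open>r1\<close>
    only \<open>y\<close> is left.\<close>
  have mix_le: "\<bar>E_up \<epsilon> (\<theta> (xb + z) * T z + (1 - \<theta> (xb + z)) * y)\<bar> \<le> K" if "\<bar>y\<bar> \<le> 2 * C" for z y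
  proof -
    have y_le: "\<bar>E_up \<epsilon> y\<bar> \<le> 2 * C + \<epsilon> / 2"
      using abs_E_up_le[OF \<epsilon>, of y] that by linarith
    show ?thesis
    proof (cases "\<bar>z\<bar> \<le> r1")
      case True
      have "min (T z) y \<le> \<theta> (xb + z) * T z + (1 - \<theta> (xb + z)) * y"
        "\<theta> (xb + z) * T z + (1 - \<theta> (xb + z)) * y \<le> max (T z) y"
        using \<theta>[of "xb + z"] convex_bound_le[of "T z" "max (T z) y" y "\<theta> (xb + z)" "1 - \<theta> (xb + z)"]
          convex_bound_le[of "- T z" "- min (T z) y" "- y" "\<theta> (xb + z)" "1 - \<theta> (xb + z)"]
        by simp_all
      then have "E_up \<epsilon> (min (T z) y) \<le> E_up \<epsilon> (\<theta> (xb + z) * T z + (1 - \<theta> (xb + z)) * y)"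
        "E_up \<epsilon> (\<theta> (xb + z) * T z + (1 - \<theta> (xb + z)) * y) \<le> E_up \<epsilon> (max (T z) y)"
        using E_up_mono[OF \<epsilon>] by auto
      then show ?thesis
        using T_le[OF True] y_le that \<epsilon> by (auto simp: min_def max_def K_def abs_le_iff split: if_splits)
    next
      case False
      then show ?thesis using \<theta>_0[of z] y_le \<epsilon> by (simp add: K_def)
    qed
  qed
  have wu_le: "\<bar>w n (tb, xb + z) - u0\<bar> \<le> 2 * C" for n z
    using w(2)[OF Q, of "xb + z" n] w(3)[OF Q, of n "xb + z"] u_le[OF \<open>tb > 0\<close>, of "xb + z"] u0_le by linarith
  have F_le: "\<bar>E_up \<epsilon> (F n z)\<bar> \<le> K" for n z
    unfolding F_eq by (rule mix_le[OF wu_le])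
  have EU_le: "\<bar>E_up \<epsilon> (U z)\<bar> \<le> K" for z
    using abs_E_up_le[OF \<epsilon>, of "U z"] U_le[of z] \<epsilon> unfolding K_def by linarith
  have Ef_le: "\<bar>E_up \<epsilon> (f z)\<bar> \<le> K" for z
    unfolding f_def by (rule mix_le[OF U_le])
  have F'_le: "\<bar>E_up \<epsilon> (F' n z)\<bar> \<le> K" for n z
    using F_le EU_le by (simp add: F'_def)
  \<comment> \<open>Within this radius the cutoff is 1 and the increment of the test function is
    exactly \<open>T\<close>, hence odd after \<open>E_up\<close>.\<close>
  define r0 where "r0 = r1 / 2"
  have r0: "0 < r0" "r0 < r1" "r0 \<le> \<rho>" using r1 by (simp_all add: r0_def)
  define J where "J g = (LINT z:- B r0|lborel. E_up \<epsilon> (g z) / z\<^sup>2)" for g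
  have q_le: "q \<le> \<bar>p\<bar> * J (F' n)" for n
  proof -
    have max: "\<forall>p\<in>Q. u p - \<phi> n p \<le> u (tb, xb) - \<phi> n (tb, xb)"
      using \<phi>_ge[of _ n] \<phi>_touch[of n] by (simp add: u0_def)
    have "Dx (\<phi> n) (tb, xb) \<noteq> 0" using p(2) by (simp add: Dx\<phi>)
    with sub Q[of xb] C2_plane_imp_C2_on[OF C2\<phi>[of n], of Q] max
    have "Dt (\<phi> n) (tb, xb) \<le> H_up \<rho> \<epsilon> (\<phi> n) u (tb, xb)"
      unfolding subsolution_def by blast
    then have "q \<le> \<bar>p\<bar> * (pv_integral \<rho> (\<lambda>z. E_up \<epsilon> (F n z) / z\<^sup>2) + (LINT z:- B \<rho>|lborel. E_up \<epsilon> (U z) / z\<^sup>2))"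
      by (simp add: hamiltonian_def Dt\<phi> Dx\<phi> F_def U_def \<phi>_touch u0_def)
    also have "pv_integral \<rho> (\<lambda>z. E_up \<epsilon> (F n z) / z\<^sup>2) = (LINT z:B \<rho> - B r0|lborel. E_up \<epsilon> (F n z) / z\<^sup>2)"
    proof (rule pv_integral_eq[OF r0(1,3)])
      fix z assume "\<bar>z\<bar> < r0"
      then have "F n z = T z" "F n (- z) = T (- z)" "\<bar>z\<bar> \<le> r1"
        using \<theta>_1[of z] \<theta>_1[of "- z"] r0(2) by (simp_all add: F_eq r0_def)
      then show "E_up \<epsilon> (F n (- z)) / (- z)\<^sup>2 = - (E_up \<epsilon> (F n z) / z\<^sup>2)"
        using T_odd[of z] by simp
    next
      fix r :: real assume "r > 0"
      then show "set_integrable lborel (B \<rho> - B r) (\<lambda>z. E_up \<epsilon> (F n z) / z\<^sup>2)"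
        by (intro set_integrable_over_square[where r = r and K = K]) (use F_le in auto)
    qed
    also have "(LINT z:B \<rho> - B r0|lborel. E_up \<epsilon> (F n z) / z\<^sup>2) = (LINT z:B \<rho> - B r0|lborel. E_up \<epsilon> (F' n z) / z\<^sup>2)"
      by (rule set_lebesgue_integral_cong) (auto simp: F'_def)
    also have "(LINT z:- B \<rho>|lborel. E_up \<epsilon> (U z) / z\<^sup>2) = (LINT z:- B \<rho>|lborel. E_up \<epsilon> (F' n z) / z\<^sup>2)"
      by (rule set_lebesgue_integral_cong) (auto simp: F'_def)
    also have "(LINT z:B \<rho> - B r0|lborel. E_up \<epsilon> (F' n z) / z\<^sup>2) + (LINT z:- B \<rho>|lborel. E_up \<epsilon> (F' n z) / z\<^sup>2)
        = (LINT z:(B \<rho> - B r0) \<union> - B \<rho>|lborel. E_up \<epsilon> (F' n z) / z\<^sup>2)"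
    proof (rule set_integral_Un[symmetric])
      have [measurable]: "F' n \<in> borel_measurable borel" unfolding F'_def[abs_def] by measurable
      show "set_integrable lborel (B \<rho> - B r0) (\<lambda>z. E_up \<epsilon> (F' n z) / z\<^sup>2)"
        by (intro set_integrable_over_square[where r = r0 and K = K]) (use F'_le r0 in auto)
      show "set_integrable lborel (- B \<rho>) (\<lambda>z. E_up \<epsilon> (F' n z) / z\<^sup>2)"
        by (intro set_integrable_over_square[where r = \<rho> and K = K]) (use F'_le r0 in auto)
    qed auto
    also have "(B \<rho> - B r0) \<union> - B \<rho> = - B r0" using r0 by (auto simp: B_def)
    finally show ?thesis by (simp add: J_def)
  qed
  have "(\<lambda>n. J (F' n)) \<longlonglongrightarrow> J f"
    unfolding J_def set_lebesgue_integral_def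
  proof (rule integral_dominated_convergence[where w = "\<lambda>z. K * (indicat_real (- B r0) z / z\<^sup>2)"])
    show "integrable lborel (\<lambda>z. K * (indicat_real (- B r0) z / z\<^sup>2))"
      by (rule integrable_mult_right[OF integrable_inverse_square_off_ball[OF r0(1)]])
    show "AE z in lborel. (\<lambda>n. indicat_real (- B r0) z *\<^sub>R (E_up \<epsilon> (F' n z) / z\<^sup>2)) \<longlonglongrightarrow>
        indicat_real (- B r0) z *\<^sub>R (E_up \<epsilon> (f z) / z\<^sup>2)"
    proof (intro AE_I2 tendsto_scaleR tendsto_const)
      fix z
      have "(\<lambda>n. E_up \<epsilon> (F' n z)) \<longlonglongrightarrow> E_up \<epsilon> (f z)"
      proof (cases "z \<in> B \<rho>")
        case True
        have "(\<lambda>n. F n z) \<longlonglongrightarrow> f z"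
          unfolding F_eq f_def U_def by (intro tendsto_intros w(4))
        \<comment> \<open>Approximation from above, as right continuity of \<open>E_up\<close>
          requires.\<close>
        moreover have "f z \<le> F n z" for n
          unfolding F_eq f_def U_def using \<theta>[of "xb + z"] w(2)[OF Q, of "xb + z" n]
          by (intro add_left_mono mult_left_mono) auto
        ultimately show ?thesis
          using True E_up_tendsto_from_above[OF \<epsilon>] by (simp add: F'_def)
      next
        case False
        then have "\<bar>z\<bar> \<ge> r1" using r1 by (auto simp: B_def)
        then show ?thesis using False \<theta>_0 by (simp add: F'_def f_def)
      qed
      then show "(\<lambda>n. E_up \<epsilon> (F' n z) / z\<^sup>2) \<longlonglongrightarrow> E_up \<epsilon> (f z) / z\<^sup>2"
        unfolding divide_inverse by (rule tendsto_mult_right)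
    qed
    show "AE z in lborel. norm (indicat_real (- B r0) z *\<^sub>R (E_up \<epsilon> (F' n z) / z\<^sup>2)) \<le> K * (indicat_real (- B r0) z / z\<^sup>2)" for n
      using F'_le by (intro AE_I2) (auto simp: indicator_def intro!: divide_right_mono)
    have [measurable]: "F' n \<in> borel_measurable borel" for n unfolding F'_def[abs_def] by measurable
    show "(\<lambda>z. indicat_real (- B r0) z *\<^sub>R (E_up \<epsilon> (F' n z) / z\<^sup>2)) \<in> borel_measurable lborel" for n
      by measurable
  qed measurable
  then have "(\<lambda>n. \<bar>p\<bar> * J (F' n)) \<longlonglongrightarrow> \<bar>p\<bar> * J f"
    by (rule tendsto_mult_left)
  then have "q \<le> \<bar>p\<bar> * J f"
    by (rule LIMSEQ_le_const) (use q_le in auto)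
  \<comment> \<open>On the annulus between \<open>r0\<close> and \<open>r1\<close> touching at time
    \<open>tb\<close> gives \<open>U z \<le> T z\<close>, so the mixture \<open>f\<close> may be
    replaced by \<open>T\<close>, whose contribution vanishes by oddness.\<close>
  also have "J f \<le> (LINT z:- B r1|lborel. E_up \<epsilon> (U z) / z\<^sup>2)"
  proof -
    have int: "set_integrable lborel (B r1 - B r0) (\<lambda>z. E_up \<epsilon> (g z) / z\<^sup>2)"
      if "g \<in> borel_measurable borel" "\<And>z. \<bar>z\<bar> \<le> r1 \<Longrightarrow> \<bar>E_up \<epsilon> (g z)\<bar> \<le> K" for g
      by (rule set_integrable_over_square[where r = r0 and K = K])
        (use that r0 in \<open>auto simp: B_def\<close>)
    have "- B r0 = (B r1 - B r0) \<union> - B r1" using r0 by (auto simp: B_def)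
    moreover have "(LINT z:(B r1 - B r0) \<union> - B r1|lborel. E_up \<epsilon> (f z) / z\<^sup>2) =
        (LINT z:B r1 - B r0|lborel. E_up \<epsilon> (f z) / z\<^sup>2) + (LINT z:- B r1|lborel. E_up \<epsilon> (f z) / z\<^sup>2)"
    proof (rule set_integral_Un)
      show "set_integrable lborel (- B r1) (\<lambda>z. E_up \<epsilon> (f z) / z\<^sup>2)"
        by (intro set_integrable_over_square[where r = r1 and K = K]) (use Ef_le r1 in auto)
    qed (use Ef_le in \<open>auto intro!: int\<close>)
    moreover have "(LINT z:- B r1|lborel. E_up \<epsilon> (f z) / z\<^sup>2) = (LINT z:- B r1|lborel. E_up \<epsilon> (U z) / z\<^sup>2)"
      using \<theta>_0 by (intro set_lebesgue_integral_cong) (auto simp: f_def B_def)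
    moreover have "(LINT z:B r1 - B r0|lborel. E_up \<epsilon> (f z) / z\<^sup>2) \<le> (LINT z:B r1 - B r0|lborel. E_up \<epsilon> (T z) / z\<^sup>2)"
    proof (rule set_integral_mono)
      show "set_integrable lborel (B r1 - B r0) (\<lambda>z. E_up \<epsilon> (T z) / z\<^sup>2)"
      proof (rule int)
        show "\<bar>E_up \<epsilon> (T z)\<bar> \<le> K" if "\<bar>z\<bar> \<le> r1" for z
          using T_le[OF that] U_le[of 0] \<epsilon> by (simp add: K_def)
      qed measurable
      fix z assume "z \<in> B r1 - B r0"
      then have "\<bar>(xb + z) - xb\<bar> \<le> r1" by (auto simp: B_def)
      then have "U z \<le> T z"
        using strip[OF \<open>tb > 0\<close>, of "xb + z"] by (simp add: U_def T_def)
      then have "f z \<le> T z"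
        unfolding f_def using \<theta>[of "xb + z"] by (intro convex_bound_le) auto
      then show "E_up \<epsilon> (f z) / z\<^sup>2 \<le> E_up \<epsilon> (T z) / z\<^sup>2"
        by (intro divide_right_mono E_up_mono \<epsilon>) auto
    qed (use Ef_le in \<open>auto intro!: int\<close>)
    moreover have "(LINT z:B r1 - B r0|lborel. E_up \<epsilon> (T z) / z\<^sup>2) = 0"
      unfolding set_lebesgue_integral_def
    proof (rule integral_odd_eq_0)
      fix z
      show "indicat_real (B r1 - B r0) (- z) *\<^sub>R (E_up \<epsilon> (T (- z)) / (- z)\<^sup>2) =
          - (indicat_real (B r1 - B r0) z *\<^sub>R (E_up \<epsilon> (T z) / z\<^sup>2))"
        using T_odd[of z] by (auto simp: indicator_def B_def)
    qed
    ultimately show ?thesis by (simp add: J_def)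
  qed
  finally show ?thesis by (simp add: U_def u0_def mult_left_mono)
qed

section \<open>The doubled functional at a maximum\<close>

text \<open>The increment factors as
  \<open>c * ((d + z)\<^sup>2 + d\<^sup>2) * (z * (2 * d + z))\<close>, so for small
  \<open>z\<close> its sign is that of \<open>z * d\<close>; being smaller than
  \<open>\<epsilon>\<close>, it is sent to plus or minus \<open>\<epsilon> / 2\<close>.\<close>

lemma E_up_quartic_increment:
  assumes "\<epsilon> > 0" "c > 0" "d \<noteq> 0"
  obtains r where "r > 0" "\<And>z. \<bar>z\<bar> \<le> r \<Longrightarrow> z \<noteq> 0 \<Longrightarrow>
    E_up \<epsilon> (c * ((d + z) ^ 4 - d ^ 4)) = sgn (z * (4 * c * d ^ 3)) * (\<epsilon> / 2)"
proof -
  have "((\<lambda>z. c * ((d + z) ^ 4 - d ^ 4)) \<longlongrightarrow> c * ((d + 0) ^ 4 - d ^ 4)) (at 0)"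
    by (intro tendsto_intros)
  then have "\<forall>\<^sub>F z in at 0. dist (c * ((d + z) ^ 4 - d ^ 4)) 0 < \<epsilon>"
    using assms(1) by (intro tendstoD) auto
  then obtain e where e: "e > 0" "\<And>z. z \<noteq> 0 \<Longrightarrow> \<bar>z\<bar> < e \<Longrightarrow> \<bar>c * ((d + z) ^ 4 - d ^ 4)\<bar> < \<epsilon>"
    unfolding eventually_at by (auto simp: dist_real_def)
  show thesis
  proof (rule that)
    \<comment> \<open>Halving \<open>e\<close> turns the strict bound on \<open>z\<close> into a
      weak one; \<open>\<bar>d\<bar>\<close> keeps the sign of \<open>2 * d + z\<close> equal to
      that of \<open>d\<close>.\<close>
    show "min (e / 2) \<bar>d\<bar> > 0" using e(1) assms(3) by simp
    fix z assume z: "\<bar>z\<bar> \<le> min (e / 2) \<bar>d\<bar>" "z \<noteq> 0"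
    define y where "y = c * ((d + z) ^ 4 - d ^ 4)"
    have small: "\<bar>y\<bar> < \<epsilon>" unfolding y_def using z e(1) by (intro e(2)) auto
    have y_eq: "y = c * ((d + z)\<^sup>2 + d\<^sup>2) * (z * (2 * d + z))"
      unfolding y_def by algebra
    have pos: "c * ((d + z)\<^sup>2 + d\<^sup>2) > 0"
      using assms(2,3) by (intro mult_pos_pos add_nonneg_pos) auto
    have b: "sgn (2 * d + z) = sgn d"
      using z assms(3) by (auto simp: sgn_if abs_if split: if_splits)
    have a: "sgn y = sgn (c * ((d + z)\<^sup>2 + d\<^sup>2)) * (sgn z * sgn (2 * d + z))"
      unfolding y_eq by (simp only: sgn_mult)
    have "sgn y = sgn (z * d)"
      unfolding a b sgn_pos[OF pos] by (simp add: sgn_mult)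
    also have "\<dots> = sgn (z * (4 * c * d ^ 3))"
    proof -
      have "z * (4 * c * d ^ 3) = (4 * c * d\<^sup>2) * (z * d)"
        by (simp add: power3_eq_cube power2_eq_square algebra_simps)
      moreover have "sgn (4 * c * d\<^sup>2) = 1" using assms(2,3) by (intro sgn_pos) auto
      ultimately show ?thesis by (simp only: sgn_mult[of "4 * c * d\<^sup>2"] mult_1)
    qed
    finally have sgn_y: "sgn y = sgn (z * (4 * c * d ^ 3))" .
    have "y \<noteq> 0" using sgn_y z(2) assms(2,3) by (auto simp: sgn_zero_iff)
    have "E_up \<epsilon> y = sgn y * (\<epsilon> / 2)"
    proof (cases "y > 0")
      case True
      then show ?thesis using E_up_eq_half[of y \<epsilon>] small by simp
    next
      case False
      then show ?thesis using E_up_eq_minus_half[of \<epsilon> y] small \<open>y \<noteq> 0\<close> by simp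
    qed
    then show "E_up \<epsilon> (c * ((d + z) ^ 4 - d ^ 4)) = sgn (z * (4 * c * d ^ 3)) * (\<epsilon> / 2)"
      unfolding sgn_y by (simp only: y_def)
  qed
qed

text \<open>The kernel \<open>1 / z\<^sup>2\<close> capped at height 1. What is cut off is
  nonnegative and supported in \<open>\<bar>z\<bar> \<le> 1\<close>; the rest is integrable and can
  be translated at small cost.\<close>

definition far_kernel :: "real \<Rightarrow> real" where
  "far_kernel z = 1 / max 1 (z\<^sup>2)"

lemma far_kernel_bounds: "0 < far_kernel z" "far_kernel z \<le> 1" "z \<noteq> 0 \<Longrightarrow> far_kernel z \<le> 1 / z\<^sup>2"
proof -
  show "0 < far_kernel z" by (auto simp: far_kernel_def max_def intro: less_le_trans[OF zero_less_one])
  show "far_kernel z \<le> 1" by (simp add: far_kernel_def)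
  show "far_kernel z \<le> 1 / z\<^sup>2" if "z \<noteq> 0"
    unfolding far_kernel_def using that by (intro divide_left_mono) auto
qed

lemma far_kernel_eq: "\<bar>z\<bar> \<ge> 1 \<Longrightarrow> far_kernel z = 1 / z\<^sup>2"
  using abs_le_square_iff[of 1 z] by (simp add: far_kernel_def max_def)

lemma borel_measurable_far_kernel [measurable]: "far_kernel \<in> borel_measurable borel"
  unfolding far_kernel_def[abs_def] by measurable

lemma integrable_far_kernel_shift: "integrable lborel (\<lambda>z. far_kernel (z - x))"
  and integral_far_kernel_shift: "(LINT z|lborel. far_kernel (z - x)) = (LINT z|lborel. far_kernel z)"
proof -
  have "integrable lborel far_kernel"
    using integrable_far_kernel by (simp add: far_kernel_def[abs_def])
  then show "integrable lborel (\<lambda>z. far_kernel (z - x))"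
    using lborel_integrable_real_affine[of far_kernel 1 "- x"] by simp
  show "(LINT z|lborel. far_kernel (z - x)) = (LINT z|lborel. far_kernel z)"
    using lborel_integral_real_affine[of 1 far_kernel "- x"] by simp
qed

lemma integrable_far_kernel_mult:
  assumes "g \<in> borel_measurable borel" "\<And>z. \<bar>g z\<bar> \<le> K"
  shows "integrable lborel (\<lambda>z. far_kernel (z - x) * g z)"
proof (rule Bochner_Integration.integrable_bound)
  show "integrable lborel (\<lambda>z. K * far_kernel (z - x))"
    by (intro integrable_mult_right integrable_far_kernel_shift)
  show "AE z in lborel. norm (far_kernel (z - x) * g z) \<le> norm (K * far_kernel (z - x))"
  proof (intro AE_I2)
    fix z
    have "\<bar>g z\<bar> \<le> \<bar>K\<bar>" using assms(2)[of z] by linarith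
    then show "norm (far_kernel (z - x) * g z) \<le> norm (K * far_kernel (z - x))"
      by (simp add: abs_mult mult.commute mult_right_mono)
  qed
qed (use assms in measurable)

text \<open>With \<open>A = max 1 (a\<^sup>2)\<close> and \<open>B = max 1 (b\<^sup>2)\<close> one
  has \<open>\<bar>A - B\<bar> \<le> \<bar>a - b\<bar> * \<bar>a + b\<bar>\<close> and
  \<open>\<bar>a\<bar> \<le> A\<close>, \<open>\<bar>b\<bar> \<le> B\<close>; division by
  \<open>A * B\<close> gives the claim. Its right side is integrable, so moving the kernel costs a
  multiple of the shift in the integral norm.\<close>

lemma far_kernel_diff_le: "\<bar>far_kernel a - far_kernel b\<bar> \<le> \<bar>a - b\<bar> * (far_kernel a + far_kernel b)"
proof -
  define A B where "A = max 1 (a\<^sup>2)" and "B = max 1 (b\<^sup>2)"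
  have AB: "A \<ge> 1" "B \<ge> 1" by (simp_all add: A_def B_def)
  have le: "\<bar>x\<bar> \<le> max 1 (x\<^sup>2)" for x :: real
  proof (cases "\<bar>x\<bar> \<le> 1")
    case False
    then have "\<bar>x\<bar> * 1 \<le> \<bar>x\<bar> * \<bar>x\<bar>" by (intro mult_left_mono) auto
    then show ?thesis by (simp add: power2_eq_square)
  qed simp
  have "\<bar>A - B\<bar> \<le> \<bar>a\<^sup>2 - b\<^sup>2\<bar>" by (auto simp: A_def B_def max_def)
  also have "\<dots> = \<bar>a - b\<bar> * \<bar>a + b\<bar>" by (simp flip: abs_mult add: power2_eq_square algebra_simps)
  also have "\<dots> \<le> \<bar>a - b\<bar> * (A + B)"
    using le[of a] le[of b] by (intro mult_left_mono) (auto simp: A_def B_def)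
  finally have "\<bar>A - B\<bar> / (A * B) \<le> \<bar>a - b\<bar> * (A + B) / (A * B)"
    using AB by (intro divide_right_mono) auto
  moreover have "\<bar>1 / A - 1 / B\<bar> = \<bar>A - B\<bar> / (A * B)"
  proof -
    have "1 / A - 1 / B = (B - A) / (A * B)" using AB by (simp add: field_simps)
    then show ?thesis using AB by (simp add: abs_mult abs_minus_commute)
  qed
  moreover have "\<bar>a - b\<bar> * (A + B) / (A * B) = \<bar>a - b\<bar> * (1 / A + 1 / B)"
    using AB by (simp add: field_simps)
  ultimately show ?thesis by (simp add: far_kernel_def A_def B_def)
qed

text \<open>Maximality is global over the box in space and local in time, which is all the touching
  lemmas need. The margin 1 to the edge of the box admits all common increments with
  \<open>\<bar>z\<bar> \<le> 1\<close>, exactly where the cut-off part of the kernel lives.\<close>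

locale doubling_maximum =
  fixes \<epsilon> \<rho> C c k lam r R tb xb sb yb :: real and u w :: "real \<times> real \<Rightarrow> real"
  assumes \<epsilon>: "\<epsilon> > 0" and \<rho>: "\<rho> > 0"
    and sub_u: "subsolution \<rho> \<epsilon> u" and sub_w: "subsolution \<rho> \<epsilon> w"
    and bound_u: "\<forall>p\<in>Q. \<bar>u p\<bar> \<le> C" and bound_w: "\<forall>p\<in>Q. \<bar>w p\<bar> \<le> C"
    and c: "c > 0" and r: "0 < r" "r \<le> 1" and tb: "tb > 0" and sb: "sb > 0"
    and xb: "\<bar>xb\<bar> \<le> R - 1" and yb: "\<bar>yb\<bar> \<le> R - 1"
    and max: "\<And>t x s y. t > 0 \<Longrightarrow> s > 0 \<Longrightarrow> \<bar>t - tb\<bar> \<le> r \<Longrightarrow> \<bar>s - sb\<bar> \<le> r \<Longrightarrow> \<bar>x\<bar> \<le> R \<Longrightarrow> \<bar>y\<bar> \<le> R \<Longrightarrow>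
      u (t, x) + w (s, y) - c * (x - y) ^ 4 - k * (t - s)\<^sup>2 - lam * t
      \<le> u (tb, xb) + w (sb, yb) - c * (xb - yb) ^ 4 - k * (tb - sb)\<^sup>2 - lam * tb"
begin

text \<open>Freezing the other pair of variables in the maximum. The time slope found here and the
  one in \<open>touch_w\<close> add up to \<open>lam\<close>, whatever \<open>k\<close> is.\<close>

lemma touch_u:
  assumes "t > 0" "\<bar>t - tb\<bar> \<le> r" "\<bar>x - xb\<bar> \<le> r"
  shows "u (t, x) \<le> u (tb, xb) + c * ((x - yb) ^ 4 - (xb - yb) ^ 4)
    + (lam + 2 * k * (tb - sb)) * (t - tb) + k * (t - tb)\<^sup>2"
proof -
  have "\<bar>x\<bar> \<le> R" "\<bar>yb\<bar> \<le> R" using assms(3) r xb yb by linarith+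
  then have "u (t, x) + w (sb, yb) - c * (x - yb) ^ 4 - k * (t - sb)\<^sup>2 - lam * t
      \<le> u (tb, xb) + w (sb, yb) - c * (xb - yb) ^ 4 - k * (tb - sb)\<^sup>2 - lam * tb"
    using assms sb r by (intro max) auto
  moreover have "k * (t - sb)\<^sup>2 - k * (tb - sb)\<^sup>2 = 2 * k * (tb - sb) * (t - tb) + k * (t - tb)\<^sup>2"
    by (simp add: power2_eq_square algebra_simps)
  ultimately show ?thesis by (simp add: algebra_simps)
qed

lemma touch_w:
  assumes "s > 0" "\<bar>s - sb\<bar> \<le> r" "\<bar>y - yb\<bar> \<le> r"
  shows "w (s, y) \<le> w (sb, yb) + c * ((y - xb) ^ 4 - (yb - xb) ^ 4)
    + 2 * k * (sb - tb) * (s - sb) + k * (s - sb)\<^sup>2"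
proof -
  have "\<bar>xb\<bar> \<le> R" "\<bar>y\<bar> \<le> R" using assms(3) r xb yb by linarith+
  then have "u (tb, xb) + w (s, y) - c * (xb - y) ^ 4 - k * (tb - s)\<^sup>2 - lam * tb
      \<le> u (tb, xb) + w (sb, yb) - c * (xb - yb) ^ 4 - k * (tb - sb)\<^sup>2 - lam * tb"
    using assms tb r by (intro max) auto
  moreover have "k * (tb - s)\<^sup>2 - k * (tb - sb)\<^sup>2 = 2 * k * (sb - tb) * (s - sb) + k * (s - sb)\<^sup>2"
    by (simp add: power2_eq_square algebra_simps)
  moreover have "(xb - y) ^ 4 = (y - xb) ^ 4" "(xb - yb) ^ 4 = (yb - xb) ^ 4"
    by (simp_all add: power4_eq_xxxx algebra_simps)
  ultimately show ?thesis by (simp add: algebra_simps)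
qed

lemma lam_le_on_diagonal:
  assumes "xb = yb"
  shows "lam \<le> 0"
proof -
  have "lam + 2 * k * (tb - sb) \<le> 0"
    by (rule subsolution_zero_gradient[OF sub_u bound_u tb r(1), where c = c and \<kappa> = k and xb = xb])
      (use c touch_u assms in auto)
  moreover have "2 * k * (sb - tb) \<le> 0"
    by (rule subsolution_zero_gradient[OF sub_w bound_w sb r(1), where c = c and \<kappa> = k and xb = yb])
      (use c touch_w assms in auto)
  ultimately show ?thesis by (simp add: algebra_simps)
qed

definition U :: "real \<Rightarrow> real" where "U z = u (tb, xb + z) - u (tb, xb)"

definition W :: "real \<Rightarrow> real" where "W z = w (sb, yb + z) - w (sb, yb)"

lemma measurable_slices [measurable]:
  "(\<lambda>x. u (tb, x)) \<in> borel_measurable borel" "(\<lambda>x. w (sb, x)) \<in> borel_measurable borel"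
  using sub_u sub_w tb sb by (auto simp: subsolution_def intro!: borel_measurable_usc_slice)

lemma measurable_increments [measurable]: "U \<in> borel_measurable borel" "W \<in> borel_measurable borel"
  unfolding U_def[abs_def] W_def[abs_def] by measurable

lemma E_up_increment_le:
  "\<bar>E_up \<epsilon> (u (tb, x) - u (tb, x'))\<bar> \<le> 2 * C + \<epsilon>" "\<bar>E_up \<epsilon> (w (sb, x) - w (sb, x'))\<bar> \<le> 2 * C + \<epsilon>"
proof -
  have "\<bar>u (tb, x)\<bar> \<le> C" "\<bar>w (sb, x)\<bar> \<le> C" for x
    using bound_u bound_w tb sb by (auto simp: Q_def)
  then have "\<bar>u (tb, x) - u (tb, x')\<bar> \<le> C + C" "\<bar>w (sb, x) - w (sb, x')\<bar> \<le> C + C"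
    by (meson abs_triangle_ineq4 add_mono order_trans)+
  then show "\<bar>E_up \<epsilon> (u (tb, x) - u (tb, x'))\<bar> \<le> 2 * C + \<epsilon>"
    "\<bar>E_up \<epsilon> (w (sb, x) - w (sb, x'))\<bar> \<le> 2 * C + \<epsilon>"
    using abs_E_up_le[OF \<epsilon>, of "u (tb, x) - u (tb, x')"] abs_E_up_le[OF \<epsilon>, of "w (sb, x) - w (sb, x')"] \<epsilon>
    by argo+
qed

text \<open>If \<open>U z + W z = 0\<close> then the translate by \<open>z\<close> of the maximum is again a maximum.  There \<open>u\<close> has
  slope \<open>4 c (xb - yb) ^ 3 \<noteq> 0\<close>, so such points on one level of \<open>u\<close> are isolated.\<close>

lemma countable_bad_increments:
  assumes "xb \<noteq> yb"
  shows "countable {z. \<bar>z\<bar> \<le> 1 \<and> U z + W z = 0 \<and> U z / \<epsilon> \<in> \<int>}" (is "countable ?Z")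
proof -
  define d where "d = xb - yb"
  have d: "d \<noteq> 0" using assms by (simp add: d_def)
  \<comment> \<open>Shifting \<open>xb\<close> by \<open>z'\<close> and \<open>yb\<close> by
    \<open>z\<close> loses nothing in \<open>u\<close> and \<open>w\<close>, because
    \<open>U z' + W z = 0\<close>; maximality then forbids a smaller penalty.\<close>
  have sep: "\<bar>d\<bar> \<le> \<bar>d + (z' - z)\<bar>" if "z \<in> ?Z" "z' \<in> ?Z" "U z = U z'" for z z'
  proof -
    have "\<bar>xb + z'\<bar> \<le> R" "\<bar>yb + z\<bar> \<le> R" using that xb yb by auto
    then have "u (tb, xb + z') + w (sb, yb + z) - c * (xb + z' - (yb + z)) ^ 4 - k * (tb - sb)\<^sup>2 - lam * tb
      \<le> u (tb, xb) + w (sb, yb) - c * (xb - yb) ^ 4 - k * (tb - sb)\<^sup>2 - lam * tb"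
      using tb sb r by (intro max) auto
    then have "U z' + W z - c * (d + (z' - z)) ^ 4 \<le> - c * d ^ 4"
      by (simp add: U_def W_def d_def algebra_simps)
    then have "d ^ 4 \<le> (d + (z' - z)) ^ 4" using that c by simp
    then have "\<bar>d\<bar> ^ 4 \<le> \<bar>d + (z' - z)\<bar> ^ 4" by simp
    then show ?thesis by (rule power_mono_iff[THEN iffD1, rotated -1]) auto
  qed
  \<comment> \<open>\<open>sep\<close> in both directions shows that distinct bad points on one
    level are at least \<open>2 * \<bar>d\<bar>\<close> apart. The level and a half-open cell of
    that length thus determine the point.\<close>
  have "inj_on (\<lambda>z. (\<lfloor>U z / \<epsilon>\<rfloor>, \<lfloor>z / (2 * \<bar>d\<bar>)\<rfloor>)) ?Z"
  proof (rule inj_onI)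
    fix z z' assume z: "z \<in> ?Z" "z' \<in> ?Z"
      and eq: "(\<lfloor>U z / \<epsilon>\<rfloor>, \<lfloor>z / (2 * \<bar>d\<bar>)\<rfloor>) = (\<lfloor>U z' / \<epsilon>\<rfloor>, \<lfloor>z' / (2 * \<bar>d\<bar>)\<rfloor>)"
    have "U z / \<epsilon> = of_int \<lfloor>U z / \<epsilon>\<rfloor>" "U z' / \<epsilon> = of_int \<lfloor>U z' / \<epsilon>\<rfloor>"
      using z by (simp_all add: of_int_floor)
    then have "U z / \<epsilon> = U z' / \<epsilon>" using eq by simp
    then have "U z = U z'" using \<epsilon> by simp
    then have "\<bar>d\<bar> \<le> \<bar>d + (z' - z)\<bar>" "\<bar>d\<bar> \<le> \<bar>d + (z - z')\<bar>"
      using sep[OF z] sep[OF z(2,1)] by simp_all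
    moreover have floor_eq: "\<lfloor>z / (2 * \<bar>d\<bar>)\<rfloor> = \<lfloor>z' / (2 * \<bar>d\<bar>)\<rfloor>" using eq by blast
    have "\<bar>z / (2 * \<bar>d\<bar>) - z' / (2 * \<bar>d\<bar>)\<bar> < 1"
      using floor_correct[of "z / (2 * \<bar>d\<bar>)", unfolded floor_eq] floor_correct[of "z' / (2 * \<bar>d\<bar>)"]
      unfolding abs_less_iff of_int_add of_int_1 by argo
    then have "\<bar>z - z'\<bar> < 2 * \<bar>d\<bar>"
      using d by (simp flip: diff_divide_distrib)
    ultimately show "z = z'" by (auto simp: abs_if split: if_splits)
  qed
  then show ?thesis by (rule countable_image_inj_on[rotated]) simp
qed

text \<open>A common increment leaves the penalty unchanged, so maximality yields
  \<open>U z + W z \<le> 0\<close>; the exceptional case of \<open>E_up_add_nonpos\<close> is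
  confined to a countable set.\<close>

lemma near_increments:
  assumes "xb \<noteq> yb"
  shows "AE z in lborel. \<bar>z\<bar> \<le> 1 \<longrightarrow> E_up \<epsilon> (U z) + E_up \<epsilon> (W z) \<le> 0"
proof -
  have "{z. \<bar>z\<bar> \<le> 1 \<and> U z + W z = 0 \<and> U z / \<epsilon> \<in> \<int>} \<in> null_sets lborel"
    using countable_bad_increments[OF assms] by (rule countable_imp_null_set_lborel)
  then show ?thesis
  proof (rule AE_not_in[THEN AE_mp], intro AE_I2 impI)
    fix z assume nb: "z \<notin> {z. \<bar>z\<bar> \<le> 1 \<and> U z + W z = 0 \<and> U z / \<epsilon> \<in> \<int>}" and z: "\<bar>z\<bar> \<le> 1"
    have "\<bar>xb + z\<bar> \<le> R" "\<bar>yb + z\<bar> \<le> R" using z xb yb by auto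
    then have "u (tb, xb + z) + w (sb, yb + z) - c * (xb + z - (yb + z)) ^ 4 - k * (tb - sb)\<^sup>2 - lam * tb
      \<le> u (tb, xb) + w (sb, yb) - c * (xb - yb) ^ 4 - k * (tb - sb)\<^sup>2 - lam * tb"
      using tb sb r by (intro max) auto
    then have "U z + W z \<le> 0" by (simp add: U_def W_def)
    then show "E_up \<epsilon> (U z) + E_up \<epsilon> (W z) \<le> 0"
      using nb z by (intro E_up_add_nonpos \<epsilon>) auto
  qed
qed

text \<open>The two inequalities are added, so that \<open>k\<close> cancels. The nonnegative part
  \<open>1 / z\<^sup>2 - far_kernel z\<close> multiplies a nonpositive quantity by
  \<open>near_increments\<close> and may be dropped; then \<open>r1\<close> tends to 0.\<close>

lemma lam_le_far_integral:
  assumes "xb \<noteq> yb"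
  defines "p \<equiv> 4 * c * (xb - yb) ^ 3"
  shows "lam \<le> \<bar>p\<bar> * (LINT z|lborel. far_kernel z * (E_up \<epsilon> (U z) + E_up \<epsilon> (W z)))"
proof -
  define K where "K = 2 * C + \<epsilon>"
  define S where "S z = E_up \<epsilon> (U z) + E_up \<epsilon> (W z)" for z
  define G where "G = (LINT z|lborel. far_kernel z * S z)"
  have E_le: "\<bar>E_up \<epsilon> (U z)\<bar> \<le> K" "\<bar>E_up \<epsilon> (W z)\<bar> \<le> K" for z
    unfolding U_def W_def K_def by (rule E_up_increment_le)+
  then have S_le: "\<bar>S z\<bar> \<le> 2 * K" for z
    unfolding S_def using abs_triangle_ineq[of "E_up \<epsilon> (U z)" "E_up \<epsilon> (W z)"] E_le[of z] by argo
  have K: "K \<ge> 0" using order_trans[OF abs_ge_zero S_le[of 0]] by simp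
  have [measurable]: "S \<in> borel_measurable borel" unfolding S_def[abs_def] by measurable
  have p: "p \<noteq> 0" using assms(1) c by (simp add: p_def)
  obtain r3 where r3: "r3 > 0" "\<And>z. \<bar>z\<bar> \<le> r3 \<Longrightarrow> z \<noteq> 0 \<Longrightarrow>
    E_up \<epsilon> (c * ((xb - yb + z) ^ 4 - (xb - yb) ^ 4)) = sgn (z * (4 * c * (xb - yb) ^ 3)) * (\<epsilon> / 2)"
    using E_up_quartic_increment[OF \<epsilon> c, of "xb - yb"] assms(1) by auto
  obtain r4 where r4: "r4 > 0" "\<And>z. \<bar>z\<bar> \<le> r4 \<Longrightarrow> z \<noteq> 0 \<Longrightarrow>
    E_up \<epsilon> (c * ((yb - xb + z) ^ 4 - (yb - xb) ^ 4)) = sgn (z * (4 * c * (yb - xb) ^ 3)) * (\<epsilon> / 2)"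
    using E_up_quartic_increment[OF \<epsilon> c, of "yb - xb"] assms(1) by auto
  have p': "4 * c * (yb - xb) ^ 3 = - p"
    unfolding p_def by (simp add: power3_eq_cube algebra_simps)
  define r5 where "r5 = Min {r, \<rho>, r3, r4}"
  have r5: "r5 > 0" "r5 \<le> r" "r5 \<le> \<rho>" "r5 \<le> r3" "r5 \<le> r4"
    using r \<rho> r3(1) r4(1) by (auto simp: r5_def)
  \<comment> \<open>The error comes from adding \<open>B r1\<close> to the domain of the bounded
    kernel: an integrand of size at most \<open>2 * K\<close> on length
    \<open>2 * r1\<close>.\<close>
  have le: "lam \<le> \<bar>p\<bar> * (G + 4 * K * r1)" if r1: "0 < r1" "r1 \<le> r5" for r1
  proof -
    have "lam + 2 * k * (tb - sb) \<le> \<bar>p\<bar> * (LINT z:- B r1|lborel. E_up \<epsilon> (U z) / z\<^sup>2)"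
      unfolding U_def
    proof (rule subsolution_nonzero_gradient[OF sub_u bound_u \<epsilon> tb r(1) less_imp_le[OF c] touch_u])
      show "p = 4 * c * (xb - yb) ^ 3" by (simp add: p_def)
      show "E_up \<epsilon> (c * ((xb + z - yb) ^ 4 - (xb - yb) ^ 4)) = sgn (z * p) * (\<epsilon> / 2)"
        if "\<bar>z\<bar> \<le> r1" "z \<noteq> 0" for z
        using r3(2)[of z] that r1 r5 by (simp add: p_def diff_add_eq)
    qed (use p r1 r5 in auto)
    moreover have "2 * k * (sb - tb) \<le> \<bar>- p\<bar> * (LINT z:- B r1|lborel. E_up \<epsilon> (W z) / z\<^sup>2)"
      unfolding W_def
    proof (rule subsolution_nonzero_gradient[OF sub_w bound_w \<epsilon> sb r(1) less_imp_le[OF c] touch_w])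
      show "- p = 4 * c * (yb - xb) ^ 3" by (simp add: p')
      show "E_up \<epsilon> (c * ((yb + z - xb) ^ 4 - (yb - xb) ^ 4)) = sgn (z * (- p)) * (\<epsilon> / 2)"
        if "\<bar>z\<bar> \<le> r1" "z \<noteq> 0" for z
        using r4(2)[of z] that r1 r5 by (simp only: p' diff_add_eq) auto
    qed (use p r1 r5 in auto)
    ultimately have "lam \<le> \<bar>p\<bar> * ((LINT z:- B r1|lborel. E_up \<epsilon> (U z) / z\<^sup>2) + (LINT z:- B r1|lborel. E_up \<epsilon> (W z) / z\<^sup>2))"
      by (simp add: algebra_simps)
    also have "(LINT z:- B r1|lborel. E_up \<epsilon> (U z) / z\<^sup>2) + (LINT z:- B r1|lborel. E_up \<epsilon> (W z) / z\<^sup>2)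
        = (LINT z:- B r1|lborel. S z / z\<^sup>2)"
      unfolding S_def add_divide_distrib
      by (rule set_integral_add(2)[symmetric]; rule set_integrable_over_square[where r = r1 and K = K])
        (use E_le r1 in auto)
    also have "\<dots> \<le> G + 4 * K * r1"
    proof -
      define near where "near z = indicat_real (- B r1) z * (1 / z\<^sup>2 - far_kernel z) * S z" for z
      have int1: "integrable lborel (\<lambda>z. indicat_real (- B r1) z *\<^sub>R (S z / z\<^sup>2))"
        using set_integrable_over_square[of S "- B r1" r1 "2 * K"] S_le r1(1)
        by (simp add: set_integrable_def)
      have int2: "integrable lborel (\<lambda>z. far_kernel z * S z)"
        using integrable_far_kernel_mult[of S "2 * K" 0] S_le by simp
      have "integrable lborel (\<lambda>z. far_kernel (z - 0) * (indicat_real (B r1) z * S z))"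
        by (rule integrable_far_kernel_mult[where K = "2 * K"])
          (use S_le K in \<open>auto simp: indicator_def\<close>)
      then have int3: "integrable lborel (\<lambda>z. indicat_real (B r1) z * far_kernel z * S z)"
        by (simp add: mult_ac)
      have int4: "integrable lborel (\<lambda>z. 2 * K * indicat_real (B r1) z)"
        by (intro integrable_mult_right integrable_real_indicator) (use r1 in \<open>auto simp: B_def\<close>)
      have split: "near z = indicat_real (- B r1) z *\<^sub>R (S z / z\<^sup>2) - far_kernel z * S z
          + indicat_real (B r1) z * far_kernel z * S z" for z
        by (auto simp: near_def indicator_def algebra_simps)
      have "(LINT z|lborel. near z) = (LINT z:- B r1|lborel. S z / z\<^sup>2) - G
          + (LINT z|lborel. indicat_real (B r1) z * far_kernel z * S z)"
        unfolding split set_lebesgue_integral_def G_def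
        using int1 int2 int3 by simp
      moreover have "0 \<le> (LINT z|lborel. - near z)"
      proof (rule Bochner_Integration.integral_nonneg_AE)
        show "AE z in lborel. 0 \<le> - near z"
          using near_increments[OF assms(1)]
        proof (rule AE_mp, intro AE_I2 impI)
          fix z assume *: "\<bar>z\<bar> \<le> 1 \<longrightarrow> E_up \<epsilon> (U z) + E_up \<epsilon> (W z) \<le> 0"
          show "0 \<le> - near z"
          proof (cases "z \<in> B r1 \<or> \<bar>z\<bar> \<ge> 1")
            case True
            then show ?thesis by (auto simp: near_def far_kernel_eq)
          next
            case False
            then have "z \<noteq> 0" using r1 by (auto simp: B_def)
            then show ?thesis
              using * False far_kernel_bounds(3)[of z]
              by (auto simp: near_def S_def intro!: mult_nonneg_nonpos)
          qed
        qed
      qed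
      moreover have "- (LINT z|lborel. indicat_real (B r1) z * far_kernel z * S z) \<le> 4 * K * r1"
      proof -
        have "(LINT z|lborel. - (indicat_real (B r1) z * far_kernel z * S z)) \<le> (LINT z|lborel. 2 * K * indicat_real (B r1) z)"
        proof (rule Bochner_Integration.integral_mono)
          show "- (indicat_real (B r1) z * far_kernel z * S z) \<le> 2 * K * indicat_real (B r1) z" for z
          proof -
            have "\<bar>far_kernel z * S z\<bar> \<le> 1 * (2 * K)"
              unfolding abs_mult using far_kernel_bounds[of z] S_le[of z] by (intro mult_mono) auto
            then show ?thesis by (auto simp: indicator_def abs_le_iff)
          qed
        qed (use int3 int4 in auto)
        also have "\<dots> = 4 * K * r1"
          using r1 by (simp add: B_def)
        finally show ?thesis by simp
      qed
      ultimately show ?thesis by simp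
    qed
    finally show ?thesis by (simp add: mult_left_mono)
  qed
  have "((\<lambda>r1. \<bar>p\<bar> * (G + 4 * K * r1)) \<longlongrightarrow> \<bar>p\<bar> * (G + 4 * K * 0)) (at_right 0)"
    by (intro tendsto_intros)
  moreover have "\<forall>\<^sub>F r1 in at_right 0. lam \<le> \<bar>p\<bar> * (G + 4 * K * r1)"
    using le r5(1) by (intro eventually_at_rightI[of 0 r5]) auto
  ultimately have "lam \<le> \<bar>p\<bar> * (G + 4 * K * 0)"
    by (intro tendsto_lowerbound) auto
  then show ?thesis by (simp add: G_def S_def)
qed

text \<open>Away from the singularity \<open>u\<close> and \<open>w\<close> are compared at the same point \<open>y\<close> rather than at the
  same increment; inside the box this comparison is strict because of the penalty, and moving
  the kernel costs a multiple of \<open>\<bar>p\<bar> * \<bar>xb - yb\<bar> = 4 * c * (xb - yb) ^ 4\<close>.\<close>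

lemma lam_le_bad_set:
  assumes "xb \<noteq> yb"
  defines "p \<equiv> 4 * c * (xb - yb) ^ 3"
    and "bad \<equiv> {y. \<bar>y\<bar> > R \<and> u (tb, xb) + w (sb, yb) \<le> u (tb, y) + w (sb, y)}"
  shows "lam \<le> \<bar>p\<bar> * ((2 * C + \<epsilon>) * (2 * \<bar>xb - yb\<bar> * (LINT z|lborel. far_kernel z)
    + 2 * (LINT y|lborel. far_kernel (y - xb) * indicat_real bad y)))"
proof -
  define K where "K = 2 * C + \<epsilon>"
  define e1 where "e1 y = E_up \<epsilon> (u (tb, y) - u (tb, xb))" for y
  define e2 where "e2 y = E_up \<epsilon> (w (sb, y) - w (sb, yb))" for y
  have e_le: "\<bar>e1 y\<bar> \<le> K" "\<bar>e2 y\<bar> \<le> K" for y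
    unfolding e1_def e2_def K_def by (rule E_up_increment_le)+
  have [measurable]: "e1 \<in> borel_measurable borel" "e2 \<in> borel_measurable borel"
    unfolding e1_def[abs_def] e2_def[abs_def] by measurable
  have bad_sets [measurable]: "bad \<in> sets borel" unfolding bad_def by measurable
  have int: "integrable lborel (\<lambda>y. far_kernel (y - x) * e1 y)" "integrable lborel (\<lambda>y. far_kernel (y - x) * e2 y)" for x
    using e_le by (auto intro!: integrable_far_kernel_mult[where K = K])
  have shift: "(LINT z|lborel. far_kernel z * g (x + z)) = (LINT y|lborel. far_kernel (y - x) * g y)"
    for g :: "real \<Rightarrow> real" and x
    using lborel_integral_real_affine[of 1 "\<lambda>z. far_kernel z * g (x + z)" "- x"] by simp
  have int0: "integrable lborel (\<lambda>z. far_kernel z * E_up \<epsilon> (U z))" "integrable lborel (\<lambda>z. far_kernel z * E_up \<epsilon> (W z))"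
    using integrable_far_kernel_mult[of "\<lambda>z. E_up \<epsilon> (U z)" K 0] integrable_far_kernel_mult[of "\<lambda>z. E_up \<epsilon> (W z)" K 0]
      E_up_increment_le by (auto simp: K_def U_def[abs_def] W_def[abs_def])
  have nonpos: "e1 y + e2 y \<le> 2 * K * indicat_real bad y" for y
  proof (cases "y \<in> bad")
    case True
    then show ?thesis using e_le[of y] by (simp add: abs_le_iff)
  next
    case False
    have "u (tb, y) + w (sb, y) < u (tb, xb) + w (sb, yb)"
    proof (cases "\<bar>y\<bar> \<le> R")
      case True
      then have "u (tb, y) + w (sb, y) \<le> u (tb, xb) + w (sb, yb) - c * (xb - yb) ^ 4"
        using max[of tb sb y y] tb sb r by simp
      moreover have "c * (xb - yb) ^ 4 > 0" using c assms(1) by (simp add: zero_less_power_eq)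
      ultimately show ?thesis by simp
    next
      case y: False
      then show ?thesis using False by (auto simp: bad_def)
    qed
    then show ?thesis
      unfolding e1_def e2_def using False by (simp add: E_up_add_nonpos \<epsilon>)
  qed
  have "(LINT z|lborel. far_kernel z * (E_up \<epsilon> (U z) + E_up \<epsilon> (W z)))
      = (LINT z|lborel. far_kernel z * e1 (xb + z)) + (LINT z|lborel. far_kernel z * e2 (yb + z))"
    unfolding distrib_left using int0 by (simp add: e1_def e2_def U_def W_def)
  also have "\<dots> = (LINT y|lborel. far_kernel (y - xb) * e1 y) + (LINT y|lborel. far_kernel (y - yb) * e2 y)"
    by (simp only: shift)
  also have "\<dots> = (LINT y|lborel. far_kernel (y - xb) * e1 y + far_kernel (y - yb) * e2 y)"
    using int by simp
  also have "\<dots> \<le> (LINT y|lborel. 2 * K * (far_kernel (y - xb) * indicat_real bad y)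
      + K * \<bar>xb - yb\<bar> * (far_kernel (y - yb) + far_kernel (y - xb)))"
  proof (rule Bochner_Integration.integral_mono)
    show "integrable lborel (\<lambda>y. far_kernel (y - xb) * e1 y + far_kernel (y - yb) * e2 y)"
      using int by simp
    have "integrable lborel (\<lambda>y. far_kernel (y - xb) * indicat_real bad y)"
      by (rule integrable_far_kernel_mult[where K = 1]) (auto simp: indicator_def)
    then show "integrable lborel (\<lambda>y. 2 * K * (far_kernel (y - xb) * indicat_real bad y)
        + K * \<bar>xb - yb\<bar> * (far_kernel (y - yb) + far_kernel (y - xb)))"
      using integrable_far_kernel_shift by simp
    fix y
    \<comment> \<open>Both increments are first given the kernel centred at \<open>xb\<close>;
      recentring the kernel of \<open>e2\<close> leaves the error estimated next.\<close>
    have "far_kernel (y - xb) * (e1 y + e2 y) \<le> far_kernel (y - xb) * (2 * K * indicat_real bad y)"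
      using nonpos far_kernel_bounds[of "y - xb"] by (intro mult_left_mono) auto
    moreover have "(far_kernel (y - yb) - far_kernel (y - xb)) * e2 y \<le>
        (\<bar>xb - yb\<bar> * (far_kernel (y - yb) + far_kernel (y - xb))) * K"
    proof -
      have "(far_kernel (y - yb) - far_kernel (y - xb)) * e2 y \<le> \<bar>far_kernel (y - yb) - far_kernel (y - xb)\<bar> * \<bar>e2 y\<bar>"
        by (metis abs_ge_self abs_mult)
      also have "\<dots> \<le> (\<bar>(y - yb) - (y - xb)\<bar> * (far_kernel (y - yb) + far_kernel (y - xb))) * K"
        using far_kernel_diff_le[of "y - yb" "y - xb"] e_le[of y] by (intro mult_mono) (auto intro: order_trans[OF abs_ge_zero])
      finally show ?thesis by simp
    qed
    ultimately show "far_kernel (y - xb) * e1 y + far_kernel (y - yb) * e2 y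
      \<le> 2 * K * (far_kernel (y - xb) * indicat_real bad y)
        + K * \<bar>xb - yb\<bar> * (far_kernel (y - yb) + far_kernel (y - xb))"
      by (simp add: algebra_simps)
  qed
  also have "\<dots> = K * (2 * \<bar>xb - yb\<bar> * (LINT z|lborel. far_kernel z)
    + 2 * (LINT y|lborel. far_kernel (y - xb) * indicat_real bad y))"
  proof -
    have "integrable lborel (\<lambda>y. far_kernel (y - xb) * indicat_real bad y)"
      by (rule integrable_far_kernel_mult[where K = 1]) (auto simp: indicator_def)
    then show ?thesis
      using integrable_far_kernel_shift
      by (simp add: integral_far_kernel_shift) (simp add: algebra_simps)
  qed
  finally show ?thesis
    using lam_le_far_integral[OF assms(1)] unfolding p_def K_def
    by (meson abs_ge_zero mult_left_mono order_trans)
qed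

end

section \<open>Comparison\<close>

lemma C1_on_Q_cong:
  assumes f: "C1_on Q f" and eq: "\<And>p. p \<in> Q \<Longrightarrow> f p = g p"
  shows "C1_on Q g"
proof -
  have ev: "\<forall>\<^sub>F s in nhds t. f (s, x) = g (s, x)" if "t > 0" for t x
  proof -
    have "\<forall>\<^sub>F s in nhds t. s \<in> {0<..}" using that by (intro eventually_nhds_in_open) auto
    then show ?thesis by eventually_elim (use eq in \<open>auto simp: Q_def\<close>)
  qed
  have slice: "(\<lambda>y. f (t, y)) = (\<lambda>y. g (t, y))" if "t > 0" for t
    using eq that by (auto simp: Q_def)
  have "Dt f p = Dt g p" "Dx f p = Dx g p" if "p \<in> Q" for p
    using that deriv_cong_ev[OF ev refl] slice by (auto simp: Dt_def Dx_def Q_def)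
  moreover have "(\<lambda>s. g (s, x)) field_differentiable (at t)" if "t > 0" for t x
  proof -
    have "(\<lambda>s. f (s, x)) field_differentiable (at t)"
      using f that by (auto simp: C1_on_def Q_def)
    then obtain D where "((\<lambda>s. f (s, x)) has_field_derivative D) (at t)"
      by (auto simp: field_differentiable_def)
    then have "((\<lambda>s. g (s, x)) has_field_derivative D) (at t)"
      using DERIV_cong_ev[OF refl ev[OF that] refl] by blast
    then show ?thesis by (auto simp: field_differentiable_def)
  qed
  ultimately show ?thesis
    using f slice by (auto simp: C1_on_def Q_def cong: continuous_on_cong)
qed

lemma C1_on_Q_uminus:
  assumes "C1_on Q f"
  shows "C1_on Q (\<lambda>p. - f p)" "p \<in> Q \<Longrightarrow> Dt (\<lambda>p. - f p) p = - Dt f p"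
    "p \<in> Q \<Longrightarrow> Dx (\<lambda>p. - f p) p = - Dx f p"
proof -
  have d: "(\<lambda>s. f (s, x)) field_differentiable (at t)" "(\<lambda>y. f (t, y)) field_differentiable (at x)"
    if "t > 0" for t x
    using assms that by (auto simp: C1_on_def Q_def)
  have D: "Dt (\<lambda>p. - f p) p = - Dt f p" "Dx (\<lambda>p. - f p) p = - Dx f p" if "p \<in> Q" for p
    using that d by (auto simp: Dt_def Dx_def Q_def deriv_minus)
  then show "p \<in> Q \<Longrightarrow> Dt (\<lambda>p. - f p) p = - Dt f p" "p \<in> Q \<Longrightarrow> Dx (\<lambda>p. - f p) p = - Dx f p"
    by auto
  have "continuous_on Q (\<lambda>p. - Dt f p)" "continuous_on Q (\<lambda>p. - Dx f p)"
    using assms by (auto simp: C1_on_def intro!: continuous_intros)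
  then have "continuous_on Q (Dt (\<lambda>p. - f p))" "continuous_on Q (Dx (\<lambda>p. - f p))"
    using D by (simp_all cong: continuous_on_cong)
  then show "C1_on Q (\<lambda>p. - f p)"
    using d by (auto simp: C1_on_def Q_def intro!: field_differentiable_minus)
qed

text \<open>Outside \<open>Q\<close> nothing is known about \<open>deriv\<close>, so
  \<open>Dt\<close> of the negative is identified only on \<open>Q\<close>. As \<open>Q\<close> is
  open in time and contains whole lines in space, regularity on it depends only on values
  there.\<close>

lemma C2_on_Q_uminus:
  assumes "C2_on Q f"
  shows "C2_on Q (\<lambda>p. - f p)"
proof -
  have f: "C1_on Q f" "C1_on Q (Dt f)" "C1_on Q (Dx f)" using assms by (auto simp: C2_on_def)
  have "C1_on Q (Dt (\<lambda>p. - f p))" "C1_on Q (Dx (\<lambda>p. - f p))"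
    using C1_on_Q_cong[OF C1_on_Q_uminus(1)[OF f(2)]] C1_on_Q_cong[OF C1_on_Q_uminus(1)[OF f(3)]]
      C1_on_Q_uminus(2,3)[OF f(1)] by simp_all
  then show ?thesis using C1_on_Q_uminus(1)[OF f(1)] by (simp add: C2_on_def)
qed

text \<open>\<open>Lim\<close> commutes with negation only once the limit is known to exist. The
  nonzero slope makes the integrand odd near 0, which reduces both principal values to ordinary
  integrals.\<close>

lemma pv_integral_E_up_uminus:
  assumes \<epsilon>: "\<epsilon> > 0" and \<rho>: "\<rho> > 0" and cont: "continuous_on UNIV h"
    and D: "(h has_field_derivative D) (at 0)" "D \<noteq> 0" and "h 0 = 0"
  shows "pv_integral \<rho> (\<lambda>z. - (E_up \<epsilon> (h z) / z\<^sup>2)) = - pv_integral \<rho> (\<lambda>z. E_up \<epsilon> (h z) / z\<^sup>2)"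
proof -
  have "((\<lambda>z. h z / z) \<longlongrightarrow> D) (at 0)"
    using D(1) \<open>h 0 = 0\<close> by (simp add: DERIV_def)
  \<comment> \<open>This tolerance forces \<open>h z / z\<close> to have the sign of
    \<open>D\<close>.\<close>
  then have "\<forall>\<^sub>F z in at 0. dist (h z / z) D < \<bar>D\<bar>"
    using D(2) by (intro tendstoD) auto
  moreover have "(h \<longlongrightarrow> h 0) (at 0)" using cont by (simp add: continuous_on_def)
  then have "\<forall>\<^sub>F z in at 0. dist (h z) (h 0) < \<epsilon>" using \<epsilon> by (rule tendstoD)
  ultimately have "\<forall>\<^sub>F z in at 0. dist (h z / z) D < \<bar>D\<bar> \<and> dist (h z) (h 0) < \<epsilon>"
    by (rule eventually_conj)
  then obtain e where e: "e > 0" "\<And>z. z \<noteq> 0 \<Longrightarrow> \<bar>z\<bar> < e \<Longrightarrow> \<bar>h z / z - D\<bar> < \<bar>D\<bar> \<and> \<bar>h z\<bar> < \<epsilon>"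
    unfolding eventually_at using \<open>h 0 = 0\<close> by (auto simp: dist_real_def)
  have E: "E_up \<epsilon> (h z) = sgn (D * z) * (\<epsilon> / 2)" if "z \<noteq> 0" "\<bar>z\<bar> < e" for z
  proof -
    define y where "y = h z / z"
    have y: "\<bar>y - D\<bar> < \<bar>D\<bar>" "h z = y * z" "\<bar>h z\<bar> < \<epsilon>"
      using e(2)[OF that] that(1) by (auto simp: y_def)
    have "sgn y = sgn D" using y(1) by (auto simp: sgn_if abs_if split: if_splits)
    then have s: "sgn (h z) = sgn (D * z)" by (simp add: y(2) sgn_mult)
    have "h z \<noteq> 0" using s that(1) D(2) by (auto simp: sgn_zero_iff)
    have "E_up \<epsilon> (h z) = sgn (h z) * (\<epsilon> / 2)"
    proof (cases "h z > 0")
      case True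
      then show ?thesis using E_up_eq_half[of "h z" \<epsilon>] y(3) by simp
    next
      case False
      then show ?thesis using E_up_eq_minus_half[of \<epsilon> "h z"] y(3) \<open>h z \<noteq> 0\<close> by simp
    qed
    then show ?thesis by (simp only: s)
  qed
  define f where "f z = E_up \<epsilon> (h z) / z\<^sup>2" for z
  define r0 where "r0 = min e \<rho>"
  have r0: "0 < r0" "r0 \<le> \<rho>" using e(1) \<rho> by (auto simp: r0_def)
  have odd: "f (- z) = - f z" if "\<bar>z\<bar> < r0" for z
  proof (cases "z = 0")
    case False
    then have "E_up \<epsilon> (h (- z)) = sgn (D * - z) * (\<epsilon> / 2)" "E_up \<epsilon> (h z) = sgn (D * z) * (\<epsilon> / 2)"
      using that by (intro E; simp add: r0_def)+
    then have "E_up \<epsilon> (h (- z)) = - E_up \<epsilon> (h z)" by (simp add: sgn_mult)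
    then show ?thesis by (simp add: f_def)
  qed (simp add: f_def)
  have "compact (h ` {-\<rho>..\<rho>})"
    by (intro compact_continuous_image continuous_on_subset[OF cont]) auto
  then have "bounded (h ` {-\<rho>..\<rho>})" by (rule compact_imp_bounded)
  then obtain M where "\<forall>y\<in>h ` {-\<rho>..\<rho>}. norm y \<le> M"
    unfolding bounded_iff by blast
  then have M: "\<bar>h z\<bar> \<le> M" if "z \<in> {-\<rho>..\<rho>}" for z
    using that by simp
  have [measurable]: "h \<in> borel_measurable borel" using cont by (rule borel_measurable_continuous_onI)
  have int: "set_integrable lborel (B \<rho> - B r) f" if "r > 0" for r
    unfolding f_def
  proof (rule set_integrable_over_square[where r = r and K = "M + \<epsilon> / 2"])
    show "\<bar>E_up \<epsilon> (h z)\<bar> \<le> M + \<epsilon> / 2" if "z \<in> B \<rho> - B r" for z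
      using abs_E_up_le[OF \<epsilon>, of "h z"] M[of z] that by (auto simp: B_def)
  qed (use that in auto)
  have "pv_integral \<rho> f = (LINT z:B \<rho> - B r0|lborel. f z)"
    by (rule pv_integral_eq[OF r0 odd int])
  moreover have "pv_integral \<rho> (\<lambda>z. - f z) = (LINT z:B \<rho> - B r0|lborel. - f z)"
    by (rule pv_integral_eq[OF r0]) (use odd int in \<open>auto simp: set_integrable_def\<close>)
  ultimately have "pv_integral \<rho> (\<lambda>z. - f z) = - pv_integral \<rho> f"
    by (simp add: set_lebesgue_integral_def)
  then show ?thesis by (simp only: f_def[abs_def])
qed

text \<open>Negation preserves the admissible test functions: the quartic family allows either sign
  of \<open>c\<close>, and the envelopes are exchanged under the principal value as well as in the
  outer integral.\<close>

lemma supersolution_imp_subsolution_uminus: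
  assumes \<epsilon>: "\<epsilon> > 0" and \<rho>: "\<rho> > 0" and super: "supersolution \<rho> \<epsilon> v"
  shows "subsolution \<rho> \<epsilon> (\<lambda>p. - v p)"
  unfolding subsolution_def
proof (intro conjI allI impI)
  show "bounded ((\<lambda>p. - v p) ` Q)"
    using super by (simp add: supersolution_def bounded_iff)
  show "usc_on Q (\<lambda>p. - v p)"
    using super unfolding supersolution_def usc_on_def lsc_on_def by (simp add: minus_less_iff)
  fix \<phi> tb xb
  assume *: "C2_on Q \<phi> \<and> (tb, xb) \<in> Q \<and> (\<forall>p\<in>Q. - v p - \<phi> p \<le> - v (tb, xb) - \<phi> (tb, xb))"
  then have \<phi>: "C2_on Q (\<lambda>p. - \<phi> p)" "C1_on Q \<phi>" and Q: "(tb, xb) \<in> Q"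
    and min: "\<forall>p\<in>Q. v p - - \<phi> p \<ge> v (tb, xb) - - \<phi> (tb, xb)"
    using C2_on_Q_uminus by (auto simp: C2_on_def)
  have tb: "tb > 0" using Q by (simp add: Q_def)
  have D: "Dt (\<lambda>p. - \<phi> p) (tb, xb) = - Dt \<phi> (tb, xb)" "Dx (\<lambda>p. - \<phi> p) (tb, xb) = - Dx \<phi> (tb, xb)"
    using C1_on_Q_uminus(2,3)[OF \<phi>(2) Q] by auto
  have test: "(Dx (\<lambda>p. - \<phi> p) (tb, xb) \<noteq> 0 \<longrightarrow>
        Dt (\<lambda>p. - \<phi> p) (tb, xb) \<ge> H_lo \<rho> \<epsilon> (\<lambda>p. - \<phi> p) v (tb, xb)) \<and>
      ((\<exists>c g. \<forall>(t, x)\<in>Q. - \<phi> (t, x) = c * \<bar>x - xb\<bar> ^ 4 + g t) \<longrightarrow> Dt (\<lambda>p. - \<phi> p) (tb, xb) \<ge> 0)"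
    using super \<phi>(1) Q min unfolding supersolution_def by blast
  {
    assume "\<exists>c g. \<forall>(t, x)\<in>Q. \<phi> (t, x) = c * \<bar>x - xb\<bar> ^ 4 + g t"
    then obtain c g where "\<forall>(t, x)\<in>Q. \<phi> (t, x) = c * \<bar>x - xb\<bar> ^ 4 + g t" by blast
    then have "\<forall>(t, x)\<in>Q. - \<phi> (t, x) = (- c) * \<bar>x - xb\<bar> ^ 4 + (- g t)" by auto
    then have "\<exists>c g. \<forall>(t, x)\<in>Q. - \<phi> (t, x) = c * \<bar>x - xb\<bar> ^ 4 + g t"
      by (intro exI[of _ "- c"] exI[of _ "\<lambda>t. - g t"])
    then show "Dt \<phi> (tb, xb) \<le> 0" using test D by auto
  }
  assume nz: "Dx \<phi> (tb, xb) \<noteq> 0"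
  define h where "h z = \<phi> (tb, xb + z) - \<phi> (tb, xb)" for z
  have diff: "((\<lambda>y. \<phi> (tb, y)) has_field_derivative Dx \<phi> (tb, x)) (at x)" for x
    using \<phi>(2) tb by (auto simp: C1_on_def Q_def Dx_def field_differentiable_derivI)
  have h: "(h has_field_derivative Dx \<phi> (tb, xb + z)) (at z)" for z
    unfolding h_def[abs_def] using DERIV_shift[of "\<lambda>y. \<phi> (tb, y)" "Dx \<phi> (tb, xb + z)" z xb] diff[of "xb + z"]
    by (auto simp: add.commute intro!: derivative_eq_intros)
  have "pv_integral \<rho> (\<lambda>z. - (E_up \<epsilon> (h z) / z\<^sup>2)) = - pv_integral \<rho> (\<lambda>z. E_up \<epsilon> (h z) / z\<^sup>2)"
    using h[of 0] nz has_field_derivative_continuous_UNIV[OF h]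
    by (intro pv_integral_E_up_uminus[OF \<epsilon> \<rho>]) (simp_all, simp add: h_def)
  moreover have "(LINT z:- B \<rho>|lborel. E_lo \<epsilon> (v (tb, xb + z) - v (tb, xb)) / z\<^sup>2)
      = - (LINT z:- B \<rho>|lborel. E_up \<epsilon> (- v (tb, xb + z) - - v (tb, xb)) / z\<^sup>2)"
    by (simp add: E_lo_conv_E_up set_lebesgue_integral_def)
  moreover have "E_lo \<epsilon> (- \<phi> (tb, xb + z) - - \<phi> (tb, xb)) / z\<^sup>2 = - (E_up \<epsilon> (h z) / z\<^sup>2)" for z
    by (simp add: E_lo_conv_E_up h_def)
  ultimately have "H_lo \<rho> \<epsilon> (\<lambda>p. - \<phi> p) v (tb, xb) = - H_up \<rho> \<epsilon> \<phi> (\<lambda>p. - v p) (tb, xb)"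
    unfolding hamiltonian_def prod.case D by (simp only: abs_minus_cancel h_def) (simp add: algebra_simps)
  then show "Dt \<phi> (tb, xb) \<le> H_up \<rho> \<epsilon> \<phi> (\<lambda>p. - v p) (tb, xb)"
    using test nz D by simp
qed

text \<open>A positive value of \<open>u + w\<close> survives the subtraction of
  \<open>lam * t\<close>. The doubled maximum then bounds \<open>lam\<close> by
  \<open>lam / 4\<close> plus a contribution from outside the box, which vanishes when the two times
  merge.\<close>

lemma sum_of_subsolutions_nonpos:
  fixes u w :: "real \<times> real \<Rightarrow> real"
  assumes \<epsilon>: "\<epsilon> > 0" and \<rho>: "\<rho> > 0" and sub_u: "subsolution \<rho> \<epsilon> u" and sub_w: "subsolution \<rho> \<epsilon> w"
    and initial: "\<And>x. initial_ext u (0, x) + initial_ext w (0, x) \<le> 0"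
    and decay: "\<And>T \<theta>. T > 0 \<Longrightarrow> \<theta> > 0 \<Longrightarrow>
      \<exists>R. \<forall>t x. 0 < t \<longrightarrow> t \<le> T \<longrightarrow> R \<le> \<bar>x\<bar> \<longrightarrow> u (t, x) + w (t, x) \<le> \<theta>"
  shows "\<forall>p\<in>Q. u p + w p \<le> 0"
proof (rule ccontr)
  assume "\<not> ?thesis"
  then obtain t0 x0 where t0: "t0 > 0" and pos: "u (t0, x0) + w (t0, x0) > 0"
    by (auto simp: Q_def not_le)
  obtain C1 C2 where "\<forall>p\<in>Q. \<bar>u p\<bar> \<le> C1" "\<forall>p\<in>Q. \<bar>w p\<bar> \<le> C2"
    using sub_u sub_w by (auto simp: subsolution_def bounded_iff)
  then obtain C where C: "\<forall>p\<in>Q. \<bar>u p\<bar> \<le> C" "\<forall>p\<in>Q. \<bar>w p\<bar> \<le> C"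
    by (metis linorder_linear order_trans)
  have C0: "C \<ge> 0" using C(1) t0 abs_ge_zero[of "u (t0, x0)"] by (force simp: Q_def)
  have usc_u: "usc_on ({0..} \<times> UNIV) (initial_ext u)" and usc_w: "usc_on ({0..} \<times> UNIV) (initial_ext w)"
    using usc_on_initial_ext C sub_u sub_w by (auto simp: subsolution_def)
  have ext_le: "\<bar>initial_ext u p\<bar> \<le> C" "\<bar>initial_ext w p\<bar> \<le> C" if "fst p \<ge> 0" for p
    using abs_initial_ext_le[OF C(1) that] abs_initial_ext_le[OF C(2) that] by auto

  \<comment> \<open>Chosen so that exactly half of the positive value at \<open>(t0, x0)\<close>
    remains; \<open>m\<close> is that half.\<close>
  define lam where "lam = (u (t0, x0) + w (t0, x0)) / (2 * t0)"
  define m where "m = (u (t0, x0) + w (t0, x0)) / 2"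
  have lam: "lam > 0" "lam * t0 = m" and m: "m > 0"
    using pos t0 by (simp_all add: lam_def m_def)
  \<comment> \<open>So long that \<open>lam * T\<close> exceeds every value of \<open>u + w\<close>;
    the final time then needs no penalty of its own.\<close>
  define T where "T = 2 * C / lam + 1 + t0"
  have T: "T > t0" "T > 0" "lam * T > 2 * C"
  proof -
    have "2 * C / lam \<ge> 0" using C0 lam by simp
    then show "T > t0" "T > 0" using t0 by (simp_all add: T_def)
    have "lam * T = 2 * C + lam + m" using lam by (simp add: T_def distrib_left)
    then show "lam * T > 2 * C" using lam m by simp
  qed
  obtain R' where R': "\<And>t x. 0 < t \<Longrightarrow> t \<le> T \<Longrightarrow> R' \<le> \<bar>x\<bar> \<Longrightarrow> u (t, x) + w (t, x) \<le> m / 2"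
    using decay[OF T(2), of "m / 2"] m by auto
  define R0 where "R0 = max 1 (max R' \<bar>x0\<bar>)"
  \<comment> \<open>Maximum points will satisfy \<open>\<bar>xb\<bar> < R0 + 1\<close>. This leaves
    the margin 1 in the box, and \<open>\<bar>y - xb\<bar> \<ge> \<bar>y\<bar> / 2\<close> for
    \<open>\<bar>y\<bar> > R\<close>.\<close>
  define R where "R = 2 * R0 + 4"
  have R0: "R0 \<ge> 1" "R0 \<ge> R'" "\<bar>x0\<bar> \<le> R0" by (auto simp: R0_def)
  have far: "initial_ext u (t, x) + initial_ext w (t, x) < m" if "0 \<le> t" "t \<le> T" "R0 \<le> \<bar>x\<bar>" for t x
  proof (cases "t > 0")
    case True
    then show ?thesis using R'[of t x] that R0 m by (auto simp: initial_ext_def)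
  next
    case False
    then show ?thesis using initial[of x] that m by simp
  qed

  define Kp where "Kp = {0..T} \<times> {-R..R}"
  have Kp: "compact Kp" "Kp \<noteq> {}" "Kp \<subseteq> {0..} \<times> UNIV"
    using T(2) R0 by (auto simp: Kp_def R_def intro!: compact_Times)
  define F where "F z = initial_ext u (fst z) + initial_ext w (snd z) + (- lam * fst (fst z))" for z :: "(real \<times> real) \<times> (real \<times> real)"
  have F_le: "F (p, q) \<le> 2 * C - lam * fst p" if "p \<in> Kp" "q \<in> Kp" for p q
    using that ext_le(1)[of p] ext_le(2)[of q] by (auto simp: F_def Kp_def abs_le_iff)
  have F_le': "F (p, q) \<le> 2 * C" if "p \<in> Kp" "q \<in> Kp" for p q
    using F_le[OF that] that lam(1) by (auto simp: Kp_def intro: order_trans)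
  have usc_F: "usc_on (Kp \<times> Kp) F"
    unfolding F_def
    by (intro usc_on_add usc_on_compose[OF usc_u] usc_on_compose[OF usc_w] continuous_on_imp_usc_on continuous_intros)
      (use Kp(3) in auto)
  have "usc_on Kp (\<lambda>p. F (p, p))"
    by (rule usc_on_compose[OF usc_F]) (auto intro!: continuous_intros)
  moreover have "bdd_above ((\<lambda>p. F (p, p)) ` Kp)"
    using F_le' by (intro bdd_aboveI2)
  ultimately obtain ps where ps: "ps \<in> Kp" "\<And>q. q \<in> Kp \<Longrightarrow> F (q, q) \<le> F (ps, ps)"
    using usc_on_attains_sup[OF Kp(1,2)] by blast
  define M where "M = F (ps, ps)"
  have "(t0, x0) \<in> Kp" using t0 T R0 by (auto simp: Kp_def R_def abs_le_iff)
  moreover have "F ((t0, x0), (t0, x0)) = m"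
    using t0 lam(2) by (simp add: F_def initial_ext_def m_def)
  ultimately have mM: "m \<le> M"
    using ps(2) unfolding M_def by metis

  define K where "K = 2 * C + \<epsilon>"
  define I where "I = (LINT z|lborel. far_kernel z)"
  have K: "K > 0" using C0 \<epsilon> by (simp add: K_def)
  have I: "I \<ge> 0" unfolding I_def
    by (intro Bochner_Integration.integral_nonneg) (simp add: less_imp_le far_kernel_bounds)
  \<comment> \<open>The admissible size of the spatial penalty. Moving the kernel will cost
    \<open>8 * \<kappa> * K * I\<close>: a factor 4 from differentiating the quartic and 2 from the
    two kernels. The result is at most \<open>lam / 4\<close>; \<open>I + 1\<close> keeps the
    denominator positive.\<close>
  define \<kappa> where "\<kappa> = lam / (32 * (K * (I + 1)))"
  have \<kappa>: "\<kappa> > 0" using lam K I by (simp add: \<kappa>_def)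
  have "K * (I + 1) \<noteq> 0" using K I by auto
  moreover have "lam / (32 * X) * X = lam / 32" if "X \<noteq> 0" for X using that by simp
  ultimately have "\<kappa> * (K * (I + 1)) = lam / 32"
    unfolding \<kappa>_def by blast
  then have "8 * \<kappa> * K * (I + 1) = lam / 4" by (simp only: mult.assoc)
  moreover have "8 * \<kappa> * K * I \<le> 8 * \<kappa> * K * (I + 1)" using \<kappa> K by (intro mult_left_mono) auto
  ultimately have \<kappa>_le: "8 * \<kappa> * K * I \<le> lam / 4" by simp

  \<comment> \<open>On the diagonal \<open>F\<close> is below \<open>m\<close> on this set: at the
    initial time by the initial comparison, at time \<open>T\<close> by the choice of
    \<open>T\<close>, and for large \<open>x\<close> by decay.\<close>
  define bd where "bd = {p :: real \<times> real. fst p = 0 \<or> fst p = T \<or> R0 + 1 \<le> \<bar>snd p\<bar>}"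
  have bd: "closed bd"
    unfolding bd_def by (intro closed_Collect_disj closed_Collect_eq closed_Collect_le continuous_intros)
  have cpt1: "compact ((Kp \<times> Kp) \<inter> (bd \<times> UNIV \<union> UNIV \<times> bd))"
    using Kp(1) bd by (intro compact_Int_closed compact_Times closed_Un closed_Times) auto
  have diag1: "F (p, p) < m" if pp: "(p, p) \<in> (Kp \<times> Kp) \<inter> (bd \<times> UNIV \<union> UNIV \<times> bd)" for p
  proof -
    obtain t x where p: "p = (t, x)" by (cases p)
    have t: "0 \<le> t" "t \<le> T" "p \<in> Kp" using pp p by (auto simp: Kp_def)
    consider "t = 0" | "t = T" | "R0 + 1 \<le> \<bar>x\<bar>" using pp p by (auto simp: bd_def)
    then show ?thesis
    proof cases
      case 1
      then show ?thesis using initial[of x] m p by (simp add: F_def)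
    next
      case 2
      then show ?thesis using F_le[OF t(3,3)] T(3) m p by simp
    next
      case 3
      moreover have "lam * t \<ge> 0" using lam t by simp
      ultimately show ?thesis using far[of t x] t p by (simp add: F_def)
    qed
  qed
  obtain \<eta>1 where \<eta>1: "\<eta>1 > 0" "\<And>p q. (p, q) \<in> (Kp \<times> Kp) \<inter> (bd \<times> UNIV \<union> UNIV \<times> bd) \<Longrightarrow>
      dist p q \<le> \<eta>1 \<Longrightarrow> F (p, q) < m"
    by (rule usc_on_less_near_diagonal[OF cpt1 usc_on_subset[OF usc_F Int_lower1] diag1]) (assumption, rule that)
  have diag2: "F (p, p) < M + \<kappa>" if "(p, p) \<in> Kp \<times> Kp" for p
    using ps(2)[of p] that \<kappa> by (simp add: M_def)
  obtain \<eta>2 where \<eta>2: "\<eta>2 > 0" "\<And>p q. (p, q) \<in> Kp \<times> Kp \<Longrightarrow> dist p q \<le> \<eta>2 \<Longrightarrow> F (p, q) < M + \<kappa>"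
    by (rule usc_on_less_near_diagonal[OF compact_Times[OF Kp(1) Kp(1)] usc_F diag2]) (assumption, rule that)
  \<comment> \<open>Halved because the differences in time and in space are both bounded by
    it.\<close>
  define e0 where "e0 = min \<eta>1 \<eta>2 / 2"
  have e0: "e0 > 0" using \<eta>1(1) \<eta>2(1) by (simp add: e0_def)
  \<comment> \<open>At a maximum the penalty is at most \<open>2 * C\<close>; the extra 1 turns this
    into \<open>\<bar>xb - yb\<bar> < e0\<close> strictly. From here on \<open>c\<close> is
    fixed.\<close>
  define c where "c = (2 * C + 1) / e0 ^ 4"
  have c: "c > 0" using C0 e0 by (simp add: c_def)
  have close: "\<bar>d\<bar> < e" if "(2 * C + 1) / e ^ n * \<bar>d\<bar> ^ n \<le> 2 * C" "e > 0" for d e and n :: nat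
  proof (rule ccontr)
    assume "\<not> ?thesis"
    then have "e ^ n \<le> \<bar>d\<bar> ^ n" using that by (intro power_mono) auto
    then have "(2 * C + 1) / e ^ n * e ^ n \<le> (2 * C + 1) / e ^ n * \<bar>d\<bar> ^ n"
      using C0 that(2) by (intro mult_left_mono) auto
    then show False using that by simp
  qed
  \<comment> \<open>At each doubled maximum \<open>u + w\<close> is at least \<open>m\<close>, so
    this contains its exceptional set; it depends on the maximum only through the two times.\<close>
  define bad where "bad t s = {y. \<bar>y\<bar> > R \<and> m \<le> u (t, y) + w (s, y)}" for t s
  define \<gamma> where "\<gamma> t s = (LINT y|lborel. far_kernel y * indicat_real (bad t s) y)" for t s
  have bad_sets: "bad t s \<in> sets borel" if "t > 0" "s > 0" for t s
  proof -
    have [measurable]: "(\<lambda>x. u (t, x)) \<in> borel_measurable borel" "(\<lambda>x. w (s, x)) \<in> borel_measurable borel"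
      using sub_u sub_w that by (auto simp: subsolution_def intro!: borel_measurable_usc_slice)
    show ?thesis unfolding bad_def by measurable
  qed
  \<comment> \<open>A crude bound for the gradient in the box. It depends on \<open>c\<close> but
    not on \<open>k\<close>.\<close>
  define P where "P = 4 * c * (2 * R) ^ 3"
  have doubling: "\<exists>t s. 0 < t \<and> t \<le> T \<and> 0 < s \<and> s \<le> T \<and> \<bar>t - s\<bar> < e \<and> lam \<le> lam / 4 + 8 * P * K * \<gamma> t s"
    if e: "0 < e" "e \<le> e0" for e
  proof -
    define k where "k = (2 * C + 1) / e ^ 2"
    define \<Phi> where "\<Phi> z = F z + (- c * (snd (fst z) - snd (snd z)) ^ 4 - k * (fst (fst z) - fst (snd z))\<^sup>2)" for z
    have k: "k \<ge> 0" using C0 by (simp add: k_def)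
    have usc: "usc_on (Kp \<times> Kp) \<Phi>"
      unfolding \<Phi>_def by (intro usc_on_add usc_F continuous_on_imp_usc_on continuous_intros)
    have bdd: "bdd_above (\<Phi> ` (Kp \<times> Kp))"
    proof (rule bdd_aboveI2)
      fix z assume z: "z \<in> Kp \<times> Kp"
      have "F z \<le> 2 * C" using F_le' z by (cases z) auto
      moreover have "0 \<le> c * (snd (fst z) - snd (snd z)) ^ 4" "0 \<le> k * (fst (fst z) - fst (snd z))\<^sup>2"
        using c k by simp_all
      ultimately show "\<Phi> z \<le> 2 * C" by (simp add: \<Phi>_def)
    qed
    have "Kp \<times> Kp \<noteq> {}" using Kp(2) by simp
    then obtain z where z: "z \<in> Kp \<times> Kp" "\<And>z'. z' \<in> Kp \<times> Kp \<Longrightarrow> \<Phi> z' \<le> \<Phi> z"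
      using usc_on_attains_sup[OF compact_Times[OF Kp(1) Kp(1)] _ usc bdd] by blast
    obtain tb xb sb yb where z_eq: "z = ((tb, xb), (sb, yb))" by (metis surj_pair)
    have box: "(tb, xb) \<in> Kp" "(sb, yb) \<in> Kp" using z(1) z_eq by auto
    have "M \<le> \<Phi> z" using z(2)[of "(ps, ps)"] ps(1) by (simp add: \<Phi>_def M_def)
    then have M_le: "M + c * (xb - yb) ^ 4 + k * (tb - sb)\<^sup>2 \<le> F z" by (simp add: \<Phi>_def z_eq)
    have F2C: "F z \<le> 2 * C" using F_le'[OF box] by (simp add: z_eq)
    have nn: "c * (xb - yb) ^ 4 \<ge> 0" "k * (tb - sb)\<^sup>2 \<ge> 0" using c k by simp_all
    have dx: "\<bar>xb - yb\<bar> < e0"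
      by (rule close[where n = 4]) (use M_le F2C nn mM m e0 in \<open>auto simp: c_def\<close>)
    have dt: "\<bar>tb - sb\<bar> < e"
      by (rule close[where n = 2]) (use M_le F2C nn mM m e in \<open>auto simp: k_def\<close>)
    have "dist (tb, xb) (sb, yb) \<le> \<bar>tb - sb\<bar> + \<bar>xb - yb\<bar>"
      using sqrt_sum_squares_le_sum_abs[of "tb - sb" "xb - yb"] by (simp add: dist_Pair_Pair dist_real_def)
    then have dist: "dist (tb, xb) (sb, yb) \<le> \<eta>1" "dist (tb, xb) (sb, yb) \<le> \<eta>2"
      using dx dt e by (auto simp: e0_def)
    have "F z < M + \<kappa>" using \<eta>2(2)[OF _ dist(2)] box by (simp add: z_eq)
    \<comment> \<open>The diagonal already attains \<open>M\<close> without penalty, and close to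
      the diagonal \<open>F\<close> exceeds \<open>M\<close> by less than
      \<open>\<kappa>\<close>.\<close>
    then have d4: "c * (xb - yb) ^ 4 \<le> \<kappa>" using M_le nn by linarith
    have "(tb, xb) \<notin> bd \<and> (sb, yb) \<notin> bd"
      using \<eta>1(2)[OF _ dist(1)] box M_le nn mM by (auto simp: z_eq)
    then have inner: "0 < tb" "tb < T" "\<bar>xb\<bar> < R0 + 1" "0 < sb" "sb < T" "\<bar>yb\<bar> < R0 + 1"
      using box by (auto simp: bd_def Kp_def)
    define r where "r = min 1 (min (T - tb) (T - sb))"
    have r: "0 < r" "r \<le> 1" "r \<le> T - tb" "r \<le> T - sb" using inner by (auto simp: r_def)
    interpret doubling_maximum \<epsilon> \<rho> C c k lam r R tb xb sb yb u w
    proof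
      show "\<bar>xb\<bar> \<le> R - 1" "\<bar>yb\<bar> \<le> R - 1" using inner R0 by (auto simp: R_def)
      fix t x s y :: real
      assume "t > 0" "s > 0" "\<bar>t - tb\<bar> \<le> r" "\<bar>s - sb\<bar> \<le> r" "\<bar>x\<bar> \<le> R" "\<bar>y\<bar> \<le> R"
      then have "((t, x), (s, y)) \<in> Kp \<times> Kp" using r by (auto simp: Kp_def)
      from z(2)[OF this] show "u (t, x) + w (s, y) - c * (x - y) ^ 4 - k * (t - s)\<^sup>2 - lam * t
          \<le> u (tb, xb) + w (sb, yb) - c * (xb - yb) ^ 4 - k * (tb - sb)\<^sup>2 - lam * tb"
        using \<open>t > 0\<close> \<open>s > 0\<close> inner by (simp add: \<Phi>_def F_def initial_ext_def z_eq)
    qed (use \<epsilon> \<rho> sub_u sub_w C c r inner in auto)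
    have ne: "xb \<noteq> yb" using lam_le_on_diagonal lam(1) by auto
    define p where "p = 4 * c * (xb - yb) ^ 3"
    define bad' where "bad' = {y. \<bar>y\<bar> > R \<and> u (tb, xb) + w (sb, yb) \<le> u (tb, y) + w (sb, y)}"
    define \<beta> where "\<beta> = (LINT y|lborel. far_kernel (y - xb) * indicat_real bad' y)"
    have main: "lam \<le> \<bar>p\<bar> * (K * (2 * \<bar>xb - yb\<bar> * I + 2 * \<beta>))"
      using lam_le_bad_set[OF ne] unfolding p_def K_def I_def \<beta>_def bad'_def .
    have "\<bar>p\<bar> * \<bar>xb - yb\<bar> = 4 * (c * (xb - yb) ^ 4)"
    proof -
      have "\<bar>p\<bar> * \<bar>xb - yb\<bar> = 4 * c * (\<bar>xb - yb\<bar> ^ 3 * \<bar>xb - yb\<bar>)"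
        using c by (simp add: p_def abs_mult power_abs)
      also have "\<bar>xb - yb\<bar> ^ 3 * \<bar>xb - yb\<bar> = \<bar>xb - yb\<bar> ^ 4" by (simp add: eval_nat_numeral)
      finally show ?thesis by simp
    qed
    then have pd: "\<bar>p\<bar> * \<bar>xb - yb\<bar> \<le> 4 * \<kappa>" using d4 by simp
    have pP: "\<bar>p\<bar> \<le> P"
    proof -
      have "\<bar>xb - yb\<bar> ^ 3 \<le> (2 * R) ^ 3" using inner R0 by (intro power_mono) (auto simp: R_def)
      then show ?thesis using c by (simp add: p_def P_def abs_mult power_abs)
    qed
    \<comment> \<open>Centring the kernel at 0 instead of \<open>xb\<close> makes the right side
      independent of \<open>xb\<close>; the factor 4 is the square of the ratio
      \<open>\<bar>y\<bar> / \<bar>y - xb\<bar> \<le> 2\<close>.\<close>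
    have \<beta>_le: "\<beta> \<le> 4 * \<gamma> tb sb"
    proof -
      have m_le: "m \<le> u (tb, xb) + w (sb, yb)"
      proof -
        have "F z = u (tb, xb) + w (sb, yb) - lam * tb" using inner by (simp add: F_def initial_ext_def z_eq)
        moreover have "lam * tb \<ge> 0" using lam inner by simp
        ultimately show ?thesis using M_le nn mM by linarith
      qed
      have "\<beta> \<le> (LINT y|lborel. 4 * (far_kernel y * indicat_real (bad tb sb) y))"
        unfolding \<beta>_def
      proof (rule integral_mono')
        have "integrable lborel (\<lambda>y. far_kernel (y - 0) * indicat_real (bad tb sb) y)"
          using bad_sets[OF inner(1,4)]
          by (intro integrable_far_kernel_mult[where K = 1]) (auto simp: indicator_def)
        then show "integrable lborel (\<lambda>y. 4 * (far_kernel y * indicat_real (bad tb sb) y))" by simp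
        fix y
        show "0 \<le> 4 * (far_kernel y * indicat_real (bad tb sb) y)"
          using far_kernel_bounds(1)[of y] by (simp add: less_imp_le)
        show "far_kernel (y - xb) * indicat_real bad' y \<le> 4 * (far_kernel y * indicat_real (bad tb sb) y)"
        proof (cases "y \<in> bad'")
          case True
          then have y: "\<bar>y\<bar> > R" "y \<in> bad tb sb" using m_le by (auto simp: bad'_def bad_def)
          have big: "\<bar>y - xb\<bar> \<ge> \<bar>y / 2\<bar>" "\<bar>y\<bar> \<ge> 2" "\<bar>y / 2\<bar> \<ge> 1"
            using y(1) inner R0 abs_triangle_ineq2[of y xb] unfolding R_def abs_divide abs_numeral by linarith+
          then have "far_kernel (y - xb) = 1 / (y - xb)\<^sup>2" "far_kernel y = 1 / y\<^sup>2"
            by (auto intro!: far_kernel_eq)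
          moreover have "(y / 2)\<^sup>2 \<le> (y - xb)\<^sup>2" using big(1) by (rule abs_le_square_iff[THEN iffD1])
          then have "1 / (y - xb)\<^sup>2 \<le> 1 / (y / 2)\<^sup>2"
            using big(2) by (intro divide_left_mono) (auto simp: zero_less_mult_iff)
          ultimately show ?thesis using True y(2) by (simp add: power_divide)
        next
          case False
          then show ?thesis using far_kernel_bounds(1)[of y] by (simp add: less_imp_le)
        qed
      qed
      then show ?thesis by (simp add: \<gamma>_def)
    qed
    have \<gamma>0: "\<gamma> tb sb \<ge> 0"
      unfolding \<gamma>_def
      by (intro Bochner_Integration.integral_nonneg) (simp add: less_imp_le far_kernel_bounds)
    have "lam \<le> 2 * (\<bar>p\<bar> * \<bar>xb - yb\<bar>) * (K * I) + \<bar>p\<bar> * (2 * K * \<beta>)"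
      using main by (simp add: algebra_simps)
    also have "\<dots> \<le> 2 * (4 * \<kappa>) * (K * I) + P * (8 * K * \<gamma> tb sb)"
    proof (rule add_mono)
      show "2 * (\<bar>p\<bar> * \<bar>xb - yb\<bar>) * (K * I) \<le> 2 * (4 * \<kappa>) * (K * I)"
        using pd K I by (intro mult_right_mono) auto
      have "\<bar>p\<bar> * (2 * K * \<beta>) \<le> \<bar>p\<bar> * (2 * K * (4 * \<gamma> tb sb))"
        using \<beta>_le K by (intro mult_left_mono) auto
      also have "\<dots> \<le> P * (2 * K * (4 * \<gamma> tb sb))"
        using pP \<gamma>0 K by (intro mult_right_mono) auto
      finally show "\<bar>p\<bar> * (2 * K * \<beta>) \<le> P * (8 * K * \<gamma> tb sb)" by simp
    qed
    also have "2 * (4 * \<kappa>) * (K * I) = 8 * \<kappa> * K * I" by simp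
    finally have "lam \<le> lam / 4 + 8 * P * K * \<gamma> tb sb" using \<kappa>_le by (simp add: mult_ac)
    then show ?thesis using inner dt less_imp_le by blast
  qed

  have "\<exists>t s. 0 < t \<and> t \<le> T \<and> 0 < s \<and> s \<le> T \<and> \<bar>t - s\<bar> < min e0 (inverse (real (Suc n)))
      \<and> lam \<le> lam / 4 + 8 * P * K * \<gamma> t s" for n
    by (rule doubling) (use e0 in auto)
  then obtain t s where ts: "\<And>n. 0 < t n" "\<And>n. t n \<le> T" "\<And>n. 0 < s n" "\<And>n. s n \<le> T"
      "\<And>n. \<bar>t n - s n\<bar> < inverse (real (Suc n))" "\<And>n. lam \<le> lam / 4 + 8 * P * K * \<gamma> (t n) (s n)"
    by (metis min_less_iff_conj)
  have "\<And>n. t n \<in> {0..T}" using ts by (auto simp: less_imp_le)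
  \<comment> \<open>The common limit of the times may be 0, which is why \<open>far\<close> and the
    semicontinuous extensions include the initial time.\<close>
  then obtain th \<phi> where th: "th \<in> {0..T}" "strict_mono \<phi>" "(t \<circ> \<phi>) \<longlonglongrightarrow> th"
    using compact_Icc[of 0 T] unfolding compact_def by meson
  have "(\<lambda>n. t n - s n) \<longlonglongrightarrow> 0"
    by (rule Lim_null_comparison[OF _ LIMSEQ_inverse_real_of_nat]) (use ts(5) in \<open>auto intro!: always_eventually less_imp_le\<close>)
  then have "(\<lambda>n. t (\<phi> n) - s (\<phi> n)) \<longlonglongrightarrow> 0"
    using LIMSEQ_subseq_LIMSEQ[OF _ th(2)] by (fastforce simp: o_def)
  then have "(\<lambda>n. t (\<phi> n) - (t (\<phi> n) - s (\<phi> n))) \<longlonglongrightarrow> th - 0"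
    using th(3) by (intro tendsto_diff) (auto simp: o_def)
  then have s_lim: "(\<lambda>n. s (\<phi> n)) \<longlonglongrightarrow> th" by simp
  have t_lim: "(\<lambda>n. t (\<phi> n)) \<longlonglongrightarrow> th" using th(3) by (simp add: o_def)
  \<comment> \<open>For fixed \<open>y\<close> outside the box, \<open>u + w\<close> at
    \<open>(th, y)\<close> is below \<open>m\<close>, both functions now being at the same point.
    Upper semicontinuity excludes \<open>y\<close> from all late bad sets, and
    \<open>far_kernel\<close> dominates.\<close>
  have "(\<lambda>n. \<gamma> (t (\<phi> n)) (s (\<phi> n))) \<longlonglongrightarrow> integral\<^sup>L lborel (\<lambda>y::real. 0::real)"
    unfolding \<gamma>_def
  proof (rule integral_dominated_convergence[where w = far_kernel])
    show "AE y in lborel. (\<lambda>n. far_kernel y * indicat_real (bad (t (\<phi> n)) (s (\<phi> n))) y) \<longlonglongrightarrow> 0"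
    proof (intro AE_I2)
      fix y
      have "\<forall>\<^sub>F n in sequentially. y \<notin> bad (t (\<phi> n)) (s (\<phi> n))"
      proof (cases "\<bar>y\<bar> > R")
        case True
        then have "initial_ext u (th, y) + initial_ext w (th, y) < m"
          using far[of th y] th(1) R0 by (auto simp: R_def)
        moreover have "usc_on ({0..} \<times> {0..}) (\<lambda>q. initial_ext u (fst q, y) + initial_ext w (snd q, y))"
          by (intro usc_on_add usc_on_compose[OF usc_u] usc_on_compose[OF usc_w] continuous_intros) auto
        ultimately have "\<forall>\<^sub>F n in sequentially. initial_ext u (fst (t (\<phi> n), s (\<phi> n)), y) + initial_ext w (snd (t (\<phi> n), s (\<phi> n)), y) < m"
          using ts th(1) by (intro usc_on_sequentially[where l = "(th, th)" and X = "\<lambda>n. (t (\<phi> n), s (\<phi> n))"] tendsto_Pair t_lim s_lim)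
            (auto simp: less_imp_le)
        then show ?thesis
          by eventually_elim (use ts in \<open>auto simp: bad_def initial_ext_def not_le\<close>)
      qed (simp add: bad_def)
      then show "(\<lambda>n. far_kernel y * indicat_real (bad (t (\<phi> n)) (s (\<phi> n))) y) \<longlonglongrightarrow> 0"
        by (intro tendsto_eventually) (elim eventually_mono, simp)
    qed
    show "AE y in lborel. norm (far_kernel y * indicat_real (bad (t (\<phi> n)) (s (\<phi> n))) y) \<le> far_kernel y" for n
      using far_kernel_bounds(1) by (auto simp: indicator_def less_imp_le)
    show "integrable lborel far_kernel" using integrable_far_kernel_shift[of 0] by simp
    show "(\<lambda>y. far_kernel y * indicat_real (bad (t (\<phi> n)) (s (\<phi> n))) y) \<in> borel_measurable lborel" for n
      using bad_sets[OF ts(1,3)] by measurable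
  qed simp
  then have "(\<lambda>n. lam / 4 + 8 * P * K * \<gamma> (t (\<phi> n)) (s (\<phi> n))) \<longlonglongrightarrow> lam / 4 + 8 * P * K * 0"
    by (intro tendsto_intros) simp
  then have "lam \<le> lam / 4 + 8 * P * K * 0"
    by (rule LIMSEQ_le_const) (use ts(6) in auto)
  then show False using lam(1) by simp
qed

theorem theorem3p6:
  fixes \<epsilon> \<rho> :: real and u v :: "real \<times> real \<Rightarrow> real"
  assumes "\<epsilon> > 0" and "\<rho> > 0"
    and "subsolution \<rho> \<epsilon> u" and "supersolution \<rho> \<epsilon> v"
    and "\<And>T. T > 0 \<Longrightarrow> \<exists>L\<le>0.
           ((\<lambda>R. Sup {u (t, x) - v (t, x) | t x. \<bar>x\<bar> \<ge> R \<and> t \<in> {0<..T}}) \<longlongrightarrow> L) at_top"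
    and "\<And>x. upper_initial u x \<le> lower_initial v x"
  shows "\<forall>p\<in>Q. u p \<le> v p"
proof -
  obtain C1 C2 where C1: "\<forall>p\<in>Q. \<bar>u p\<bar> \<le> C1" and C2: "\<forall>p\<in>Q. \<bar>v p\<bar> \<le> C2"
    using assms(3,4) by (auto simp: subsolution_def supersolution_def bounded_iff)
  have C2': "\<forall>p\<in>Q. \<bar>- v p\<bar> \<le> C2" using C2 by simp
  have "\<forall>p\<in>Q. u p + - v p \<le> 0"
  proof (rule sum_of_subsolutions_nonpos[OF assms(1-3) supersolution_imp_subsolution_uminus[OF assms(1,2,4)]])
    fix x
    have "upper_initial (\<lambda>p. - v p) x = - lower_initial v x"
      unfolding upper_initial_def lower_initial_def by (simp flip: ereal_Limsup_uminus)
    then have "ereal (initial_ext u (0, x)) \<le> - ereal (initial_ext (\<lambda>p. - v p) (0, x))"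
      using assms(6)[of x] by (simp add: initial_ext_eq[OF C1] initial_ext_eq[OF C2'])
    then show "initial_ext u (0, x) + initial_ext (\<lambda>p. - v p) (0, x) \<le> 0" by simp
  next
    fix T \<theta> :: real assume T: "T > 0" and \<theta>: "\<theta> > 0"
    define A where "A R = {u (t, x) - v (t, x) | t x. \<bar>x\<bar> \<ge> R \<and> t \<in> {0<..T}}" for R
    obtain L where "L \<le> 0" "((\<lambda>R. Sup (A R)) \<longlongrightarrow> L) at_top"
      using assms(5)[OF T] unfolding A_def by blast
    then have "\<forall>\<^sub>F R in at_top. Sup (A R) < \<theta>" using \<theta> by (intro order_tendstoD(2)[of _ L]) auto
    then obtain R where R: "Sup (A R) < \<theta>" by (auto simp: eventually_at_top_linorder)
    \<comment> \<open>The real \<open>Sup\<close> bounds the members of the set only when the set is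
      bounded above.\<close>
    have "bdd_above (A R)"
    proof (rule bdd_aboveI)
      fix a assume "a \<in> A R"
      then obtain p where "p \<in> Q" "a = u p - v p" by (auto simp: A_def Q_def)
      then show "a \<le> C1 + C2" using C1 C2 by (smt (verit) abs_le_iff)
    qed
    then have "u (t, x) + - v (t, x) \<le> \<theta>" if "0 < t" "t \<le> T" "R \<le> \<bar>x\<bar>" for t x
      using cSup_upper[of "u (t, x) - v (t, x)" "A R"] R that by (fastforce simp: A_def)
    then show "\<exists>R. \<forall>t x. 0 < t \<longrightarrow> t \<le> T \<longrightarrow> R \<le> \<bar>x\<bar> \<longrightarrow> u (t, x) + - v (t, x) \<le> \<theta>" by blast
  qed
  then show ?thesis by simp
qed

end
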